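(* Let $\langle\gamma\rangle\in\mathbb{R}\setminus\{0\}$ and consider the one-dimensional cubic Gabitov--Turitsyn equation $$ i u_t+\langle\gamma\rangle\partial_x^2 u+\int_0^1 e^{-i\sigma\partial_x^2}\Big[\big|e^{i\sigma\partial_x^2}u\big|^2\, e^{i\sigma\partial_x^2}u\Big]\,d\sigma=0,\qquad u(0,x)=u_0(x),\quad x\in\mathbb{R}. $$ For every $s<-\frac32$, norm inflation occurs in $H^s$: for all $\epsilon>0$ there exists smooth initial data $u_0$ with corresponding solution $u(t)$ satisfying $$\|u_0\|_{H^s}<\epsilon\quad\text{and}\quad\|u(T)\|_{H^s}>\epsilon^{-1}\quad\text{for some }|T|<\epsilon.$$ As a consequence, for any $T>0$ and any $s<-\frac32$, the data-to-solution map of this equation fails to be continuous at $u_0=0$ from $H^s$ to $C_tH^s_x((-T,T))$.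
   Context: $\|f\|_{H^s}^2=\int(1+|\xi|^2)^s|\widehat f(\xi)|^2d\xi$. The corresponding solution is the unique solution in $C_tL^2_x$ of the Duhamel formula $$u(t)=e^{i\langle\gamma\rangle t\partial_x^2}u_0+i\int_0^t\int_0^1 e^{i\langle\gamma\rangle(t-\tau)\partial_x^2-i\sigma\partial_x^2}\Big[\big|e^{i\sigma\partial_x^2}u(\tau)\big|^2e^{i\sigma\partial_x^2}u(\tau)\Big]d\sigma\,d\tau ,$$ which exists for data in $L^2(\mathbb{R})$. The data-to-solution map is understood as defined on smooth data (in $L^2$); its failure of continuity at $0$ from $H^s$ to $C_tH^s_x((-T,T))$ means that $\|u_0\|_{H^s}\to0$ does not imply $\sup_{|t|<T}\|u(t)\|_{H^s}\to0$. *)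

theory Defs
  imports "HOL-Analysis.Analysis"
begin

section \<open>The Hilbert space of square integrable functions on the line\<close>

definition square_integrable :: "(real \<Rightarrow> complex) \<Rightarrow> bool" where
  "square_integrable f \<longleftrightarrow>
     f \<in> borel_measurable lborel \<and> integrable lborel (\<lambda>x. (cmod (f x))\<^sup>2)"

lemma square_integrable_measurable [measurable_dest]:
  "square_integrable f \<Longrightarrow> f \<in> borel_measurable lborel"
  by (simp add: square_integrable_def)

lemma square_integrable_dominated:
  assumes [measurable]: "f \<in> borel_measurable lborel" and "square_integrable g"
    and "AE x in lborel. cmod (f x) \<le> cmod (g x)"
  shows "square_integrable f"
  unfolding square_integrable_def
proof (intro conjI)
  show "integrable lborel (\<lambda>x. (cmod (f x))\<^sup>2)"
  proof (rule Bochner_Integration.integrable_bound)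
    show "integrable lborel (\<lambda>x. (cmod (g x))\<^sup>2)"
      using assms by (simp add: square_integrable_def)
    show "AE x in lborel. norm ((cmod (f x))\<^sup>2) \<le> norm ((cmod (g x))\<^sup>2)"
      using assms(3) by eventually_elim (simp add: power_mono)
  qed simp
qed fact

lemma square_integrable_0 [simp]: "square_integrable (\<lambda>x. 0)"
  by (simp add: square_integrable_def)

lemma square_integrable_cmult:
  assumes "square_integrable f"
  shows "square_integrable (\<lambda>x. c * f x)"
  unfolding square_integrable_def
proof (intro conjI)
  note [measurable] = square_integrable_measurable [OF assms]
  show "(\<lambda>x. c * f x) \<in> borel_measurable lborel"
    by measurable
  show "integrable lborel (\<lambda>x. (cmod (c * f x))\<^sup>2)"
    using assms by (simp add: square_integrable_def norm_mult power_mult_distrib)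
qed

lemma square_integrable_scaleR:
  assumes "square_integrable f"
  shows "square_integrable (\<lambda>x. r *\<^sub>R f x)"
  using square_integrable_cmult [OF assms, of "of_real r"] by (simp add: scaleR_conv_of_real)

lemma square_integrable_uminus:
  assumes "square_integrable f"
  shows "square_integrable (\<lambda>x. - f x)"
  using square_integrable_cmult [OF assms, of "-1"] by simp

lemma square_integrable_add:
  assumes f: "square_integrable f" and g: "square_integrable g"
  shows "square_integrable (\<lambda>x. f x + g x)"
proof -
  note [measurable] = square_integrable_measurable [OF f] square_integrable_measurable [OF g]
  have "integrable lborel (\<lambda>x. (cmod (f x + g x))\<^sup>2)"
  proof (rule Bochner_Integration.integrable_bound)
    show "integrable lborel (\<lambda>x. 2 * (cmod (f x))\<^sup>2 + 2 * (cmod (g x))\<^sup>2)"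
      using f g by (auto simp: square_integrable_def)
    have "(cmod (f x + g x))\<^sup>2 \<le> 2 * (cmod (f x))\<^sup>2 + 2 * (cmod (g x))\<^sup>2" for x
    proof -
      have "(cmod (f x + g x))\<^sup>2 \<le> (cmod (f x) + cmod (g x))\<^sup>2"
        by (intro power_mono norm_triangle_ineq norm_ge_zero)
      also have "\<dots> \<le> 2 * (cmod (f x))\<^sup>2 + 2 * (cmod (g x))\<^sup>2"
        using sum_squares_bound [of "cmod (f x)" "cmod (g x)"]
        by (simp add: power2_sum)
      finally show ?thesis .
    qed
    then show "AE x in lborel. norm ((cmod (f x + g x))\<^sup>2)
        \<le> norm (2 * (cmod (f x))\<^sup>2 + 2 * (cmod (g x))\<^sup>2)"
      by (intro AE_I2) (simp add: abs_of_nonneg)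
  qed simp
  then show ?thesis
    by (simp add: square_integrable_def)
qed

lemma square_integrable_diff:
  assumes "square_integrable f" "square_integrable g"
  shows "square_integrable (\<lambda>x. f x - g x)"
  using square_integrable_add [OF assms(1) square_integrable_uminus [OF assms(2)]] by simp

lemma integrable_inner_square_integrable:
  assumes f: "square_integrable f" and g: "square_integrable g"
  shows "integrable lborel (\<lambda>x. f x \<bullet> g x)"
proof (rule Bochner_Integration.integrable_bound)
  note [measurable] = square_integrable_measurable [OF f] square_integrable_measurable [OF g]
  show "integrable lborel (\<lambda>x. (cmod (f x))\<^sup>2 + (cmod (g x))\<^sup>2)"
    using f g by (auto simp: square_integrable_def)
  show "(\<lambda>x. f x \<bullet> g x) \<in> borel_measurable lborel"
    by measurable
  have "\<bar>f x \<bullet> g x\<bar> \<le> (cmod (f x))\<^sup>2 + (cmod (g x))\<^sup>2" for x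
  proof -
    have "0 \<le> cmod (f x) * cmod (g x)" by simp
    then show ?thesis
      using Cauchy_Schwarz_ineq2 [of "f x" "g x"] sum_squares_bound [of "cmod (f x)" "cmod (g x)"]
      by linarith
  qed
  then show "AE x in lborel. norm (f x \<bullet> g x) \<le> norm ((cmod (f x))\<^sup>2 + (cmod (g x))\<^sup>2)"
    by (intro AE_I2) (simp add: abs_of_nonneg)
qed

definition L2_rel :: "(real \<Rightarrow> complex) \<Rightarrow> (real \<Rightarrow> complex) \<Rightarrow> bool" where
  "L2_rel f g \<longleftrightarrow> square_integrable f \<and> square_integrable g \<and> (AE x in lborel. f x = g x)"

quotient_type L2 = "real \<Rightarrow> complex" / partial: L2_rel
proof (rule part_equivpI)
  show "\<exists>f. L2_rel f f"
    by (intro exI [of _ "\<lambda>x. 0"]) (simp add: L2_rel_def)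
  show "symp L2_rel"
    by (auto simp: symp_def L2_rel_def elim: eventually_mono)
  show "transp L2_rel"
    unfolding transp_def L2_rel_def by (auto elim: eventually_elim2)
qed

instantiation L2 :: real_inner
begin

lift_definition zero_L2 :: L2 is "\<lambda>x. 0"
  by (simp add: L2_rel_def)

lift_definition plus_L2 :: "L2 \<Rightarrow> L2 \<Rightarrow> L2" is "\<lambda>f g x. f x + g x"
  unfolding L2_rel_def by (auto intro: square_integrable_add elim: eventually_elim2)

lift_definition uminus_L2 :: "L2 \<Rightarrow> L2" is "\<lambda>f x. - f x"
  unfolding L2_rel_def by (auto intro: square_integrable_uminus elim: eventually_mono)

lift_definition minus_L2 :: "L2 \<Rightarrow> L2 \<Rightarrow> L2" is "\<lambda>f g x. f x - g x"
  unfolding L2_rel_def by (auto intro: square_integrable_diff elim: eventually_elim2)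

lift_definition scaleR_L2 :: "real \<Rightarrow> L2 \<Rightarrow> L2" is "\<lambda>r f x. r *\<^sub>R f x"
  unfolding L2_rel_def by (auto intro: square_integrable_scaleR elim: eventually_mono)

lift_definition inner_L2 :: "L2 \<Rightarrow> L2 \<Rightarrow> real" is "\<lambda>f g. LBINT x. f x \<bullet> g x"
proof -
  fix f f' g g' :: "real \<Rightarrow> complex"
  assume *: "L2_rel f f'" "L2_rel g g'"
  then have [measurable]: "f \<in> borel_measurable lborel" "f' \<in> borel_measurable lborel"
    "g \<in> borel_measurable lborel" "g' \<in> borel_measurable lborel"
    by (auto simp: L2_rel_def square_integrable_def)
  show "(LBINT x. f x \<bullet> g x) = (LBINT x. f' x \<bullet> g' x)"
  proof (rule integral_cong_AE)
    have "AE x in lborel. f x = f' x" "AE x in lborel. g x = g' x"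
      using * by (auto simp: L2_rel_def)
    then show "AE x in lborel. f x \<bullet> g x = f' x \<bullet> g' x"
      by eventually_elim simp
  qed measurable
qed

definition norm_L2 :: "L2 \<Rightarrow> real" where
  "norm_L2 u = sqrt (u \<bullet> u)"

definition dist_L2 :: "L2 \<Rightarrow> L2 \<Rightarrow> real" where
  "dist_L2 u v = norm (u - v)"

definition sgn_L2 :: "L2 \<Rightarrow> L2" where
  "sgn_L2 u = inverse (norm u) *\<^sub>R u"

definition uniformity_L2 :: "(L2 \<times> L2) filter" where
  "uniformity_L2 = (INF e\<in>{0 <..}. principal {(u, v). dist u v < e})"

definition open_L2 :: "L2 set \<Rightarrow> bool" where
  "open_L2 U \<longleftrightarrow> (\<forall>u\<in>U. \<forall>\<^sub>F (v, w) in uniformity. v = u \<longrightarrow> w \<in> U)"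

instance
proof
  fix u v w :: L2 and a b r :: real and U :: "L2 set"
  show "dist u v = norm (u - v)" by (fact dist_L2_def)
  show "sgn u = inverse (norm u) *\<^sub>R u" by (fact sgn_L2_def)
  show "uniformity = (INF e\<in>{0 <..}. principal {(u::L2, v). dist u v < e})"
    by (fact uniformity_L2_def)
  show "open U \<longleftrightarrow> (\<forall>u\<in>U. \<forall>\<^sub>F (v, w) in uniformity. v = u \<longrightarrow> w \<in> U)"
    by (fact open_L2_def)
  show "norm u = sqrt (u \<bullet> u)" by (fact norm_L2_def)
  show "u + v + w = u + (v + w)"
    by transfer (auto simp: L2_rel_def add.assoc intro!: square_integrable_add)
  show "u + v = v + u"
    by transfer (auto simp: L2_rel_def add.commute intro!: square_integrable_add)
  show "0 + u = u"
    by transfer (auto simp: L2_rel_def)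
  show "- u + u = 0"
    by transfer (auto simp: L2_rel_def)
  show "u - v = u + - v"
    by transfer (auto simp: L2_rel_def intro!: square_integrable_diff)
  show "a *\<^sub>R (u + v) = a *\<^sub>R u + a *\<^sub>R v"
    by transfer (auto simp: L2_rel_def scaleR_add_right
        intro!: square_integrable_add square_integrable_scaleR)
  show "(a + b) *\<^sub>R u = a *\<^sub>R u + b *\<^sub>R u"
    by transfer (auto simp: L2_rel_def scaleR_add_left
        intro!: square_integrable_add square_integrable_scaleR)
  show "a *\<^sub>R b *\<^sub>R u = (a * b) *\<^sub>R u"
    by transfer (auto simp: L2_rel_def intro!: square_integrable_scaleR)
  show "1 *\<^sub>R u = u"
    by transfer (auto simp: L2_rel_def)
  show "u \<bullet> v = v \<bullet> u"
    by transfer (simp add: inner_commute)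
  show "(u + v) \<bullet> w = u \<bullet> w + v \<bullet> w"
    by transfer (simp add: inner_add_left L2_rel_def integrable_inner_square_integrable)
  show "(r *\<^sub>R u) \<bullet> v = r * (u \<bullet> v)"
    by transfer simp
  show "0 \<le> u \<bullet> u"
    by transfer (simp add: Bochner_Integration.integral_nonneg)
  show "u \<bullet> u = 0 \<longleftrightarrow> u = 0"
  proof (transfer, goal_cases)
    case (1 f)
    have "(LBINT x. f x \<bullet> f x) = 0 \<longleftrightarrow> (AE x in lborel. f x \<bullet> f x = 0)"
      using 1 by (intro integral_nonneg_eq_0_iff_AE integrable_inner_square_integrable)
        (auto simp: L2_rel_def)
    then show ?case
      using 1 by (simp add: L2_rel_def)
  qed
qed

end

text \<open>The equivalence class of \<open>f\<close>, with default value \<open>0\<close> if \<open>f\<close> is not square integrable.\<close>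

definition L2_of :: "(real \<Rightarrow> complex) \<Rightarrow> L2" where
  "L2_of f = (if square_integrable f then abs_L2 f else 0)"

lemma square_integrable_rep_L2 [simp]: "square_integrable (rep_L2 u)"
  using Quotient3_rep_reflp [OF Quotient3_L2, of u] by (simp add: L2_rel_def)

lemma rep_L2_measurable [measurable]: "rep_L2 u \<in> borel_measurable lborel"
  using square_integrable_rep_L2 square_integrable_def by blast

lemma L2_of_rep_L2 [simp]: "L2_of (rep_L2 u) = u"
  by (simp add: L2_of_def Quotient3_abs_rep [OF Quotient3_L2])

lemma L2_of_eq_iff:
  assumes "square_integrable f" "square_integrable g"
  shows "L2_of f = L2_of g \<longleftrightarrow> (AE x in lborel. f x = g x)"
  using assms Quotient3_rel [OF Quotient3_L2, of f g] by (auto simp: L2_of_def L2_rel_def)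

lemma AE_rep_L2_of:
  assumes "square_integrable f"
  shows "AE x in lborel. rep_L2 (L2_of f) x = f x"
  using L2_of_eq_iff [OF square_integrable_rep_L2 assms, of "L2_of f"] by simp

lemma L2_of_add:
  "square_integrable f \<Longrightarrow> square_integrable g \<Longrightarrow> L2_of (\<lambda>x. f x + g x) = L2_of f + L2_of g"
  by (simp add: L2_of_def square_integrable_add plus_L2.abs_eq L2_rel_def)

lemma L2_of_diff:
  "square_integrable f \<Longrightarrow> square_integrable g \<Longrightarrow> L2_of (\<lambda>x. f x - g x) = L2_of f - L2_of g"
  by (simp add: L2_of_def square_integrable_diff minus_L2.abs_eq L2_rel_def)

lemma L2_of_scaleR:
  "square_integrable f \<Longrightarrow> L2_of (\<lambda>x. r *\<^sub>R f x) = r *\<^sub>R L2_of f"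
  by (simp add: L2_of_def square_integrable_scaleR scaleR_L2.abs_eq L2_rel_def)

lemma L2_of_0: "L2_of (\<lambda>x. 0) = 0"
  by (simp add: L2_of_def zero_L2_def)

lemma L2_of_sum:
  assumes "\<And>i. i \<in> I \<Longrightarrow> square_integrable (f i)"
  shows "square_integrable (\<lambda>x. \<Sum>i\<in>I. f i x) \<and> L2_of (\<lambda>x. \<Sum>i\<in>I. f i x) = (\<Sum>i\<in>I. L2_of (f i))"
  using assms
  by (induct I rule: infinite_finite_induct)
     (simp_all add: L2_of_0 square_integrable_add L2_of_add)

lemma norm_L2_of:
  "square_integrable f \<Longrightarrow> norm (L2_of f) = sqrt (LBINT x. (cmod (f x))\<^sup>2)"
  by (simp add: norm_L2_def L2_of_def inner_L2.abs_eq L2_rel_def power2_norm_eq_inner)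

lemma norm_L2_rep: "norm u = sqrt (LBINT x. (cmod (rep_L2 u x))\<^sup>2)"
  using norm_L2_of [OF square_integrable_rep_L2, of u] by simp

lemma norm_L2_of_ennreal:
  assumes "square_integrable f"
  shows "ennreal ((norm (L2_of f))\<^sup>2) = (\<integral>\<^sup>+x. ennreal ((cmod (f x))\<^sup>2) \<partial>lborel)"
  using assms
  by (subst nn_integral_eq_integral)
     (auto simp: norm_L2_of square_integrable_def Bochner_Integration.integral_nonneg)

lemma square_integrable_nn_integral:
  assumes "f \<in> borel_measurable lborel" "(\<integral>\<^sup>+x. ennreal ((cmod (f x))\<^sup>2) \<partial>lborel) < \<infinity>"
  shows "square_integrable f"
  unfolding square_integrable_def
  using assms by (intro conjI integrableI_bounded) auto

instance L2 :: banach
proof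
  fix X :: "nat \<Rightarrow> L2"
  assume X: "Cauchy X"
  have "\<exists>r. strict_mono r \<and> (\<forall>k. \<forall>m\<ge>r k. \<forall>n\<ge>r k. dist (X m) (X n) < (1/2) ^ k)"
  proof -
    have "\<forall>k. \<exists>N. \<forall>m\<ge>N. \<forall>n\<ge>N. dist (X m) (X n) < (1/2) ^ k"
      using X by (auto simp: Cauchy_def)
    then obtain N where N: "\<And>k m n. m \<ge> N k \<Longrightarrow> n \<ge> N k \<Longrightarrow> dist (X m) (X n) < (1/2) ^ k"
      by metis
    define r where "r = rec_nat (N 0) (\<lambda>k m. max (Suc m) (N (Suc k)))"
    have "strict_mono r"
      by (rule strict_monoI_Suc) (simp add: r_def)
    moreover have "r k \<ge> N k" for k
      by (cases k) (auto simp: r_def)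
    ultimately show ?thesis
      using N by (meson order_trans)
  qed
  then obtain r :: "nat \<Rightarrow> nat" where r: "strict_mono r"
    and r_dist: "\<And>k m n. m \<ge> r k \<Longrightarrow> n \<ge> r k \<Longrightarrow> dist (X m) (X n) < (1/2) ^ k"
    by metis
  define F where "F k = rep_L2 (X (r k))" for k
  have F [simp]: "square_integrable (F k)" and XF: "L2_of (F k) = X (r k)" for k
    by (simp_all add: F_def)
  have [measurable]: "F k \<in> borel_measurable lborel" for k
    by (simp add: F_def)
  have diff: "(\<integral>\<^sup>+x. ennreal ((cmod (F m x - F n x))\<^sup>2) \<partial>lborel) \<le> ennreal ((1/4) ^ k)"
    if "m \<ge> k" "n \<ge> k" for m n k
  proof -
    have "norm (L2_of (F m) - L2_of (F n)) < (1/2) ^ k"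
      using r_dist [of k "r m" "r n"] that r
      by (simp add: XF dist_norm strict_mono_less_eq)
    then have "(norm (L2_of (\<lambda>x. F m x - F n x)))\<^sup>2 \<le> ((1/2) ^ k)\<^sup>2"
      by (intro power_mono) (auto simp: L2_of_diff)
    also have "((1/2) ^ k)\<^sup>2 = (1/4 :: real) ^ k"
      by (simp add: power2_eq_square flip: power_mult_distrib)
    finally show ?thesis
      by (subst norm_L2_of_ennreal [symmetric]) (auto intro: square_integrable_diff ennreal_leI)
  qed
  have "AE x in lborel. (\<Sum>k. ennreal (2 ^ k * (cmod (F (Suc k) x - F k x))\<^sup>2)) \<noteq> \<infinity>"
  proof (rule nn_integral_PInf_AE)
    have "(\<integral>\<^sup>+x. (\<Sum>k. ennreal (2 ^ k * (cmod (F (Suc k) x - F k x))\<^sup>2)) \<partial>lborel)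
        = (\<Sum>k. \<integral>\<^sup>+x. ennreal (2 ^ k * (cmod (F (Suc k) x - F k x))\<^sup>2) \<partial>lborel)"
      by (rule nn_integral_suminf) measurable
    also have "\<dots> \<le> (\<Sum>k. ennreal ((1/2) ^ k))"
    proof (intro suminf_le allI)
      fix k
      have "(\<integral>\<^sup>+x. ennreal (2 ^ k * (cmod (F (Suc k) x - F k x))\<^sup>2) \<partial>lborel)
          = ennreal (2 ^ k) * (\<integral>\<^sup>+x. ennreal ((cmod (F (Suc k) x - F k x))\<^sup>2) \<partial>lborel)"
        by (subst nn_integral_cmult [symmetric]) (auto simp: ennreal_mult)
      also have "\<dots> \<le> ennreal (2 ^ k) * ennreal ((1/4) ^ k)"
        by (intro mult_left_mono diff) auto
      also have "\<dots> = ennreal ((1/2) ^ k)"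
        by (simp add: ennreal_mult [symmetric] flip: power_mult_distrib)
      finally show "(\<integral>\<^sup>+x. ennreal (2 ^ k * (cmod (F (Suc k) x - F k x))\<^sup>2) \<partial>lborel)
          \<le> ennreal ((1/2) ^ k)" .
    qed auto
    also have "\<dots> < \<infinity>"
      by (subst suminf_ennreal2) (auto intro!: summable_geometric)
    finally show "(\<integral>\<^sup>+x. (\<Sum>k. ennreal (2 ^ k * (cmod (F (Suc k) x - F k x))\<^sup>2)) \<partial>lborel) \<noteq> \<infinity>"
      by simp
  qed measurable
  then have conv: "AE x in lborel. convergent (\<lambda>k. F k x)"
  proof eventually_elim
    case (elim x)
    define d where "d k = F (Suc k) x - F k x" for k
    have "summable (\<lambda>k. 2 ^ k * (cmod (d k))\<^sup>2)"
      using elim by (intro summable_suminf_not_top) (auto simp: d_def)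
    then have "(\<lambda>k. 2 ^ k * (cmod (d k))\<^sup>2) \<longlonglongrightarrow> 0"
      by (rule summable_LIMSEQ_zero)
    then have "\<forall>\<^sub>F k in sequentially. 2 ^ k * (cmod (d k))\<^sup>2 < 1"
      by (rule order_tendstoD) simp
    then have "\<forall>\<^sub>F k in sequentially. norm (d k) \<le> (sqrt (1/2)) ^ k"
    proof eventually_elim
      case (elim k)
      have "(cmod (d k))\<^sup>2 \<le> (1/2) ^ k"
        using elim by (simp add: power_divide field_simps)
      also have "(1/2 :: real) ^ k = ((sqrt (1/2)) ^ k)\<^sup>2"
        by (simp add: power2_eq_square flip: power_mult_distrib)
      finally show ?case
        by (rule power2_le_imp_le) simp
    qed
    moreover have "summable (\<lambda>k. (sqrt (1/2)) ^ k)"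
      by (rule summable_geometric) (simp add: real_sqrt_divide)
    ultimately have "summable d"
      by (rule summable_comparison_test_ev)
    then have "convergent (\<lambda>n. \<Sum>k<n. d k)"
      by (simp add: summable_iff_convergent)
    then have "convergent (\<lambda>n. F n x - F 0 x)"
      by (simp add: d_def sum_lessThan_telescope [of "\<lambda>k. F k x"])
    then have "convergent (\<lambda>n. (F n x - F 0 x) + F 0 x)"
      by (intro convergent_add convergent_const)
    then show ?case by simp
  qed
  define f where "f x = lim (\<lambda>k. F k x)" for x
  have [measurable]: "f \<in> borel_measurable lborel"
    unfolding f_def by (rule borel_measurable_lim_metric) measurable
  have lim: "AE x in lborel. (\<lambda>k. F k x) \<longlonglongrightarrow> f x"
    using conv by eventually_elim (simp add: f_def convergent_LIMSEQ_iff)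
  have tail: "(\<integral>\<^sup>+x. ennreal ((cmod (f x - F k x))\<^sup>2) \<partial>lborel) \<le> ennreal ((1/4) ^ k)" for k
  proof -
    have "(\<integral>\<^sup>+x. ennreal ((cmod (f x - F k x))\<^sup>2) \<partial>lborel)
        = (\<integral>\<^sup>+x. liminf (\<lambda>m. ennreal ((cmod (F m x - F k x))\<^sup>2)) \<partial>lborel)"
    proof (rule nn_integral_cong_AE)
      show "AE x in lborel. ennreal ((cmod (f x - F k x))\<^sup>2)
          = liminf (\<lambda>m. ennreal ((cmod (F m x - F k x))\<^sup>2))"
        using lim
      proof eventually_elim
        case (elim x)
        have "(\<lambda>m. ennreal ((cmod (F m x - F k x))\<^sup>2)) \<longlonglongrightarrow> ennreal ((cmod (f x - F k x))\<^sup>2)"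
          by (intro tendsto_ennrealI tendsto_intros elim)
        then show ?case
          by (intro lim_imp_Liminf [symmetric]) auto
      qed
    qed
    also have "\<dots> \<le> liminf (\<lambda>m. \<integral>\<^sup>+x. ennreal ((cmod (F m x - F k x))\<^sup>2) \<partial>lborel)"
      by (rule nn_integral_liminf) measurable
    also have "\<dots> \<le> ennreal ((1/4) ^ k)"
      by (rule Liminf_le) (auto intro!: eventually_sequentiallyI [of k] diff)
    finally show ?thesis .
  qed
  have sub: "square_integrable (\<lambda>x. f x - F k x)" for k
    using tail [of k] by (intro square_integrable_nn_integral) (auto simp: le_less_trans)
  have f: "square_integrable f"
    using square_integrable_add [OF sub [of 0] F [of 0]] by simp
  have bound: "norm (L2_of f - X (r k)) \<le> (1/2) ^ k" for k
  proof -
    have "ennreal ((norm (L2_of (\<lambda>x. f x - F k x)))\<^sup>2) \<le> ennreal ((1/4) ^ k)"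
      using tail [of k] by (simp add: norm_L2_of_ennreal sub)
    then have "(norm (L2_of f - X (r k)))\<^sup>2 \<le> (1/4) ^ k"
      by (simp add: L2_of_diff f XF)
    also have "(1/4 :: real) ^ k = ((1/2) ^ k)\<^sup>2"
      by (simp add: power2_eq_square flip: power_mult_distrib)
    finally show ?thesis
      by (rule power2_le_imp_le) simp
  qed
  have "(\<lambda>k. X (r k)) \<longlonglongrightarrow> L2_of f"
  proof -
    show "(\<lambda>k. X (r k)) \<longlonglongrightarrow> L2_of f"
      unfolding LIMSEQ_def
    proof (intro allI impI)
      fix e :: real
      assume "e > 0"
      then obtain K where K: "(1/2 :: real) ^ K < e"
        using real_arch_pow_inv [of e "1/2"] by auto
      have "dist (X (r k)) (L2_of f) < e" if "k \<ge> K" for k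
      proof -
        have "dist (X (r k)) (L2_of f) \<le> (1/2) ^ k"
          using bound [of k] by (simp add: dist_norm norm_minus_commute)
        also have "\<dots> \<le> (1/2) ^ K"
          using that by (intro power_decreasing) auto
        finally show ?thesis using K by simp
      qed
      then show "\<exists>K. \<forall>k\<ge>K. dist (X (r k)) (L2_of f) < e" by blast
    qed
  qed
  then have "X \<longlonglongrightarrow> L2_of f"
    by (intro Cauchy_converges_subseq [OF X r]) (simp add: comp_def)
  then show "convergent X"
    by (rule convergentI)
qed

lemma L2_of_tendsto_dominated:
  assumes f [measurable]: "f \<in> borel_measurable lborel"
    and F [measurable]: "\<And>n. F n \<in> borel_measurable lborel"
    and g: "square_integrable g"
    and bound: "\<And>n x. cmod (F n x) \<le> cmod (g x)"
    and lim: "\<And>x. (\<lambda>n. F n x) \<longlonglongrightarrow> f x"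
  shows "(\<lambda>n. L2_of (F n)) \<longlonglongrightarrow> L2_of f"
proof -
  have bound': "cmod (f x) \<le> cmod (g x)" for x
    by (rule LIMSEQ_le_const2 [OF tendsto_norm [OF lim]]) (use bound in auto)
  have F': "square_integrable (F n)" and f': "square_integrable f" for n
    using bound bound' by (auto intro!: square_integrable_dominated [OF _ g])
  have "(\<lambda>n. LBINT x. (cmod (F n x - f x))\<^sup>2) \<longlonglongrightarrow> (LBINT (x::real). 0)"
  proof (rule integral_dominated_convergence)
    show "integrable lborel (\<lambda>x. 4 * (cmod (g x))\<^sup>2)"
      using g by (simp add: square_integrable_def)
    show "AE x in lborel. (\<lambda>n. (cmod (F n x - f x))\<^sup>2) \<longlonglongrightarrow> 0"
    proof (intro AE_I2)
      fix x
      have "(\<lambda>n. (cmod (F n x - f x))\<^sup>2) \<longlonglongrightarrow> (cmod (f x - f x))\<^sup>2"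
        by (intro tendsto_intros lim)
      then show "(\<lambda>n. (cmod (F n x - f x))\<^sup>2) \<longlonglongrightarrow> 0" by simp
    qed
    show "AE x in lborel. norm ((cmod (F n x - f x))\<^sup>2) \<le> 4 * (cmod (g x))\<^sup>2" for n
    proof (intro AE_I2)
      fix x
      have "cmod (F n x - f x) \<le> 2 * cmod (g x)"
        using norm_triangle_ineq4 [of "F n x" "f x"] bound [of n x] bound' [of x] by linarith
      then have "(cmod (F n x - f x))\<^sup>2 \<le> (2 * cmod (g x))\<^sup>2"
        by (intro power_mono) auto
      then show "norm ((cmod (F n x - f x))\<^sup>2) \<le> 4 * (cmod (g x))\<^sup>2"
        by (simp add: power_mult_distrib)
    qed
  qed measurable
  then have "(\<lambda>n. sqrt (LBINT x. (cmod (F n x - f x))\<^sup>2)) \<longlonglongrightarrow> sqrt 0"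
    by (intro tendsto_real_sqrt) simp
  moreover have "sqrt (LBINT x. (cmod (F n x - f x))\<^sup>2) = norm (L2_of (F n) - L2_of f)" for n
    using norm_L2_of [OF square_integrable_diff [OF F' f']] by (simp only: L2_of_diff [OF F' f'])
  ultimately have "(\<lambda>n. norm (L2_of (F n) - L2_of f)) \<longlonglongrightarrow> 0"
    by simp
  then show ?thesis
    by (rule LIM_zero_cancel [OF tendsto_norm_zero_cancel])
qed

text \<open>
  Separability: the finite sums of functions \<open>c * indicator {a<..b}\<close> with \<open>a\<close>, \<open>b\<close> rational and
  \<open>c\<close> a Gaussian rational are dense.
\<close>

definition step_L2 :: "complex \<Rightarrow> real set \<Rightarrow> L2" where
  "step_L2 c A = L2_of (\<lambda>x. c * indicator A x)"

definition rat_step_L2 :: "(rat \<times> rat \<times> rat \<times> rat) list \<Rightarrow> L2" where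
  "rat_step_L2 xs =
     (\<Sum>(p, q, a, b) \<leftarrow> xs. step_L2 (Complex (of_rat p) (of_rat q)) {of_rat a<..of_rat b})"

lemma square_integrable_indicator:
  assumes [measurable]: "A \<in> sets borel" and "A \<subseteq> {a..b}"
  shows "square_integrable (\<lambda>x. c * indicator A x)"
proof -
  have "emeasure lborel A \<le> emeasure lborel {a..b}"
    using assms by (intro emeasure_mono) auto
  also have "\<dots> < \<infinity>"
    by (simp add: emeasure_lborel_Icc_eq)
  finally have "integrable lborel (indicator A :: real \<Rightarrow> real)"
    by (simp add: integrable_indicator_iff)
  then have "integrable lborel (\<lambda>x. (cmod c)\<^sup>2 * indicator A x)"
    by simp
  also have "(\<lambda>x. (cmod c)\<^sup>2 * indicator A x) = (\<lambda>x. (cmod (c * indicator A x))\<^sup>2)"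
    by (auto simp: indicator_def fun_eq_iff)
  finally show ?thesis
    by (simp add: square_integrable_def)
qed

lemma step_L2_add:
  assumes "A \<in> sets borel" "A \<subseteq> {a..b}" "B \<in> sets borel" "B \<subseteq> {a..b}"
    and eq: "\<And>x. c * indicator C x = p * indicator A x + q * indicator B x"
  shows "step_L2 c C = step_L2 p A + step_L2 q B"
  using assms(1-4) unfolding step_L2_def eq
  by (intro L2_of_add square_integrable_indicator)

lemma ex_rat_sequence: "\<exists>q :: nat \<Rightarrow> rat. (\<lambda>n. of_rat (q n)) \<longlonglongrightarrow> a \<and>
  (\<forall>n. a < of_rat (q n) \<and> of_rat (q n) < a + 1)" for a :: real
proof -
  have "\<exists>q. a < of_rat q \<and> of_rat q < a + 1 / real (Suc n)" for n
    by (rule of_rat_dense) simp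
  then obtain q where q: "\<And>n. a < of_rat (q n)" "\<And>n. of_rat (q n) < a + 1 / real (Suc n)"
    by metis
  have "(\<lambda>n. of_rat (q n)) \<longlonglongrightarrow> a"
  proof (rule tendsto_sandwich [OF _ _ tendsto_const])
    show "(\<lambda>n. a + 1 / real (Suc n)) \<longlonglongrightarrow> a"
      using tendsto_add [OF tendsto_const LIMSEQ_Suc [OF lim_1_over_n], of a] by simp
  qed (use q in \<open>auto intro!: always_eventually less_imp_le\<close>)
  moreover have "of_rat (q n) < a + 1" for n
    using q(2) [of n] by (rule less_le_trans) simp
  ultimately show ?thesis
    using q by blast
qed

lemma closure_rat_step_L2: "closure (range rat_step_L2) = UNIV"
proof -
  define V where "V = closure (range rat_step_L2)"
  have V_lim: "u \<in> V" if "\<And>n. U n \<in> V" "U \<longlonglongrightarrow> u" for U u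
    using that(1) that(2) unfolding V_def by (rule closed_sequentially [OF closed_closure])
  have V_base: "rat_step_L2 xs \<in> V" for xs
    unfolding V_def by (rule subsetD [OF closure_subset rangeI])
  have V_0: "0 \<in> V"
    using V_base [of "[]"] by (simp add: rat_step_L2_def)
  have V_add: "u + v \<in> V" if uv: "u \<in> V" "v \<in> V" for u v
  proof -
    have "\<exists>U. (\<forall>n. U n \<in> range rat_step_L2) \<and> U \<longlonglongrightarrow> u"
      using uv(1) unfolding V_def by (subst (asm) closure_sequential)
    then obtain U where U: "\<And>n. U n \<in> range rat_step_L2" "U \<longlonglongrightarrow> u"
      by blast
    have "\<exists>W. (\<forall>n. W n \<in> range rat_step_L2) \<and> W \<longlonglongrightarrow> v"
      using uv(2) unfolding V_def by (subst (asm) closure_sequential)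
    then obtain W where W: "\<And>n. W n \<in> range rat_step_L2" "W \<longlonglongrightarrow> v"
      by blast
    have "U n + W n \<in> V" for n
    proof -
      obtain xs ys where "U n = rat_step_L2 xs" "W n = rat_step_L2 ys"
        using U(1) [of n] W(1) [of n] by (auto simp: image_iff)
      then have "U n + W n = rat_step_L2 (xs @ ys)"
        by (simp add: rat_step_L2_def)
      then show ?thesis using V_base by simp
    qed
    then show ?thesis
      using tendsto_add [OF U(2) W(2)] by (rule V_lim)
  qed
  have V_sum: "(\<Sum>i\<in>I. u i) \<in> V" if "\<And>i. i \<in> I \<Longrightarrow> u i \<in> V" for I :: "'i set" and u
    using that by (induct I rule: infinite_finite_induct) (simp_all add: V_0 V_add)
  have V_Ioc: "step_L2 c {a<..b} \<in> V" for c a b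
  proof (cases "a \<le> b")
    case True
    obtain A where A: "(\<lambda>n. of_rat (A n)) \<longlonglongrightarrow> a" "\<And>n. a < of_rat (A n)"
      using ex_rat_sequence [of a] by blast
    obtain B where B: "(\<lambda>n. of_rat (B n)) \<longlonglongrightarrow> b" "\<And>n. b < of_rat (B n)" "\<And>n. of_rat (B n) < b + 1"
      using ex_rat_sequence [of b] by blast
    obtain P where P: "(\<lambda>n. of_rat (P n)) \<longlonglongrightarrow> Re c" "\<And>n. Re c < of_rat (P n)" "\<And>n. of_rat (P n) < Re c + 1"
      using ex_rat_sequence [of "Re c"] by blast
    obtain Q where Q: "(\<lambda>n. of_rat (Q n)) \<longlonglongrightarrow> Im c" "\<And>n. Im c < of_rat (Q n)" "\<And>n. of_rat (Q n) < Im c + 1"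
      using ex_rat_sequence [of "Im c"] by blast
    define C where "C n = Complex (of_rat (P n)) (of_rat (Q n))" for n
    have C: "C \<longlonglongrightarrow> c"
      using tendsto_Complex [OF P(1) Q(1)] by (simp add: C_def [abs_def])
    have C_bound: "cmod (C n) \<le> cmod c + 2" for n
    proof -
      have "cmod (C n - c) \<le> \<bar>Re (C n - c)\<bar> + \<bar>Im (C n - c)\<bar>"
        by (rule cmod_le)
      also have "\<dots> \<le> 2"
        using P(2,3) [of n] Q(2,3) [of n] by (simp add: C_def)
      finally show ?thesis
        using norm_triangle_ineq2 [of "C n" c] by linarith
    qed
    have "(\<lambda>n. step_L2 (C n) {of_rat (A n)<..of_rat (B n)}) \<longlonglongrightarrow> step_L2 c {a<..b}"
      unfolding step_L2_def
    proof (rule L2_of_tendsto_dominated)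
      show "square_integrable (\<lambda>x. complex_of_real (cmod c + 2) * indicator {a<..b+1} x)"
        by (rule square_integrable_indicator [of _ a "b + 1"]) auto
      show "cmod (C n * indicator {of_rat (A n)<..of_rat (B n)} x)
          \<le> cmod (complex_of_real (cmod c + 2) * indicator {a<..b+1} x)" for n x
        using C_bound [of n] A(2) [of n] B(3) [of n]
        by (auto simp: indicator_def norm_mult simp flip: of_real_add)
      fix x :: real
      have "\<forall>\<^sub>F n in sequentially. indicator {of_rat (A n)<..of_rat (B n)} x
          = (indicator {a<..b} x :: complex)"
      proof -
        consider "x \<le> a" | "a < x" "x \<le> b" | "b < x" by linarith
        then show ?thesis
        proof cases
          case 1
          then have "\<not> of_rat (A n) < x" for n
            using A(2) [of n] by simp
          with 1 show ?thesis by (intro always_eventually) (auto simp: indicator_def)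
        next
          case 2
          have "\<forall>\<^sub>F n in sequentially. of_rat (A n) < x"
            using A(1) 2(1) by (rule order_tendstoD)
          then show ?thesis
          proof eventually_elim
            case (elim n)
            then show ?case
              using 2 B(2) [of n] by (auto simp: indicator_def)
          qed
        next
          case 3
          have "\<forall>\<^sub>F n in sequentially. of_rat (B n) < x"
            using B(1) 3 by (rule order_tendstoD)
          then show ?thesis
            by eventually_elim (use 3 in \<open>auto simp: indicator_def\<close>)
        qed
      qed
      then have "(\<lambda>n. indicator {of_rat (A n)<..of_rat (B n)} x) \<longlonglongrightarrow> (indicator {a<..b} x :: complex)"
        by (rule tendsto_eventually)
      with C show "(\<lambda>n. C n * indicator {of_rat (A n)<..of_rat (B n)} x) \<longlonglongrightarrow> c * indicator {a<..b} x"
        by (intro tendsto_mult)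
    qed auto
    moreover have "step_L2 (C n) {of_rat (A n)<..of_rat (B n)} \<in> V" for n
      using V_base [of "[(P n, Q n, A n, B n)]"] by (simp add: rat_step_L2_def C_def)
    ultimately show ?thesis
      by (rule V_lim [rotated])
  next
    case False
    then show ?thesis
      using V_0 by (simp add: step_L2_def L2_of_0)
  qed
  have Ioc_Int_stable: "Int_stable (range (\<lambda>(a, b). {a<..b::real}))"
  proof (rule Int_stableI)
    fix A B :: "real set"
    assume "A \<in> range (\<lambda>(a, b). {a<..b})" "B \<in> range (\<lambda>(a, b). {a<..b})"
    then obtain a b c d where "A = {a<..b}" "B = {c<..d}" by auto
    then have "A \<inter> B = (\<lambda>(a, b). {a<..b}) (max a c, min b d)" by simp
    then show "A \<inter> B \<in> range (\<lambda>(a, b). {a<..b})" by (rule range_eqI)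
  qed
  have V_bounded: "\<forall>c. step_L2 c (A \<inter> {-r<..r}) \<in> V" if "A \<in> sets borel" for A :: "real set" and r
  proof -
    note Ioc_Int_stable
    moreover have "range (\<lambda>(a, b). {a<..b::real}) \<subseteq> Pow UNIV"
      by simp
    moreover have "A \<in> sigma_sets UNIV (range (\<lambda>(a, b). {a<..b::real}))"
      using that by (simp add: borel_sigma_sets_Ioc sets_measure_of)
    ultimately show ?thesis
    proof (induct rule: sigma_sets_induct_disjoint)
      case (basic A)
      then show ?case by (auto simp: Int_greaterThanAtMost intro: V_Ioc)
    next
      case empty
      show ?case using V_0 by (simp add: step_L2_def L2_of_0)
    next
      case (compl A)
      have [measurable]: "A \<in> sets borel"
        using compl(1) by (simp add: borel_sigma_sets_Ioc sets_measure_of)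
      show ?case
      proof
        fix c
        have "step_L2 c ((UNIV - A) \<inter> {-r<..r}) = step_L2 c {-r<..r} + step_L2 (-c) (A \<inter> {-r<..r})"
          by (rule step_L2_add [of _ "-r" r]) (auto simp: indicator_def)
        then show "step_L2 c ((UNIV - A) \<inter> {-r<..r}) \<in> V"
          by (simp add: V_add V_Ioc compl(2) [rule_format])
      qed
    next
      case (union A)
      have [measurable]: "A i \<in> sets borel" for i
        using union(2) by (auto simp: borel_sigma_sets_Ioc sets_measure_of)
      show ?case
      proof
        fix c
        have sum: "(\<Sum>i<n. step_L2 c (A i \<inter> {-r<..r})) = step_L2 c ((\<Union>i<n. A i) \<inter> {-r<..r})" for n
        proof (induct n)
          case 0
          then show ?case by (simp add: step_L2_def L2_of_0)
        next
          case (Suc n)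
          define E where "E = (\<Union>i<n. A i)"
          have [measurable]: "E \<in> sets borel"
            unfolding E_def by measurable
          have "A i \<inter> A n = {}" if "i < n" for i
            using disjoint_family_onD [OF union(1), of i n] that by simp
          then have E: "E \<inter> A n = {}"
            unfolding E_def by blast
          have "(\<Union>i<Suc n. A i) = E \<union> A n"
            by (simp add: E_def lessThan_Suc Un_commute)
          moreover have "step_L2 c ((E \<union> A n) \<inter> {-r<..r})
              = step_L2 c (E \<inter> {-r<..r}) + step_L2 c (A n \<inter> {-r<..r})"
          proof (rule step_L2_add [of _ "-r" r])
            show "c * indicator ((E \<union> A n) \<inter> {-r<..r}) x
                = c * indicator (E \<inter> {-r<..r}) x + c * indicator (A n \<inter> {-r<..r}) x" for x
              using E by (cases "x \<in> E"; cases "x \<in> A n") (auto simp: indicator_def)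
          qed auto
          ultimately have "step_L2 c ((\<Union>i<Suc n. A i) \<inter> {-r<..r})
              = step_L2 c ((\<Union>i<n. A i) \<inter> {-r<..r}) + step_L2 c (A n \<inter> {-r<..r})"
            by (simp add: E_def)
          with Suc show ?case by simp
        qed
        have "(\<lambda>n. step_L2 c ((\<Union>i<n. A i) \<inter> {-r<..r})) \<longlonglongrightarrow> step_L2 c ((\<Union>i. A i) \<inter> {-r<..r})"
          unfolding step_L2_def
        proof (rule L2_of_tendsto_dominated)
          show "square_integrable (\<lambda>x. c * indicator {-r<..r} x)"
            by (rule square_integrable_indicator [of _ "-r" r]) auto
          show "cmod (c * indicator ((\<Union>i<n. A i) \<inter> {-r<..r}) x) \<le> cmod (c * indicator {-r<..r} x)" for n x
            by (auto simp: indicator_def)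
          fix x
          have "\<forall>\<^sub>F n in sequentially. c * indicator ((\<Union>i<n. A i) \<inter> {-r<..r}) x
              = c * indicator ((\<Union>i. A i) \<inter> {-r<..r}) x"
          proof (cases "x \<in> (\<Union>i. A i)")
            case True
            then obtain i where "x \<in> A i" by blast
            then show ?thesis
              by (intro eventually_sequentiallyI [of "Suc i"]) (auto simp: indicator_def)
          next
            case False
            then show ?thesis
              by (intro always_eventually) (auto simp: indicator_def)
          qed
          then show "(\<lambda>n. c * indicator ((\<Union>i<n. A i) \<inter> {-r<..r}) x)
              \<longlonglongrightarrow> c * indicator ((\<Union>i. A i) \<inter> {-r<..r}) x"
            by (rule tendsto_eventually)
        qed measurable
        moreover have "step_L2 c ((\<Union>i<n. A i) \<inter> {-r<..r}) \<in> V" for n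
          unfolding sum [symmetric] using union(3) by (intro V_sum) simp
        ultimately show "step_L2 c ((\<Union>i. A i) \<inter> {-r<..r}) \<in> V"
          by (rule V_lim [rotated])
      qed
    qed
  qed
  have V_step: "step_L2 c A \<in> V"
    if [measurable]: "A \<in> sets borel" and sq: "square_integrable (\<lambda>x. c * indicator A x)" for c A
  proof -
    have "(\<lambda>n. step_L2 c (A \<inter> {- real n<..real n})) \<longlonglongrightarrow> step_L2 c A"
      unfolding step_L2_def
    proof (rule L2_of_tendsto_dominated [OF _ _ sq])
      fix x
      obtain N where N: "\<bar>x\<bar> < real N"
        using reals_Archimedean2 by blast
      have "\<forall>\<^sub>F n in sequentially. c * indicator (A \<inter> {- real n<..real n}) x = c * indicator A x"
        using N by (intro eventually_sequentiallyI [of N]) (auto simp: indicator_def)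
      then show "(\<lambda>n. c * indicator (A \<inter> {- real n<..real n}) x) \<longlonglongrightarrow> c * indicator A x"
        by (rule tendsto_eventually)
    qed (auto simp: indicator_def)
    then show ?thesis
      by (rule V_lim [rotated]) (use V_bounded [OF that(1)] in blast)
  qed
  have "u \<in> V" for u
  proof -
    define f where "f = rep_L2 u"
    have f: "square_integrable f" "L2_of f = u" and [measurable]: "f \<in> borel_measurable lborel"
      by (auto simp: f_def)
    obtain F where F: "\<And>n. simple_function lborel (F n)" "\<And>x. (\<lambda>n. F n x) \<longlonglongrightarrow> f x"
      and F_bound: "\<And>n x. cmod (F n x) \<le> 2 * cmod (f x)"
      using borel_measurable_implies_sequence_metric [of f lborel 0] by auto
    have [measurable]: "F n \<in> borel_measurable lborel" for n
      using F(1) by (rule borel_measurable_simple_function)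
    have f2: "square_integrable (\<lambda>x. 2 * f x)"
      using f(1) by (rule square_integrable_cmult)
    have "(\<lambda>n. L2_of (F n)) \<longlonglongrightarrow> u"
      unfolding f(2) [symmetric]
      by (rule L2_of_tendsto_dominated [OF _ _ f2]) (use F F_bound in \<open>auto simp: norm_mult\<close>)
    moreover have "L2_of (F n) \<in> V" for n
    proof -
      have fin: "finite (range (F n))"
        using simple_functionD(1) [OF F(1) [of n]] by simp
      have sq: "square_integrable (\<lambda>x. y * indicator (F n -` {y}) x)" for y
        by (rule square_integrable_dominated [OF _ f2])
           (use F_bound [of n] in \<open>auto simp: indicator_def norm_mult\<close>)
      have sets: "F n -` {y} \<in> sets borel" for y
        using measurable_sets [of "F n" lborel borel "{y}"] by simp
      have "F n = (\<lambda>x. \<Sum>y\<in>range (F n). y * indicator (F n -` {y}) x)"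
      proof
        fix x
        have "(\<Sum>y\<in>range (F n). y * indicator (F n -` {y}) x)
            = F n x * indicator (F n -` {F n x}) x
              + (\<Sum>y\<in>range (F n) - {F n x}. y * indicator (F n -` {y}) x)"
          using fin by (rule sum.remove) simp
        also have "(\<Sum>y\<in>range (F n) - {F n x}. y * indicator (F n -` {y}) x) = 0"
          by (rule sum.neutral) (auto simp: indicator_def)
        finally show "F n x = (\<Sum>y\<in>range (F n). y * indicator (F n -` {y}) x)"
          by simp
      qed
      then have "L2_of (F n) = L2_of (\<lambda>x. \<Sum>y\<in>range (F n). y * indicator (F n -` {y}) x)"
        by (rule arg_cong)
      also have "\<dots> = (\<Sum>y\<in>range (F n). step_L2 y (F n -` {y}))"
        unfolding step_L2_def by (intro conjunct2 [OF L2_of_sum] sq)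
      also have "\<dots> \<in> V"
        by (intro V_sum V_step sets sq)
      finally show ?thesis .
    qed
    ultimately show ?thesis
      by (rule V_lim [rotated])
  qed
  then show ?thesis
    unfolding V_def by blast
qed

instance L2 :: second_countable_topology
proof
  define B :: "L2 set set" where
    "B = (\<lambda>(xs, q). ball (rat_step_L2 xs) (of_rat q)) ` UNIV"
  have "countable B"
    unfolding B_def by (intro countable_image) simp
  moreover have "open = generate_topology B"
  proof (intro ext iffI)
    fix U :: "L2 set"
    assume "generate_topology B U"
    then show "open U"
    proof induct
      case (Basis b)
      then show ?case by (auto simp: B_def)
    qed (simp_all add: open_Int open_Union)
  next
    fix U :: "L2 set"
    assume U: "open U"
    have "\<exists>b\<in>B. u \<in> b \<and> b \<subseteq> U" if "u \<in> U" for u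
    proof -
      obtain e where e: "e > 0" "ball u e \<subseteq> U"
        using openE [OF U \<open>u \<in> U\<close>] by metis
      obtain q where q: "0 < real_of_rat q" "of_rat q < e / 2"
        using of_rat_dense [of 0 "e / 2"] e(1) by (metis half_gt_zero)
      obtain xs where xs: "dist (rat_step_L2 xs) u < of_rat q"
      proof -
        have "u \<in> closure (range rat_step_L2)"
          by (simp add: closure_rat_step_L2)
        then have "\<exists>v\<in>range rat_step_L2. dist v u < of_rat q"
          using q(1) by (simp add: closure_approachable)
        then show ?thesis using that by blast
      qed
      have "ball (rat_step_L2 xs) (of_rat q) \<subseteq> ball u e"
      proof
        fix v
        assume "v \<in> ball (rat_step_L2 xs) (of_rat q)"
        then have "dist (rat_step_L2 xs) v < of_rat q"
          by simp
        then have "dist u v < of_rat q + of_rat q"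
          using xs dist_triangle3 [of u v "rat_step_L2 xs"] by linarith
        then show "v \<in> ball u e"
          using q(2) by simp
      qed
      moreover have "u \<in> ball (rat_step_L2 xs) (of_rat q)"
        using xs by simp
      moreover have "ball (rat_step_L2 xs) (of_rat q) \<in> B"
        unfolding B_def by (rule image_eqI [of _ _ "(xs, q)"]) simp_all
      ultimately show ?thesis
        using e(2) by (meson subset_trans)
    qed
    then have "U = \<Union>{b \<in> B. b \<subseteq> U}"
      by blast
    moreover have "generate_topology B (\<Union>{b \<in> B. b \<subseteq> U})"
      by (rule generate_topology.UN) (simp add: generate_topology.Basis)
    ultimately show "generate_topology B U"
      by simp
  qed
  ultimately show "\<exists>B :: L2 set set. countable B \<and> open = generate_topology B"
    by blast
qed

section \<open>Fourier transform, Sobolev norms and the Schroedinger group\<close>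

text \<open>
  The unitary Fourier transform on \<open>L2\<close>, as the limit in \<open>L2\<close> for \<open>R \<rightarrow> \<infinity>\<close> of
  \<open>(2 * pi) powr (-1/2) * (\<integral>x\<in>{-R..R}. exp (- i x \<xi>) * u x)\<close>. By Plancherel's theorem the truncated
  integrals are square integrable in \<open>\<xi>\<close>, the limit exists, and \<open>fourier\<close> is bijective.
\<close>

definition fourier :: "L2 \<Rightarrow> L2" where
  "fourier u = Lim at_top (\<lambda>R::real. L2_of (\<lambda>\<xi>.
     (LBINT x:{-R..R}. exp (- \<i> * of_real (x * \<xi>)) * rep_L2 u x) / of_real (sqrt (2 * pi))))"

text \<open>Only used for \<open>s \<le> 0\<close>, where the integral is finite for all \<open>u\<close>.\<close>

definition Hs_norm :: "real \<Rightarrow> L2 \<Rightarrow> real" where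
  "Hs_norm s u = sqrt (LBINT \<xi>. (1 + \<bar>\<xi>\<bar>\<^sup>2) powr s * (cmod (rep_L2 (fourier u) \<xi>))\<^sup>2)"

text \<open>Pointwise multiplication by a bounded measurable function.\<close>

definition mult_L2 :: "(real \<Rightarrow> complex) \<Rightarrow> L2 \<Rightarrow> L2" where
  "mult_L2 m u = L2_of (\<lambda>x. m x * rep_L2 u x)"

text \<open>\<open>exp (i t \<partial>\<^sub>x\<^sup>2)\<close>\<close>

definition schroedinger :: "real \<Rightarrow> L2 \<Rightarrow> L2" where
  "schroedinger t u = inv fourier (mult_L2 (\<lambda>\<xi>. exp (- \<i> * of_real (t * \<xi>\<^sup>2))) (fourier u))"

section \<open>The Gabitov--Turitsyn equation\<close>

definition cubic :: "(real \<Rightarrow> complex) \<Rightarrow> real \<Rightarrow> complex" where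
  "cubic f x = of_real ((cmod (f x))\<^sup>2) * f x"

definition GT_integrand :: "real \<Rightarrow> (real \<Rightarrow> L2) \<Rightarrow> real \<Rightarrow> real \<Rightarrow> real \<Rightarrow> L2" where
  "GT_integrand \<gamma> u t \<tau> \<sigma> =
     schroedinger (\<gamma> * (t - \<tau>) - \<sigma>) (L2_of (cubic (rep_L2 (schroedinger \<sigma> (u \<tau>)))))"

text \<open>
  Solutions in \<open>C\<^sub>tL\<^sup>2\<^sub>x\<close> of the Duhamel formula, for all times in \<open>\<real>\<close>; the integrals are Bochner
  integrals in \<open>L2\<close>. The second and third conditions hold for every continuous \<open>u\<close>, since by the
  Strichartz inequality the \<open>L\<^sup>6\<close> norm of \<open>exp (i \<sigma> \<partial>\<^sub>x\<^sup>2) f\<close> in \<open>(\<sigma>, x) \<in> [0, 1] \<times> \<real>\<close> is finite for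
  \<open>f \<in> L\<^sup>2\<close>; they say that the default values of \<open>L2_of\<close> and of the Bochner integral play no role.
\<close>

definition GT_solution :: "real \<Rightarrow> L2 \<Rightarrow> (real \<Rightarrow> L2) \<Rightarrow> bool" where
  "GT_solution \<gamma> u0 u \<longleftrightarrow>
     continuous_on UNIV u \<and>
     (\<forall>\<tau>. AE \<sigma> in lborel. \<sigma> \<in> {0..1} \<longrightarrow>
        square_integrable (cubic (rep_L2 (schroedinger \<sigma> (u \<tau>))))) \<and>
     (\<forall>t. (\<forall>\<tau>. interval_lebesgue_integrable lborel 0 1 (GT_integrand \<gamma> u t \<tau>)) \<and>
        interval_lebesgue_integrable lborel 0 (ereal t)
          (\<lambda>\<tau>. LBINT \<sigma>=0..1. GT_integrand \<gamma> u t \<tau> \<sigma>)) \<and>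
     (\<forall>t. u t = schroedinger (\<gamma> * t) u0 +
        mult_L2 (\<lambda>x. \<i>) (LBINT \<tau>=0..ereal t. (LBINT \<sigma>=0..1. GT_integrand \<gamma> u t \<tau> \<sigma>)))"

definition smooth_function :: "(real \<Rightarrow> complex) \<Rightarrow> bool" where
  "smooth_function f \<longleftrightarrow> (\<exists>D :: nat \<Rightarrow> real \<Rightarrow> complex. D 0 = f \<and>
     (\<forall>n x. (D n has_vector_derivative D (Suc n) x) (at x)))"

definition smooth_L2 :: "L2 \<Rightarrow> bool" where
  "smooth_L2 u \<longleftrightarrow> (\<exists>f. smooth_function f \<and> square_integrable f \<and> u = L2_of f)"

text \<open>
  Continuity at \<open>0\<close> of the map taking smooth data to the solution, from \<open>H\<^sup>s\<close> to
  \<open>C\<^sub>tH\<^sup>s\<^sub>x((-T, T))\<close>; the solution with data \<open>0\<close> is \<open>0\<close>.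
\<close>

definition GT_continuous_at_0 :: "real \<Rightarrow> real \<Rightarrow> real \<Rightarrow> bool" where
  "GT_continuous_at_0 \<gamma> s T \<longleftrightarrow>
     (\<forall>\<epsilon>>0. \<exists>\<delta>>0. \<forall>u0 u. smooth_L2 u0 \<longrightarrow> GT_solution \<gamma> u0 u \<longrightarrow> Hs_norm s u0 < \<delta> \<longrightarrow>
        (SUP t\<in>{-T<..<T}. ereal (Hs_norm s (u t))) < ereal \<epsilon>)"

end

(*
  Write u(t) = exp(i <gamma> t d_x^2) v(t). On the Fourier side the equation reads v' = i G(v), where G is
  a trilinear convolution over the plane with coordinates p = xi_1 - xi, q = xi_3 - xi; since the
  resonance function is 2pq, averaging over sigma in [0, 1] gives a kernel bounded by
  min(1, 1/|pq|). The kernel min(1, 1/|pq|) is a bounded bilinear form on L^2 (Schur test with the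
  weight |q|^(-1/2)), so bounds on v in L^1 and in L^infinity grow at most exponentially as long as
  the L^2 norm is conserved; this gives global solutions.
  For the inflation take N = m^12, R = m^9, Fourier data R on [N, 4N] and time T = c/N^2. The data
  have size R/N in H^s because s < -3/2. For frequencies in [0, 1] the phases 2pq have size N^2, so
  that the first Picard iterate has size T R^3 there, and gamma T is too small to produce
  cancellation. All other contributions are O(T^2 R^5 N^(1/3)), by min(1, 1/|pq|) <= |pq|^(-11/12),
  which is smaller by a factor m^2; hence the low frequencies of u(T) have size m^3.
*)

theory Submission
  imports Defs "HOL-Probability.Characteristic_Functions"
begin

section \<open>Translations and the Fourier transform of integrable functions\<close>

text \<open>\<open>GT_solution\<close> lives in L^2, where the cubic term makes sense only through
  Strichartz estimates. Keeping the Fourier transform in L^1 and L^infinity avoids them: such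
  functions are bounded in physical space, so the cubic term is square integrable for every \<sigma>
  and locally Lipschitz in L^2. The obstacle is global existence: the bound on the nonlinearity is
  linear in these norms only while the L^2 norm is controlled, and mass is conserved only along a
  solution. Hence the detour through a nonlinearity cut off in L^2. The exponents: small data and a
  large iterate c R^3 / N^2 require R between N^(2/3) and N, and R = N^(3/4) is such a choice. Each
  use of |p|^(-11/12) on an interval of length N costs N^(1/12) = m; two nonlinearities with two
  factors each cost m^4, while T R^2 = c m^(-6), which leaves the gain m^2. The sign matters too:
  for \<open>\<theta> = 0\<close> and p, q > 0 the averaged phase has imaginary part (1 - cos (2 p
  q)) / (2 p q), which is nonnegative, so that the parts of the data cannot cancel each
  other.\<close>

lemma borel_measurable_cis [measurable]: "cis \<in> borel_measurable borel"
  by (intro borel_measurable_continuous_onI continuous_intros)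

lemma AE_lborel_affine:
  fixes c t :: real
  assumes "c \<noteq> 0" "AE x in lborel. P x"
  shows "AE x in lborel. P (t + c * x)"
proof -
  obtain N where N: "N \<in> null_sets lborel" "{x \<in> space lborel. \<not> P x} \<subseteq> N"
    using assms(2) by (auto simp: eventually_ae_filter)
  have [measurable]: "N \<in> sets borel" using N(1) by auto
  have "AE x in lborel. x \<notin> N"
    using N(1) by (rule AE_not_in)
  then have "AE x in lborel. t + c * x \<notin> N"
    by (intro AE_borel_affine assms) measurable
  then show ?thesis
    by eventually_elim (use N(2) in auto)
qed

lemma square_integrable_affine:
  assumes "square_integrable f" "c \<noteq> 0"
  shows "square_integrable (\<lambda>x. f (t + c * x))"
proof -
  note [measurable] = square_integrable_measurable [OF assms(1)]
  have "integrable lborel (\<lambda>x. (cmod (f (t + c * x)))\<^sup>2)"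
    using assms by (intro lborel_integrable_real_affine) (auto simp: square_integrable_def)
  then show ?thesis
    by (simp add: square_integrable_def)
qed

text \<open>One operator for two maps: \<open>c = 1\<close> gives translations,
  \<open>c = - 1\<close> with \<open>t = 0\<close> gives the reflection that relates the Fourier
  transform to its inverse.\<close>

definition affine_L2 :: "real \<Rightarrow> real \<Rightarrow> L2 \<Rightarrow> L2" where
  "affine_L2 c t u = L2_of (\<lambda>x. rep_L2 u (t + c * x))"

lemma affine_L2_of:
  assumes "square_integrable f" "c \<noteq> 0"
  shows "affine_L2 c t (L2_of f) = L2_of (\<lambda>x. f (t + c * x))"
  unfolding affine_L2_def
  using assms by (subst L2_of_eq_iff)
     (auto intro!: square_integrable_affine AE_lborel_affine AE_rep_L2_of)

lemma L2_of_exhaust: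
  obtains f where "square_integrable f" "u = L2_of f"
  using L2_of_rep_L2 square_integrable_rep_L2 by metis

lemma inner_L2_of:
  assumes "square_integrable f" "square_integrable g"
  shows "L2_of f \<bullet> L2_of g = (LBINT x. f x \<bullet> g x)"
  using assms by (simp add: L2_of_def inner_L2.abs_eq L2_rel_def)

lemma L2_of_cong_AE:
  assumes "square_integrable f" "square_integrable g" "AE x in lborel. f x = g x"
  shows "L2_of f = L2_of g"
  using assms by (simp add: L2_of_eq_iff)

lemma norm_affine_L2:
  assumes "\<bar>c\<bar> = 1"
  shows "norm (affine_L2 c t u) = norm u"
proof (cases u rule: L2_of_exhaust)
  case (1 f)
  then have [measurable]: "f \<in> borel_measurable lborel" by (auto simp: square_integrable_def)
  have "c \<noteq> 0" using assms by auto
  then have "(LBINT x. (cmod (f (t + c * x)))\<^sup>2) = (LBINT x. (cmod (f x))\<^sup>2)"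
    using lborel_integral_real_affine [of c "\<lambda>x. (cmod (f x))\<^sup>2" t] assms by simp
  with 1 \<open>c \<noteq> 0\<close> show ?thesis
    by (simp add: affine_L2_of norm_L2_of square_integrable_affine)
qed

lemma affine_L2_diff: "c \<noteq> 0 \<Longrightarrow> affine_L2 c t (u - v) = affine_L2 c t u - affine_L2 c t v"
  by (cases u rule: L2_of_exhaust, cases v rule: L2_of_exhaust)
     (simp add: affine_L2_of square_integrable_affine square_integrable_diff flip: L2_of_diff)

lemma affine_L2_add: "c \<noteq> 0 \<Longrightarrow> affine_L2 c t (u + v) = affine_L2 c t u + affine_L2 c t v"
  by (cases u rule: L2_of_exhaust, cases v rule: L2_of_exhaust)
     (simp add: affine_L2_of square_integrable_affine square_integrable_add flip: L2_of_add)

text \<open>A shifted indicator differs from the original only within distance |h| of the two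
  endpoints, so the squared L^2 distance is at most |c|^2 times 4 |h|.\<close>

lemma translation_step_L2:
  "((\<lambda>h. affine_L2 1 (- h) (step_L2 c {a<..b})) \<longlongrightarrow> step_L2 c {a<..b}) (at 0)"
proof (rule LIM_zero_cancel, rule tendsto_norm_zero_cancel)
  define f where "f x = c * indicator {a<..b} x" for x :: real
  have f: "square_integrable f"
    unfolding f_def by (rule square_integrable_indicator [of _ a b]) auto
  have "\<forall>\<^sub>F h in at 0. norm (affine_L2 1 (- h) (step_L2 c {a<..b}) - step_L2 c {a<..b})
      \<le> sqrt ((cmod c)\<^sup>2 * (4 * \<bar>h\<bar>))"
  proof (intro always_eventually allI)
    fix h :: real
    let ?A = "{a - \<bar>h\<bar>..a + \<bar>h\<bar>}" and ?B = "{b - \<bar>h\<bar>..b + \<bar>h\<bar>}"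
    have *: "square_integrable (\<lambda>x. f (- h + 1 * x))"
      by (rule square_integrable_affine [OF f]) simp
    have "(LBINT x. (cmod (f (- h + 1 * x) - f x))\<^sup>2)
        \<le> (LBINT x. (cmod c)\<^sup>2 * (indicator ?A x + indicator ?B x))"
    proof (rule integral_mono)
      show "integrable lborel (\<lambda>x. (cmod (f (- h + 1 * x) - f x))\<^sup>2)"
        using square_integrable_diff [OF * f] by (simp add: square_integrable_def)
      show "integrable lborel (\<lambda>x. (cmod c)\<^sup>2 * (indicat_real ?A x + indicator ?B x))"
        by (intro integrable_mult_right Bochner_Integration.integrable_add)
           (simp_all add: integrable_indicator_iff emeasure_lborel_Icc_eq)
      show "(cmod (f (- h + 1 * x) - f x))\<^sup>2 \<le> (cmod c)\<^sup>2 * (indicator ?A x + indicator ?B x)" for x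
        by (auto simp: f_def indicator_def norm_mult)
    qed
    also have "\<dots> = (cmod c)\<^sup>2 * (4 * \<bar>h\<bar>)"
      by (simp add: integrable_indicator_iff emeasure_lborel_Icc_eq)
    finally show "norm (affine_L2 1 (- h) (step_L2 c {a<..b}) - step_L2 c {a<..b})
        \<le> sqrt ((cmod c)\<^sup>2 * (4 * \<bar>h\<bar>))"
      unfolding step_L2_def f_def [symmetric]
      by (subst affine_L2_of [OF f])
         (use * f in \<open>simp_all add: norm_L2_of square_integrable_diff flip: L2_of_diff\<close>)
  qed
  moreover have "((\<lambda>h. sqrt ((cmod c)\<^sup>2 * (4 * \<bar>h\<bar>))) \<longlongrightarrow> sqrt ((cmod c)\<^sup>2 * (4 * \<bar>0\<bar>))) (at 0)"
    by (intro tendsto_intros)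
  ultimately show "((\<lambda>h. norm (affine_L2 1 (- h) (step_L2 c {a<..b}) - step_L2 c {a<..b}))
      \<longlongrightarrow> 0) (at 0)"
    by (simp add: tendsto_sandwich [OF always_eventually [OF allI [OF norm_ge_zero]] _ tendsto_const])
qed

text \<open>Translations are isometries, so continuity at h = 0 passes from the dense set of
  rational step functions to all of L^2 by a three-epsilon argument.\<close>

lemma translation_continuous:
  "((\<lambda>h. affine_L2 1 (- h) u) \<longlongrightarrow> u) (at 0)"
proof -
  have rat: "((\<lambda>h. affine_L2 1 (- h) (rat_step_L2 xs)) \<longlongrightarrow> rat_step_L2 xs) (at 0)" for xs
  proof (induct xs)
    case Nil
    show ?case
      by (simp add: rat_step_L2_def L2_of_0 [symmetric] affine_L2_of)
  next
    case (Cons x xs)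
    obtain p q a b where x: "x = (p, q, a, b)" by (cases x)
    have "rat_step_L2 (x # xs) = step_L2 (Complex (of_rat p) (of_rat q)) {of_rat a<..of_rat b}
        + rat_step_L2 xs"
      by (simp add: x rat_step_L2_def)
    then show ?case
      by (simp add: affine_L2_add) (intro tendsto_add Cons translation_step_L2)
  qed
  show ?thesis
  proof (rule tendstoI)
    fix e :: real
    assume "e > 0"
    have "u \<in> closure (range rat_step_L2)"
      by (simp add: closure_rat_step_L2)
    then obtain xs where xs: "dist (rat_step_L2 xs) u < e / 3"
      using \<open>e > 0\<close> unfolding closure_approachable by (auto dest!: spec [of _ "e / 3"])
    define w where "w = rat_step_L2 xs"
    have "\<forall>\<^sub>F h in at 0. dist (affine_L2 1 (- h) w) w < e / 3"
      using rat [of xs] \<open>e > 0\<close> unfolding w_def by (intro tendstoD) simp_all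
    then show "\<forall>\<^sub>F h in at 0. dist (affine_L2 1 (- h) u) u < e"
    proof eventually_elim
      case (elim h)
      have "dist (affine_L2 1 (- h) u) (affine_L2 1 (- h) w) = dist u w"
        unfolding dist_norm by (simp add: norm_affine_L2 flip: affine_L2_diff)
      with elim xs show ?case
        using dist_triangle [of "affine_L2 1 (- h) u" u "affine_L2 1 (- h) w"]
          dist_triangle [of "affine_L2 1 (- h) w" u w]
        by (simp add: w_def dist_commute)
    qed
  qed
qed

section \<open>Fourier integrals of integrable functions and Plancherel's identity\<close>

definition ft :: "(real \<Rightarrow> complex) \<Rightarrow> real \<Rightarrow> complex" where
  "ft f \<xi> = (LBINT x. cis (- (x * \<xi>)) * f x) / of_real (sqrt (2 * pi))"

lemma measurable_ft [measurable]:
  assumes [measurable]: "f \<in> borel_measurable borel"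
  shows "ft f \<in> borel_measurable borel"
  unfolding ft_def [abs_def] by measurable

lemma integrable_mult_pair:
  fixes f :: "'a \<Rightarrow> 'c::{banach,real_normed_field,second_countable_topology}"
  assumes "sigma_finite_measure M1" "sigma_finite_measure M2"
    and f: "integrable M1 f" and g: "integrable M2 g"
  shows "integrable (M1 \<Otimes>\<^sub>M M2) (\<lambda>(x, y). f x * g y)"
proof -
  interpret pair_sigma_finite M1 M2
    using assms(1,2) by (simp add: pair_sigma_finite_def)
  note [measurable] = borel_measurable_integrable [OF f] borel_measurable_integrable [OF g]
  show ?thesis
  proof (rule Fubini_integrable)
    show "integrable M1 (\<lambda>x. LINT y|M2. norm (case (x, y) of (x, y) \<Rightarrow> f x * g y))"
      using f by (simp add: norm_mult)
  qed (use g in auto)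
qed

lemma integrable_cis_mult:
  assumes "integrable lborel f" "g \<in> borel_measurable borel"
  shows "integrable lborel (\<lambda>x. cis (g x) * f x)"
proof (rule Bochner_Integration.integrable_bound [OF assms(1)])
  note [measurable] = assms(2) borel_measurable_integrable [OF assms(1)]
  show "(\<lambda>x. cis (g x) * f x) \<in> borel_measurable lborel"
    by measurable
qed (simp add: norm_mult)

lemma norm_ft_le:
  "cmod (ft f \<xi>) \<le> (LBINT x. cmod (f x))"
proof -
  have "cmod (ft f \<xi>) \<le> (LBINT x. cmod (cis (- (x * \<xi>)) * f x)) / sqrt (2 * pi)"
    unfolding ft_def norm_divide by (intro frac_le integral_norm_bound) (auto intro!: integral_nonneg_AE)
  also have "\<dots> \<le> (LBINT x. cmod (f x)) / 1"
    using pi_ge_two by (intro frac_le) (auto simp: norm_mult intro!: integral_nonneg_AE real_le_rsqrt)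
  finally show ?thesis by simp
qed

lemma ft_add:
  "integrable lborel f \<Longrightarrow> integrable lborel g \<Longrightarrow> ft (\<lambda>x. f x + g x) \<xi> = ft f \<xi> + ft g \<xi>"
  by (simp add: ft_def distrib_left integrable_cis_mult add_divide_distrib)

lemma ft_diff:
  "integrable lborel f \<Longrightarrow> integrable lborel g \<Longrightarrow> ft (\<lambda>x. f x - g x) \<xi> = ft f \<xi> - ft g \<xi>"
  by (simp add: ft_def right_diff_distrib integrable_cis_mult diff_divide_distrib)

lemma ft_cnj: "cnj (ft f \<xi>) = ft (\<lambda>x. cnj (f x)) (- \<xi>)"
proof -
  have "cnj (LBINT x. cis (- (x * \<xi>)) * f x) = (LBINT x. cnj (cis (- (x * \<xi>)) * f x))"
    by (rule Bochner_Integration.integral_cnj [symmetric])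
  then show ?thesis
    by (simp add: ft_def cis_cnj)
qed

text \<open>Both sides are the double integral of cis (- x \<xi>) f(x) g(\<xi>), up to the same
  factor; it converges absolutely because f and g are integrable. The formula contains no
  conjugation, which is why reflections appear once inner products are formed.\<close>

lemma ft_adjoint:
  assumes f: "integrable lborel f" and g: "integrable lborel g"
  shows "(LBINT \<xi>. ft f \<xi> * g \<xi>) = (LBINT x. f x * ft g x)"
proof -
  note [measurable] = borel_measurable_integrable [OF f] borel_measurable_integrable [OF g]
  have *: "integrable (lborel \<Otimes>\<^sub>M lborel) (\<lambda>(x, \<xi>). cis (- (x * \<xi>)) * f x * g \<xi>)"
  proof (rule Bochner_Integration.integrable_bound)
    show "integrable (lborel \<Otimes>\<^sub>M lborel) (\<lambda>(x, \<xi>). f x * g \<xi>)"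
      using f g by (intro integrable_mult_pair) (auto intro: lborel.sigma_finite_measure_axioms)
  qed (auto simp: norm_mult)
  have "(LBINT \<xi>. ft f \<xi> * g \<xi>) = (LBINT \<xi>. LBINT x. cis (- (x * \<xi>)) * f x * g \<xi>) / of_real (sqrt (2 * pi))"
    by (simp add: ft_def)
  also have "(LBINT \<xi>. LBINT x. cis (- (x * \<xi>)) * f x * g \<xi>) = (LBINT x. LBINT \<xi>. cis (- (x * \<xi>)) * f x * g \<xi>)"
    by (rule lborel_pair.Fubini_integral [OF *])
  also have "\<dots> = (LBINT x. f x * (LBINT \<xi>. cis (- (\<xi> * x)) * g \<xi>))"
    by (simp add: mult_ac flip: integral_mult_right_zero)
  finally show ?thesis
    by (simp add: ft_def)
qed

text \<open>After rescaling \<xi> by 1/\<epsilon> this is the characteristic function of the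
  standard normal distribution at (s - t)/\<epsilon>.\<close>

lemma ft_gaussian:
  assumes "\<epsilon> > 0"
  shows "integrable lborel (\<lambda>\<xi>. complex_of_real (exp (- (\<epsilon> * \<xi>)\<^sup>2 / 2)))"
    and "ft (\<lambda>\<xi>. cis (s * \<xi>) * complex_of_real (exp (- (\<epsilon> * \<xi>)\<^sup>2 / 2))) t
      = complex_of_real (exp (- ((s - t) / \<epsilon>)\<^sup>2 / 2) / \<epsilon>)"
proof -
  have int: "integrable lborel (\<lambda>x. complex_of_real (std_normal_density x))"
    by (intro integrable_of_real integrable_normal_density zero_less_one)
  have eq: "complex_of_real (std_normal_density x) = of_real (exp (- x\<^sup>2 / 2)) / of_real (sqrt (2 * pi))" for x
    by (simp add: normal_density_def)
  have int': "integrable lborel (\<lambda>x. complex_of_real (exp (- x\<^sup>2 / 2)))"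
    using integrable_mult_right [OF int, of "of_real (sqrt (2 * pi))"] by (simp add: eq)
  show "integrable lborel (\<lambda>\<xi>. complex_of_real (exp (- (\<epsilon> * \<xi>)\<^sup>2 / 2)))"
    using lborel_integrable_real_affine [OF int', of \<epsilon> 0] assms by simp
  have char: "(LBINT x. cis (r * x) * of_real (exp (- x\<^sup>2 / 2))) / of_real (sqrt (2 * pi))
      = of_real (exp (- r\<^sup>2 / 2))" for r
  proof -
    have "of_real (exp (- r\<^sup>2 / 2)) = char std_normal_distribution r"
      by (simp add: char_std_normal_distribution)
    also have "\<dots> = (LBINT x. std_normal_density x *\<^sub>R iexp (r * x))"
      unfolding char_def by (subst integral_density) auto
    also have "\<dots> = (LBINT x. cis (r * x) * of_real (exp (- x\<^sup>2 / 2))) / of_real (sqrt (2 * pi))"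
      by (simp add: scaleR_conv_of_real eq cis_conv_exp mult_ac flip: integral_divide_zero)
    finally show ?thesis by simp
  qed
  define F where "F \<xi> = cis (- (\<xi> * t)) * (cis (s * \<xi>) * complex_of_real (exp (- (\<epsilon> * \<xi>)\<^sup>2 / 2)))" for \<xi>
  have F: "F (0 + (1 / \<epsilon>) * x) = cis (((s - t) / \<epsilon>) * x) * of_real (exp (- x\<^sup>2 / 2))" for x
  proof -
    have "- ((1 / \<epsilon>) * x * t) + s * ((1 / \<epsilon>) * x) = ((s - t) / \<epsilon>) * x"
      using assms by (simp add: field_simps)
    moreover have "\<epsilon> * ((1 / \<epsilon>) * x) = x"
      using assms by simp
    ultimately show ?thesis
      unfolding F_def by (simp only: add_0 mult.assoc [symmetric] cis_mult)
  qed
  have "(LBINT \<xi>. F \<xi>) = \<bar>1 / \<epsilon>\<bar> *\<^sub>R (LBINT x. F (0 + (1 / \<epsilon>) * x))"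
    using assms by (intro lborel_integral_real_affine) simp
  then have "(LBINT \<xi>. cis (- (\<xi> * t)) * (cis (s * \<xi>) * complex_of_real (exp (- (\<epsilon> * \<xi>)\<^sup>2 / 2))))
      = \<bar>1 / \<epsilon>\<bar> *\<^sub>R (LBINT x. cis (((s - t) / \<epsilon>) * x) * of_real (exp (- x\<^sup>2 / 2)))"
    unfolding F by (simp only: F_def)
  then have "ft (\<lambda>\<xi>. cis (s * \<xi>) * complex_of_real (exp (- (\<epsilon> * \<xi>)\<^sup>2 / 2))) t
      = of_real (1 / \<epsilon>) * ((LBINT x. cis (((s - t) / \<epsilon>) * x) * of_real (exp (- x\<^sup>2 / 2))) / of_real (sqrt (2 * pi)))"
    using assms unfolding ft_def by (simp only: scaleR_conv_of_real times_divide_eq_right) simp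
  then show "ft (\<lambda>\<xi>. cis (s * \<xi>) * complex_of_real (exp (- (\<epsilon> * \<xi>)\<^sup>2 / 2))) t
      = complex_of_real (exp (- ((s - t) / \<epsilon>)\<^sup>2 / 2) / \<epsilon>)"
    unfolding char by (simp only: of_real_mult [symmetric]) simp
qed

lemma square_integrable_cmod:
  "square_integrable f \<Longrightarrow> square_integrable (\<lambda>x. of_real (cmod (f x)))"
  unfolding square_integrable_def by auto

lemma integrable_cmod_mult:
  assumes "square_integrable f" "square_integrable g"
  shows "integrable lborel (\<lambda>x. cmod (f x) * cmod (g x))"
    and "(LBINT x. cmod (f x) * cmod (g x)) \<le> norm (L2_of f) * norm (L2_of g)"
proof -
  note sq = square_integrable_cmod [OF assms(1)] square_integrable_cmod [OF assms(2)]
  show "integrable lborel (\<lambda>x. cmod (f x) * cmod (g x))"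
    using integrable_inner_square_integrable [OF sq] by (simp add: inner_complex_def)
  have "(LBINT x. cmod (f x) * cmod (g x)) = L2_of (\<lambda>x. of_real (cmod (f x))) \<bullet> L2_of (\<lambda>x. of_real (cmod (g x)))"
    using sq by (simp add: inner_L2_of inner_complex_def)
  also have "\<dots> \<le> norm (L2_of (\<lambda>x. of_real (cmod (f x)))) * norm (L2_of (\<lambda>x. of_real (cmod (g x))))"
    by (rule norm_cauchy_schwarz)
  finally show "(LBINT x. cmod (f x) * cmod (g x)) \<le> norm (L2_of f) * norm (L2_of g)"
    using assms sq by (simp add: norm_L2_of)
qed

lemma integrable_mult_square_integrable:
  assumes "square_integrable f" "square_integrable g"
  shows "integrable lborel (\<lambda>x. f x * g x)"
proof (rule Bochner_Integration.integrable_bound [OF integrable_cmod_mult(1) [OF assms]])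
  note [measurable] = square_integrable_measurable [OF assms(1)] square_integrable_measurable [OF assms(2)]
  show "(\<lambda>x. f x * g x) \<in> borel_measurable lborel" by measurable
qed (simp add: norm_mult)

lemma borel_measurable_cnj [measurable]: "cnj \<in> borel_measurable borel"
  by (intro borel_measurable_continuous_onI continuous_intros)

lemma square_integrable_cnj: "square_integrable f \<Longrightarrow> square_integrable (\<lambda>x. cnj (f x))"
  unfolding square_integrable_def by auto

text \<open>Supplies the hypothesis of Fubini's theorem in \<open>plancherel_gauss\<close>: by
  Cauchy-Schwarz the x-integral is at most the squared norm of f for each z, and the Gaussian weight
  makes this integrable in z.\<close>

lemma integrable_translate_gauss:
  assumes f: "square_integrable f"
  shows "integrable (lborel \<Otimes>\<^sub>M lborel)
    (\<lambda>(z, x). f x * cnj (f (x - \<epsilon> * z)) * of_real (std_normal_density z))"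
proof (rule lborel_pair.Fubini_integrable)
  note [measurable] = square_integrable_measurable [OF f]
  let ?F = "\<lambda>z x. f x * cnj (f (x - \<epsilon> * z)) * of_real (std_normal_density z)"
  have tr: "square_integrable (\<lambda>x. f (x - h))" for h
    using square_integrable_affine [OF f, of 1 "- h"] by simp
  have n: "norm (L2_of (\<lambda>x. f (x - h))) = norm (L2_of f)" for h
    using affine_L2_of [OF f, of 1 "- h"] norm_affine_L2 [of 1 "- h" "L2_of f"] by simp
  show "(\<lambda>(z, x). ?F z x) \<in> borel_measurable (lborel \<Otimes>\<^sub>M lborel)"
    by (simp add: split_beta')
  show "AE z in lborel. integrable lborel (\<lambda>x. case (z, x) of (z, x) \<Rightarrow> ?F z x)"
    using integrable_mult_square_integrable [OF f square_integrable_cnj [OF tr]] by simp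
  show "integrable lborel (\<lambda>z. LBINT x. norm (case (z, x) of (z, x) \<Rightarrow> ?F z x))"
  proof (rule Bochner_Integration.integrable_bound)
    show "integrable lborel (\<lambda>z. (norm (L2_of f))\<^sup>2 * std_normal_density z)"
      by simp
    show "(\<lambda>z. LBINT x. norm (case (z, x) of (z, x) \<Rightarrow> ?F z x)) \<in> borel_measurable lborel"
      by measurable
    have "(LBINT x. cmod (f x) * cmod (f (x - \<epsilon> * z))) * std_normal_density z
        \<le> (norm (L2_of f))\<^sup>2 * std_normal_density z" for z
      using integrable_cmod_mult(2) [OF f tr [of "\<epsilon> * z"]]
      by (intro mult_right_mono) (simp_all add: n power2_eq_square)
    then show "AE z in lborel. norm (LBINT x. norm (case (z, x) of (z, x) \<Rightarrow> ?F z x))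
        \<le> norm ((norm (L2_of f))\<^sup>2 * std_normal_density z)"
      by (intro AE_I2) (simp add: norm_mult abs_mult integral_nonneg_AE)
  qed
qed

text \<open>
  Plancherel's identity with a Gaussian factor; letting \<open>\<epsilon> \<rightarrow> 0\<close> the right-hand side tends to
  \<open>(norm (L2_of f))\<^sup>2\<close>, by continuity of translations.
\<close>

lemma plancherel_gauss:
  assumes f: "integrable lborel f" and f2: "square_integrable f" and \<epsilon>: "\<epsilon> > 0"
  shows "integrable lborel (\<lambda>\<xi>. (cmod (ft f \<xi>))\<^sup>2 * exp (- (\<epsilon> * \<xi>)\<^sup>2 / 2))"
    and "(LBINT \<xi>. (cmod (ft f \<xi>))\<^sup>2 * exp (- (\<epsilon> * \<xi>)\<^sup>2 / 2))
      = (LBINT z. std_normal_density z * (L2_of f \<bullet> affine_L2 1 (- (\<epsilon> * z)) (L2_of f)))"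
proof -
  note [measurable] = borel_measurable_integrable [OF f]
  define g where "g \<xi> = complex_of_real (exp (- (\<epsilon> * \<xi>)\<^sup>2 / 2))" for \<xi>
  have g [measurable]: "g \<in> borel_measurable borel" and g_even: "g (- \<xi>) = g \<xi>" for \<xi>
    by (simp_all add: g_def [abs_def])
  have g_int: "integrable lborel g"
    using ft_gaussian(1) [OF \<epsilon>] by (simp add: g_def [abs_def])
  \<comment> \<open>Chosen so that \<open>ft f \<xi> * w \<xi>\<close> is the integrand of the
    claim; \<open>ft_adjoint\<close> then moves the transform onto \<open>w\<close>, where it
    becomes a Gaussian average of translates of the conjugate of f.\<close>
  define w where "w \<xi> = cnj (ft f \<xi>) * g \<xi>" for \<xi>
  have bdd: "integrable lborel (\<lambda>\<xi>. h \<xi> * g \<xi>)"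
    if [measurable]: "h \<in> borel_measurable borel" and B: "\<And>\<xi>. cmod (h \<xi>) \<le> B" for h B
  proof (rule Bochner_Integration.integrable_bound)
    show "integrable lborel (\<lambda>\<xi>. of_real B * g \<xi>)"
      using g_int by simp
    have "0 \<le> B" using B [of 0] norm_ge_zero order_trans by blast
    then show "AE \<xi> in lborel. cmod (h \<xi> * g \<xi>) \<le> cmod (of_real B * g \<xi>)"
      using B by (intro AE_I2) (simp add: norm_mult mult_right_mono)
  qed measurable
  have w: "integrable lborel w"
    unfolding w_def by (rule bdd [of _ "LBINT x. cmod (f x)"]) (auto intro: norm_ft_le)
  have eq: "ft f \<xi> * w \<xi> = of_real ((cmod (ft f \<xi>))\<^sup>2 * exp (- (\<epsilon> * \<xi>)\<^sup>2 / 2))" for \<xi>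
    by (simp add: w_def g_def mult.assoc [symmetric] complex_norm_square del: of_real_power)
  have "integrable lborel (\<lambda>\<xi>. (ft f \<xi> * cnj (ft f \<xi>)) * g \<xi>)"
    by (rule bdd [of _ "(LBINT x. cmod (f x)) * (LBINT x. cmod (f x))"])
       (auto simp: norm_mult intro!: mult_mono norm_ft_le)
  then have "integrable lborel (\<lambda>\<xi>. ft f \<xi> * w \<xi>)"
    by (simp add: w_def mult.assoc)
  then have int: "integrable lborel (\<lambda>\<xi>. complex_of_real ((cmod (ft f \<xi>))\<^sup>2 * exp (- (\<epsilon> * \<xi>)\<^sup>2 / 2)))"
    unfolding eq .
  then show "integrable lborel (\<lambda>\<xi>. (cmod (ft f \<xi>))\<^sup>2 * exp (- (\<epsilon> * \<xi>)\<^sup>2 / 2))"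
    using integrable_Re [OF int] by simp
  have ft_w: "ft w x = (LBINT z. cnj (f (x - \<epsilon> * z)) * of_real (std_normal_density z))" for x
  proof -
    let ?s = "complex_of_real (sqrt (2 * pi))"
    have "ft w x = (LBINT \<xi>. cis (- (\<xi> * x)) * (ft (\<lambda>x. cnj (f x)) (- \<xi>) * g \<xi>)) / ?s"
      by (simp add: ft_def [of w] w_def ft_cnj)
    also have "\<dots> = (LBINT \<xi>. ft (\<lambda>x. cnj (f x)) \<xi> * (cis (x * \<xi>) * g \<xi>)) / ?s"
      by (subst lborel_integral_real_affine [of "- 1" _ 0]) (simp_all add: g_even mult_ac)
    \<comment> \<open>The adjoint formula a second time: now the transform lands on a modulated
      Gaussian, which is known explicitly.\<close>
    also have "\<dots> = (LBINT y. cnj (f y) * ft (\<lambda>\<xi>. cis (x * \<xi>) * g \<xi>) y) / ?s"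
      using f g_int by (subst ft_adjoint) (auto intro: integrable_cis_mult)
    also have "\<dots> = (LBINT y. cnj (f y) * complex_of_real (exp (- ((x - y) / \<epsilon>)\<^sup>2 / 2) / \<epsilon>)) / ?s"
      unfolding g_def ft_gaussian(2) [OF \<epsilon>] ..
    also have "\<dots> = (LBINT z. cnj (f (x - \<epsilon> * z)) * complex_of_real (exp (- z\<^sup>2 / 2))) / ?s"
      using \<epsilon> by (subst lborel_integral_real_affine [of "- \<epsilon>" _ x])
        (simp_all add: scaleR_conv_of_real)
    also have "\<dots> = (LBINT z. cnj (f (x - \<epsilon> * z)) * of_real (std_normal_density z))"
      by (simp add: normal_density_def flip: integral_divide_zero)
    finally show ?thesis .
  qed
  have "complex_of_real (LBINT \<xi>. (cmod (ft f \<xi>))\<^sup>2 * exp (- (\<epsilon> * \<xi>)\<^sup>2 / 2)) = (LBINT \<xi>. ft f \<xi> * w \<xi>)"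
    unfolding eq by (rule integral_complex_of_real [symmetric])
  also have "\<dots> = (LBINT x. f x * ft w x)"
    by (rule ft_adjoint [OF f w])
  also have "\<dots> = (LBINT x. LBINT z. f x * cnj (f (x - \<epsilon> * z)) * of_real (std_normal_density z))"
    by (simp add: ft_w mult.assoc flip: integral_mult_right_zero)
  also have "\<dots> = (LBINT z. LBINT x. f x * cnj (f (x - \<epsilon> * z)) * of_real (std_normal_density z))"
    by (rule lborel_pair.Fubini_integral [OF integrable_translate_gauss [OF f2]])
  finally have *: "complex_of_real (LBINT \<xi>. (cmod (ft f \<xi>))\<^sup>2 * exp (- (\<epsilon> * \<xi>)\<^sup>2 / 2))
      = (LBINT z. (LBINT x. f x * cnj (f (x - \<epsilon> * z))) * of_real (std_normal_density z))"
    by simp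
  have int2: "integrable lborel (\<lambda>z. (LBINT x. f x * cnj (f (x - \<epsilon> * z))) * complex_of_real (std_normal_density z))"
    using lborel_pair.integrable_fst [OF integrable_translate_gauss [OF f2, of \<epsilon>]] by simp
  have tr: "square_integrable (\<lambda>x. f (x - h))" for h
    using square_integrable_affine [OF f2, of 1 "- h"] by simp
  have Re: "Re (LBINT x. f x * cnj (f (x - h))) = L2_of f \<bullet> affine_L2 1 (- h) (L2_of f)" for h
  proof -
    have "Re (LBINT x. f x * cnj (f (x - h))) = (LBINT x. Re (f x * cnj (f (x - h))))"
      by (rule Bochner_Integration.integral_Re [symmetric])
        (rule integrable_mult_square_integrable [OF f2 square_integrable_cnj [OF tr]])
    also have "\<dots> = L2_of f \<bullet> affine_L2 1 (- h) (L2_of f)"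
      using affine_L2_of [OF f2, of 1 "- h"] by (simp add: inner_L2_of f2 tr inner_complex_def)
    finally show ?thesis .
  qed
  have "(LBINT \<xi>. (cmod (ft f \<xi>))\<^sup>2 * exp (- (\<epsilon> * \<xi>)\<^sup>2 / 2))
      = (LBINT z. Re ((LBINT x. f x * cnj (f (x - \<epsilon> * z))) * of_real (std_normal_density z)))"
    using arg_cong [OF *, of Re]
    by (simp only: Re_complex_of_real Bochner_Integration.integral_Re [OF int2])
  also have "\<dots> = (LBINT z. std_normal_density z * (L2_of f \<bullet> affine_L2 1 (- (\<epsilon> * z)) (L2_of f)))"
    by (simp add: Re mult.commute)
  finally show "(LBINT \<xi>. (cmod (ft f \<xi>))\<^sup>2 * exp (- (\<epsilon> * \<xi>)\<^sup>2 / 2))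
      = (LBINT z. std_normal_density z * (L2_of f \<bullet> affine_L2 1 (- (\<epsilon> * z)) (L2_of f)))" .
qed

text \<open>Square integrability of \<open>ft f\<close> is part of the claim, so no majorant is at
  hand on the frequency side. The Gaussian factors increase to 1 there, and monotone convergence
  gives integrability together with the value of the integral.\<close>

lemma plancherel:
  assumes f: "integrable lborel f" and f2: "square_integrable f"
  shows "square_integrable (ft f)" and "norm (L2_of (ft f)) = norm (L2_of f)"
proof -
  note [measurable] = borel_measurable_integrable [OF f]
  define \<epsilon> where "\<epsilon> k = 1 / real (Suc k)" for k
  have \<epsilon>: "\<epsilon> k > 0" for k by (simp add: \<epsilon>_def)
  have \<epsilon>_lim: "\<epsilon> \<longlonglongrightarrow> 0"
    unfolding \<epsilon>_def by (rule LIMSEQ_Suc [OF lim_1_over_n])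
  define G where "G k \<xi> = (cmod (ft f \<xi>))\<^sup>2 * exp (- (\<epsilon> k * \<xi>)\<^sup>2 / 2)" for k \<xi>
  have cont: "isCont (\<lambda>h. affine_L2 1 (- h) (L2_of f)) 0"
    using translation_continuous [of "L2_of f"] affine_L2_of [OF f2, of 1 0]
    by (simp add: isCont_def)
  have lim: "(\<lambda>k. LBINT \<xi>. G k \<xi>) \<longlonglongrightarrow> (norm (L2_of f))\<^sup>2"
  proof -
    have "(\<lambda>k. LBINT z. std_normal_density z * (L2_of f \<bullet> affine_L2 1 (- (\<epsilon> k * z)) (L2_of f)))
        \<longlonglongrightarrow> (LBINT z. std_normal_density z * (norm (L2_of f))\<^sup>2)"
    proof (rule integral_dominated_convergence)
      show "integrable lborel (\<lambda>z. std_normal_density z * (norm (L2_of f))\<^sup>2)"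
        by simp
      have "(\<lambda>k. std_normal_density z * (L2_of f \<bullet> affine_L2 1 (- (\<epsilon> k * z)) (L2_of f)))
          \<longlonglongrightarrow> std_normal_density z * (L2_of f \<bullet> affine_L2 1 (- 0) (L2_of f))" for z
        using \<epsilon>_lim by (intro tendsto_intros isCont_tendsto_compose [OF cont]) (auto intro: tendsto_eq_intros)
      then show "AE z in lborel. (\<lambda>k. std_normal_density z * (L2_of f \<bullet> affine_L2 1 (- (\<epsilon> k * z)) (L2_of f)))
          \<longlonglongrightarrow> std_normal_density z * (norm (L2_of f))\<^sup>2"
        using affine_L2_of [OF f2, of 1 0] by (simp add: power2_norm_eq_inner)
      show "AE z in lborel. norm (std_normal_density z * (L2_of f \<bullet> affine_L2 1 (- (\<epsilon> k * z)) (L2_of f)))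
          \<le> std_normal_density z * (norm (L2_of f))\<^sup>2" for k
      proof (intro AE_I2)
        fix z
        have "\<bar>L2_of f \<bullet> affine_L2 1 (- (\<epsilon> k * z)) (L2_of f)\<bar> \<le> (norm (L2_of f))\<^sup>2"
          using Cauchy_Schwarz_ineq2 [of "L2_of f" "affine_L2 1 (- (\<epsilon> k * z)) (L2_of f)"]
          by (simp add: norm_affine_L2 power2_eq_square)
        then show "norm (std_normal_density z * (L2_of f \<bullet> affine_L2 1 (- (\<epsilon> k * z)) (L2_of f)))
          \<le> std_normal_density z * (norm (L2_of f))\<^sup>2"
          by (simp add: abs_mult mult_left_mono)
      qed
      have "(\<lambda>h. L2_of f \<bullet> affine_L2 1 h (L2_of f)) = (\<lambda>h. LBINT x. f x \<bullet> f (h + 1 * x))"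
        by (simp add: affine_L2_of [OF f2] inner_L2_of f2 square_integrable_affine [OF f2, of 1, simplified])
      also have "\<dots> \<in> borel_measurable borel"
        by measurable
      finally have [measurable]: "(\<lambda>h. L2_of f \<bullet> affine_L2 1 h (L2_of f)) \<in> borel_measurable borel" .
      show "(\<lambda>z. std_normal_density z * (L2_of f \<bullet> affine_L2 1 (- (\<epsilon> k * z)) (L2_of f))) \<in> borel_measurable lborel" for k
        by measurable
    qed simp
    then show ?thesis
      unfolding G_def plancherel_gauss(2) [OF f f2 \<epsilon>] by simp
  qed
  have mono: "AE \<xi> in lborel. mono (\<lambda>k. G k \<xi>)"
  proof (intro AE_I2 incseq_SucI)
    fix \<xi> k
    have "(\<epsilon> (Suc k) * \<xi>)\<^sup>2 \<le> (\<epsilon> k * \<xi>)\<^sup>2"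
      unfolding power_mult_distrib
      by (intro mult_right_mono power_mono) (auto simp: \<epsilon>_def field_simps)
    then show "G k \<xi> \<le> G (Suc k) \<xi>"
      by (simp add: G_def mult_left_mono)
  qed
  have conv: "AE \<xi> in lborel. (\<lambda>k. G k \<xi>) \<longlonglongrightarrow> (cmod (ft f \<xi>))\<^sup>2"
  proof (intro AE_I2)
    fix \<xi>
    have "(\<lambda>k. G k \<xi>) \<longlonglongrightarrow> (cmod (ft f \<xi>))\<^sup>2 * exp (- (0 * \<xi>)\<^sup>2 / 2)"
      unfolding G_def by (intro tendsto_intros \<epsilon>_lim) simp_all
    then show "(\<lambda>k. G k \<xi>) \<longlonglongrightarrow> (cmod (ft f \<xi>))\<^sup>2" by simp
  qed
  have G: "integrable lborel (G k)" for k
    unfolding G_def using plancherel_gauss(1) [OF f f2 \<epsilon>] .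
  have meas: "(\<lambda>\<xi>. (cmod (ft f \<xi>))\<^sup>2) \<in> borel_measurable lborel"
    by measurable
  have int: "integrable lborel (\<lambda>\<xi>. (cmod (ft f \<xi>))\<^sup>2)"
    and eq: "(LBINT \<xi>. (cmod (ft f \<xi>))\<^sup>2) = (norm (L2_of f))\<^sup>2"
    using integrable_monotone_convergence [OF G mono conv lim meas]
      integral_monotone_convergence [OF G mono conv lim meas] by auto
  then show sq: "square_integrable (ft f)"
    by (simp add: square_integrable_def)
  then show "norm (L2_of (ft f)) = norm (L2_of f)"
    using eq by (simp add: norm_L2_of)
qed

section \<open>The Fourier transform on \<open>L2\<close>\<close>

lemma L2_of_restrict_tendsto:
  assumes f: "square_integrable f"
  shows "((\<lambda>R. L2_of (\<lambda>x. indicator {-R..R} x *\<^sub>R f x)) \<longlongrightarrow> L2_of f) at_top"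
proof (rule tendsto_at_topI_sequentially)
  fix X :: "nat \<Rightarrow> real"
  assume X: "filterlim X at_top sequentially"
  note [measurable] = square_integrable_measurable [OF f]
  show "(\<lambda>n. L2_of (\<lambda>x. indicator {-X n..X n} x *\<^sub>R f x)) \<longlonglongrightarrow> L2_of f"
  proof (rule L2_of_tendsto_dominated [OF _ _ f])
    fix x
    have "\<forall>\<^sub>F n in sequentially. \<bar>x\<bar> \<le> X n"
      using X by (simp add: filterlim_at_top)
    then have "\<forall>\<^sub>F n in sequentially. indicator {-X n..X n} x *\<^sub>R f x = f x"
      by eventually_elim (auto simp: indicator_def)
    then show "(\<lambda>n. indicator {-X n..X n} x *\<^sub>R f x) \<longlonglongrightarrow> f x"
      by (rule tendsto_eventually)
  qed (auto simp: indicator_def)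
qed

lemma restrict_Icc:
  assumes f: "square_integrable f"
  shows "square_integrable (\<lambda>x. indicator {-R..R::real} x *\<^sub>R f x)"
    and "integrable lborel (\<lambda>x. indicator {-R..R::real} x *\<^sub>R f x)"
proof -
  note [measurable] = square_integrable_measurable [OF f]
  show "square_integrable (\<lambda>x. indicator {-R..R::real} x *\<^sub>R f x)"
    by (rule square_integrable_dominated [OF _ f]) (auto simp: indicator_def)
  have "square_integrable (\<lambda>x. 1 * indicator {-R..R} x)"
    by (rule square_integrable_indicator [of _ "-R" R]) auto
  then have "integrable lborel (\<lambda>x. 1 * indicator {-R..R} x * f x)"
    by (rule integrable_mult_square_integrable [OF _ f])
  moreover have "1 * indicator {-R..R} x * f x = indicator {-R..R} x *\<^sub>R f x" for x
    by (simp add: indicator_def)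
  ultimately show "integrable lborel (\<lambda>x. indicator {-R..R::real} x *\<^sub>R f x)"
    by simp
qed

lemma norm_ft_diff:
  assumes "integrable lborel f" "square_integrable f" "integrable lborel g" "square_integrable g"
  shows "norm (L2_of (ft f) - L2_of (ft g)) = norm (L2_of f - L2_of g)"
proof -
  have "ft (\<lambda>x. f x - g x) = (\<lambda>\<xi>. ft f \<xi> - ft g \<xi>)"
    using assms by (simp add: ft_diff fun_eq_iff)
  then have "L2_of (ft f) - L2_of (ft g) = L2_of (ft (\<lambda>x. f x - g x))"
    using assms by (simp add: plancherel flip: L2_of_diff)
  also have "norm \<dots> = norm (L2_of (\<lambda>x. f x - g x))"
    using assms by (intro plancherel) (auto intro: square_integrable_diff)
  finally show ?thesis
    using assms by (simp add: L2_of_diff)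
qed

text \<open>\<open>fourier\<close> is defined through \<open>Lim\<close>, which says something only
  once a limit exists. It does because \<open>ft\<close> is isometric on the truncations, and these
  converge to u: the integer radii give a Cauchy sequence and thus a candidate, and any other
  sequence of radii stays asymptotically close to it.\<close>

lemma fourier_tendsto:
  "((\<lambda>R. L2_of (ft (\<lambda>x. indicator {-R..R} x *\<^sub>R rep_L2 u x))) \<longlongrightarrow> fourier u) at_top"
proof -
  define c where "c R = (\<lambda>x. indicator {-R..R} x *\<^sub>R rep_L2 u x)" for R :: real
  have c: "square_integrable (c R)" "integrable lborel (c R)" for R
    unfolding c_def by (intro restrict_Icc square_integrable_rep_L2)+
  have lim: "((\<lambda>R. L2_of (c R)) \<longlongrightarrow> u) at_top"
    using L2_of_restrict_tendsto [OF square_integrable_rep_L2, of u] by (simp add: c_def)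
  have d: "dist (L2_of (ft (c R))) (L2_of (ft (c S))) = dist (L2_of (c R)) (L2_of (c S))" for R S
    unfolding dist_norm by (rule norm_ft_diff) (use c in auto)
  have "Cauchy (\<lambda>n. L2_of (c (real n)))"
    using filterlim_compose [OF lim filterlim_real_sequentially] by (intro LIMSEQ_imp_Cauchy)
  then have "Cauchy (\<lambda>n. L2_of (ft (c (real n))))"
    by (simp add: Cauchy_def d)
  then obtain y where y: "(\<lambda>n. L2_of (ft (c (real n)))) \<longlonglongrightarrow> y"
    using Cauchy_convergent_iff convergent_def by blast
  have "((\<lambda>R. L2_of (ft (c R))) \<longlongrightarrow> y) at_top"
  proof (rule tendsto_at_topI_sequentially)
    fix X :: "nat \<Rightarrow> real"
    assume X: "filterlim X at_top sequentially"
    have "(\<lambda>n. dist (L2_of (c (X n))) (L2_of (c (real n)))) \<longlonglongrightarrow> dist u u"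
      by (intro tendsto_dist filterlim_compose [OF lim] X filterlim_real_sequentially)
    then have "(\<lambda>n. dist (L2_of (ft (c (X n)))) (L2_of (ft (c (real n))))) \<longlonglongrightarrow> 0"
      unfolding d by simp
    then have "(\<lambda>n. L2_of (ft (c (X n))) - L2_of (ft (c (real n)))) \<longlonglongrightarrow> 0"
      unfolding dist_norm by (rule tendsto_norm_zero_cancel)
    then have "(\<lambda>n. L2_of (ft (c (X n))) - L2_of (ft (c (real n))) + L2_of (ft (c (real n)))) \<longlonglongrightarrow> 0 + y"
      by (intro tendsto_add y)
    then show "(\<lambda>n. L2_of (ft (c (X n)))) \<longlonglongrightarrow> y" by simp
  qed
  moreover have "fourier u = Lim at_top (\<lambda>R. L2_of (ft (c R)))"
    by (simp add: fourier_def ft_def [abs_def] c_def cis_conv_exp set_lebesgue_integral_def)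
  ultimately show ?thesis
    by (simp add: c_def tendsto_Lim)
qed

text \<open>The isometry also compares \<open>ft f\<close> with the transforms of the truncations,
  so both have the same limit.\<close>

lemma fourier_L2_of:
  assumes f: "integrable lborel f" "square_integrable f"
  shows "fourier (L2_of f) = L2_of (ft f)"
proof -
  let ?u = "L2_of f"
  define c where "c R = (\<lambda>x. indicator {-R..R} x *\<^sub>R rep_L2 ?u x)" for R :: real
  have c: "square_integrable (c R)" "integrable lborel (c R)" for R
    unfolding c_def by (intro restrict_Icc square_integrable_rep_L2)+
  have lim: "((\<lambda>R. L2_of (c R)) \<longlongrightarrow> ?u) at_top"
    using L2_of_restrict_tendsto [OF square_integrable_rep_L2, of ?u] by (simp add: c_def)
  have d: "dist (L2_of (ft (c R))) (L2_of (ft f)) = dist (L2_of (c R)) ?u" for R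
    unfolding dist_norm by (rule norm_ft_diff) (use c f in auto)
  have "((\<lambda>R. dist (L2_of (ft (c R))) (L2_of (ft f))) \<longlongrightarrow> 0) at_top"
    unfolding d using lim by (rule tendsto_dist_iff [THEN iffD1])
  then have "((\<lambda>R. L2_of (ft (c R))) \<longlongrightarrow> L2_of (ft f)) at_top"
    by (rule tendsto_dist_iff [THEN iffD2])
  moreover have "((\<lambda>R. L2_of (ft (c R))) \<longlongrightarrow> fourier ?u) at_top"
    using fourier_tendsto [of ?u] by (simp add: c_def)
  ultimately show ?thesis
    by (intro tendsto_unique [OF trivial_limit_at_top_linorder])
qed

section \<open>Isometry, linearity and inversion of the Fourier transform on L^2\<close>

lemma L2_exhaust_limit:
  obtains f where "\<And>n. square_integrable (f n)" "\<And>n. integrable lborel (f n)"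
    "(\<lambda>n :: nat. L2_of (f n)) \<longlonglongrightarrow> u" "(\<lambda>n. L2_of (ft (f n))) \<longlonglongrightarrow> fourier u"
proof
  let ?f = "\<lambda>n :: nat. (\<lambda>x. indicator {- real n..real n} x *\<^sub>R rep_L2 u x)"
  show "square_integrable (?f n)" "integrable lborel (?f n)" for n
    by (intro restrict_Icc square_integrable_rep_L2)+
  show "(\<lambda>n. L2_of (?f n)) \<longlonglongrightarrow> u"
    using filterlim_compose [OF L2_of_restrict_tendsto [OF square_integrable_rep_L2] filterlim_real_sequentially, of u]
    by simp
  show "(\<lambda>n. L2_of (ft (?f n))) \<longlonglongrightarrow> fourier u"
    using filterlim_compose [OF fourier_tendsto filterlim_real_sequentially, of u] by simp
qed

lemma norm_fourier [simp]: "norm (fourier u) = norm u"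
proof (cases u rule: L2_exhaust_limit)
  case (1 f)
  then have "(\<lambda>n. norm (L2_of (f n))) \<longlonglongrightarrow> norm (fourier u)"
    using tendsto_norm [OF 1(4)] by (simp add: plancherel)
  with tendsto_norm [OF 1(3)] show ?thesis
    by (metis LIMSEQ_unique)
qed

text \<open>The proof is driven by the distance identity
  \<open>norm (fourier w - L2_of (ft h)) = norm (w - L2_of h)\<close>, which presupposes no
  linearity of \<open>fourier\<close>: applied to u + v and f + g it bounds the defect by
  approximation errors alone.\<close>

lemma fourier_add: "fourier (u + v) = fourier u + fourier v"
proof -
  have *: "norm (fourier (u + v) - (L2_of (ft f) + L2_of (ft g))) \<le> norm (u - L2_of f) + norm (v - L2_of g)"
    if "square_integrable f" "integrable lborel f" "square_integrable g" "integrable lborel g" for f g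
  proof -
    have "ft (\<lambda>x. f x + g x) = (\<lambda>\<xi>. ft f \<xi> + ft g \<xi>)"
      using that by (simp add: ft_add fun_eq_iff)
    then have sum: "L2_of (ft f) + L2_of (ft g) = L2_of (ft (\<lambda>x. f x + g x))"
      using that by (simp add: plancherel flip: L2_of_add)
    have "norm (fourier w - L2_of (ft h)) = norm (w - L2_of h)"
      if h: "square_integrable h" "integrable lborel h" for w h
    proof (cases w rule: L2_exhaust_limit)
      case (1 k)
      have "(\<lambda>n. norm (L2_of (k n) - L2_of h)) \<longlonglongrightarrow> norm (fourier w - L2_of (ft h))"
        using tendsto_norm [OF tendsto_diff [OF 1(4) tendsto_const [of "L2_of (ft h)"]]] h 1
        by (simp add: norm_ft_diff)
      with tendsto_norm [OF tendsto_diff [OF 1(3) tendsto_const [of "L2_of h"]]] show ?thesis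
        by (metis LIMSEQ_unique)
    qed
    from this [of "\<lambda>x. f x + g x" "u + v"] show ?thesis
      unfolding sum using that
      by (simp add: square_integrable_add L2_of_add norm_diff_triangle_ineq)
  qed
  obtain f where f: "\<And>n. square_integrable (f n)" "\<And>n. integrable lborel (f n)"
    "(\<lambda>n :: nat. L2_of (f n)) \<longlonglongrightarrow> u" "(\<lambda>n. L2_of (ft (f n))) \<longlonglongrightarrow> fourier u"
    using L2_exhaust_limit [of u] by blast
  obtain g where g: "\<And>n. square_integrable (g n)" "\<And>n. integrable lborel (g n)"
    "(\<lambda>n :: nat. L2_of (g n)) \<longlonglongrightarrow> v" "(\<lambda>n. L2_of (ft (g n))) \<longlonglongrightarrow> fourier v"
    using L2_exhaust_limit [of v] by blast
  have "(\<lambda>n. norm (fourier (u + v) - (L2_of (ft (f n)) + L2_of (ft (g n)))))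
      \<longlonglongrightarrow> norm (fourier (u + v) - (fourier u + fourier v))"
    by (intro tendsto_intros f g)
  moreover have "(\<lambda>n. norm (u - L2_of (f n)) + norm (v - L2_of (g n))) \<longlonglongrightarrow> norm (u - u) + norm (v - v)"
    by (intro tendsto_intros f g)
  ultimately have "norm (fourier (u + v) - (fourier u + fourier v)) \<le> norm (u - u) + norm (v - v)"
    by (rule LIMSEQ_le) (use * f g in blast)
  then show ?thesis by simp
qed

lemma ft_cmult: "ft (\<lambda>x. c * f x) \<xi> = c * ft f \<xi>"
  by (simp add: ft_def mult.left_commute)

lemma fourier_scaleR: "fourier (r *\<^sub>R u) = r *\<^sub>R fourier u"
proof (cases u rule: L2_exhaust_limit)
  case (1 f)
  have eq: "L2_of (ft (\<lambda>x. r *\<^sub>R f n x)) = r *\<^sub>R L2_of (ft (f n))" for n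
    using 1 by (simp add: scaleR_conv_of_real ft_cmult [abs_def] plancherel flip: L2_of_scaleR)
  have "norm (fourier (r *\<^sub>R u) - r *\<^sub>R L2_of (ft (f n))) = norm (r *\<^sub>R u - r *\<^sub>R L2_of (f n))" for n
  proof -
    have "r *\<^sub>R L2_of (ft (f n)) = fourier (L2_of (\<lambda>x. r *\<^sub>R f n x))"
      using 1 by (simp add: fourier_L2_of square_integrable_scaleR flip: eq)
    moreover have "fourier (r *\<^sub>R u) = fourier (r *\<^sub>R u - r *\<^sub>R L2_of (f n)) + fourier (r *\<^sub>R L2_of (f n))"
      by (simp flip: fourier_add)
    ultimately show ?thesis
      using 1 by (simp add: L2_of_scaleR)
  qed
  moreover have "(\<lambda>n. norm (fourier (r *\<^sub>R u) - r *\<^sub>R L2_of (ft (f n)))) \<longlonglongrightarrow> norm (fourier (r *\<^sub>R u) - r *\<^sub>R fourier u)"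
    by (intro tendsto_intros 1)
  ultimately have "(\<lambda>n. norm (r *\<^sub>R u - r *\<^sub>R L2_of (f n))) \<longlonglongrightarrow> norm (fourier (r *\<^sub>R u) - r *\<^sub>R fourier u)"
    by (simp only:)
  moreover have "(\<lambda>n. norm (r *\<^sub>R u - r *\<^sub>R L2_of (f n))) \<longlonglongrightarrow> norm (r *\<^sub>R u - r *\<^sub>R u)"
    by (intro tendsto_intros 1)
  ultimately have "norm (fourier (r *\<^sub>R u) - r *\<^sub>R fourier u) = norm (r *\<^sub>R u - r *\<^sub>R u)"
    by (rule LIMSEQ_unique)
  then show ?thesis by simp
qed

lemma bounded_linear_fourier: "bounded_linear fourier"
  by (rule bounded_linear_intro [of _ 1]) (simp_all add: fourier_add fourier_scaleR)

text \<open>Polarization, in the form that expands the squared norm of F u + F v.\<close>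

lemma inner_isometry:
  fixes F :: "'a::real_inner \<Rightarrow> 'b::real_inner"
  assumes "linear F" "\<And>x. norm (F x) = norm x"
  shows "F u \<bullet> F v = u \<bullet> v"
proof -
  have *: "F x \<bullet> F x = x \<bullet> x" for x
    using assms(2) by (simp add: dot_square_norm)
  have "(F u + F v) \<bullet> (F u + F v) = (u + v) \<bullet> (u + v)"
    using * [of "u + v"] by (simp add: linear_add [OF assms(1)])
  then show ?thesis
    using * [of u] * [of v] by (simp add: inner_add_left inner_add_right inner_commute)
qed

text \<open>The real inner product is the real part of the integral of f times the conjugate of g,
  and the transform of a conjugate is the conjugate of the transform at the reflected
  frequency.\<close>

lemma inner_ft:
  assumes f: "integrable lborel f" "square_integrable f" and g: "integrable lborel g" "square_integrable g"
  shows "L2_of (ft f) \<bullet> L2_of g = L2_of f \<bullet> affine_L2 (-1) 0 (L2_of (ft g))"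
proof -
  have g': "integrable lborel (\<lambda>x. cnj (g x))"
    using g by simp
  have "L2_of (ft f) \<bullet> L2_of g = (LBINT x. Re (ft f x * cnj (g x)))"
    using f g by (simp add: inner_L2_of plancherel inner_complex_def)
  also have "\<dots> = Re (LBINT x. ft f x * cnj (g x))"
    using integrable_mult_square_integrable [OF plancherel(1) [OF f] square_integrable_cnj [OF g(2)]]
    by (rule Bochner_Integration.integral_Re)
  also have "(LBINT x. ft f x * cnj (g x)) = (LBINT x. f x * ft (\<lambda>x. cnj (g x)) x)"
    by (rule ft_adjoint [OF f(1) g'])
  also have "(\<lambda>x. f x * ft (\<lambda>x. cnj (g x)) x) = (\<lambda>x. f x * cnj (ft g (0 + (-1) * x)))"
    by (simp add: ft_cnj)
  also have "Re (LBINT x. f x * cnj (ft g (0 + (-1) * x))) = (LBINT x. Re (f x * cnj (ft g (0 + (-1) * x))))"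
    using integrable_mult_square_integrable [OF f(2) square_integrable_cnj [OF square_integrable_affine [OF plancherel(1) [OF g]]], of "-1" 0]
    by (intro Bochner_Integration.integral_Re [symmetric]) simp
  also have "\<dots> = L2_of f \<bullet> affine_L2 (-1) 0 (L2_of (ft g))"
    using f g square_integrable_affine [OF plancherel(1) [OF g], of "-1" 0]
    by (simp add: affine_L2_of plancherel inner_L2_of inner_complex_def)
  finally show ?thesis .
qed

definition reflect_L2 :: "L2 \<Rightarrow> L2" where
  "reflect_L2 = affine_L2 (-1) 0"

lemma reflect_L2_of: "square_integrable f \<Longrightarrow> reflect_L2 (L2_of f) = L2_of (\<lambda>x. f (- x))"
  using affine_L2_of [of f "-1" 0] by (simp add: reflect_L2_def)

lemma bounded_linear_reflect: "bounded_linear reflect_L2"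
proof (rule bounded_linear_intro [of _ 1])
  show "reflect_L2 (r *\<^sub>R u) = r *\<^sub>R reflect_L2 u" for r u
    by (cases u rule: L2_of_exhaust)
       (simp add: reflect_L2_def affine_L2_of square_integrable_affine [of _ "-1" 0, simplified] square_integrable_scaleR flip: L2_of_scaleR)
qed (simp_all add: reflect_L2_def affine_L2_add norm_affine_L2)

lemma norm_reflect [simp]: "norm (reflect_L2 u) = norm u"
  by (simp add: reflect_L2_def norm_affine_L2)

lemma fourier_adjoint: "fourier u \<bullet> w = u \<bullet> reflect_L2 (fourier w)"
proof -
  obtain f where f: "\<And>n. square_integrable (f n)" "\<And>n. integrable lborel (f n)"
    "(\<lambda>n :: nat. L2_of (f n)) \<longlonglongrightarrow> u" "(\<lambda>n. L2_of (ft (f n))) \<longlonglongrightarrow> fourier u"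
    using L2_exhaust_limit [of u] by blast
  obtain g where g: "\<And>n. square_integrable (g n)" "\<And>n. integrable lborel (g n)"
    "(\<lambda>n :: nat. L2_of (g n)) \<longlonglongrightarrow> w" "(\<lambda>n. L2_of (ft (g n))) \<longlonglongrightarrow> fourier w"
    using L2_exhaust_limit [of w] by blast
  have "L2_of (ft (f n)) \<bullet> L2_of (g n) = L2_of (f n) \<bullet> reflect_L2 (L2_of (ft (g n)))" for n
    unfolding reflect_L2_def using f g by (intro inner_ft) auto
  moreover have "(\<lambda>n. L2_of (ft (f n)) \<bullet> L2_of (g n)) \<longlonglongrightarrow> fourier u \<bullet> w"
    by (intro tendsto_intros f g)
  ultimately have "(\<lambda>n. L2_of (f n) \<bullet> reflect_L2 (L2_of (ft (g n)))) \<longlonglongrightarrow> fourier u \<bullet> w"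
    by (simp only:)
  moreover have "(\<lambda>n. L2_of (f n) \<bullet> reflect_L2 (L2_of (ft (g n)))) \<longlonglongrightarrow> u \<bullet> reflect_L2 (fourier w)"
    by (intro tendsto_intros f g bounded_linear.tendsto [OF bounded_linear_reflect])
  ultimately show ?thesis
    by (rule LIMSEQ_unique)
qed

text \<open>
  The adjoint of \<open>fourier\<close> is again an isometry, being \<open>fourier\<close> followed by a reflection; hence it is
  the inverse.
\<close>

lemma fourier_reflect_fourier: "fourier (reflect_L2 (fourier w)) = w"
proof -
  define T where "T w = reflect_L2 (fourier w)" for w
  have T: "linear T" "norm (T w) = norm w" for w
    using bounded_linear.linear [OF bounded_linear_compose [OF bounded_linear_reflect bounded_linear_fourier]]
    by (simp_all add: T_def [abs_def])
  have "(fourier (T w) - w) \<bullet> z = 0" for z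
    using inner_isometry [OF T, of w z] fourier_adjoint [of "T w" z]
    by (simp add: T_def inner_diff_left)
  then show ?thesis
    unfolding T_def [symmetric] by (metis inner_eq_zero_iff right_minus_eq)
qed

lemma inj_fourier: "inj fourier"
proof (rule injI)
  fix u v assume "fourier u = fourier v"
  then have "fourier (u - v) = 0"
    by (simp add: linear_diff [OF bounded_linear.linear [OF bounded_linear_fourier]])
  then show "u = v"
    using norm_fourier [of "u - v"] by simp
qed

lemma inv_fourier: "inv fourier w = reflect_L2 (fourier w)"
  by (rule inv_f_eq [OF inj_fourier fourier_reflect_fourier])

lemma fourier_inv_fourier [simp]: "fourier (inv fourier w) = w"
  by (simp add: inv_fourier fourier_reflect_fourier)

lemma inv_fourier_fourier [simp]: "inv fourier (fourier u) = u"
  by (simp add: inj_fourier)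

lemma bounded_linear_inv_fourier: "bounded_linear (inv fourier)"
  unfolding inv_fourier [abs_def]
  by (rule bounded_linear_compose [OF bounded_linear_reflect bounded_linear_fourier])

lemma norm_inv_fourier [simp]: "norm (inv fourier u) = norm u"
  by (simp add: inv_fourier)

lemma inv_fourier_L2_of:
  assumes "integrable lborel f" "square_integrable f"
  shows "inv fourier (L2_of f) = L2_of (\<lambda>x. ft f (- x))"
  using assms by (simp add: inv_fourier fourier_L2_of reflect_L2_of plancherel)

section \<open>The Schroedinger group on the Fourier side\<close>

lemma square_integrable_mult_bounded:
  assumes [measurable]: "m \<in> borel_measurable borel" and "\<And>x. cmod (m x) \<le> B" "square_integrable f"
  shows "square_integrable (\<lambda>x. m x * f x)"
proof (rule square_integrable_dominated [OF _ square_integrable_cmult [OF assms(3), of "of_real B"]])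
  note [measurable] = square_integrable_measurable [OF assms(3)]
  show "(\<lambda>x. m x * f x) \<in> borel_measurable lborel" by measurable
  have "0 \<le> B" using assms(2) [of 0] norm_ge_zero order_trans by blast
  then show "AE x in lborel. cmod (m x * f x) \<le> cmod (of_real B * f x)"
    using assms(2) by (intro AE_I2) (simp add: norm_mult mult_right_mono)
qed

lemma mult_L2_of:
  assumes "m \<in> borel_measurable borel" "\<And>x. cmod (m x) \<le> B" "square_integrable f"
  shows "mult_L2 m (L2_of f) = L2_of (\<lambda>x. m x * f x)"
  unfolding mult_L2_def
proof (rule L2_of_cong_AE)
  show "AE x in lborel. m x * rep_L2 (L2_of f) x = m x * f x"
    using AE_rep_L2_of [OF assms(3)] by eventually_elim simp
qed (intro square_integrable_mult_bounded [OF assms(1,2)] square_integrable_rep_L2 assms(3))+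

lemma mult_L2_unimodular:
  assumes m: "m \<in> borel_measurable borel" "\<And>x. cmod (m x) = 1"
  shows "norm (mult_L2 m u) = norm u" "bounded_linear (mult_L2 m)"
proof -
  have B: "cmod (m x) \<le> 1" for x using m by simp
  note mult_L2_of' = mult_L2_of [OF m(1) B] and sq = square_integrable_mult_bounded [OF m(1) B]
  show n: "norm (mult_L2 m u) = norm u" for u
    by (cases u rule: L2_of_exhaust) (simp add: mult_L2_of' norm_L2_of sq m(2) norm_mult)
  show "bounded_linear (mult_L2 m)"
  proof (rule bounded_linear_intro [of _ 1])
    show "mult_L2 m (u + v) = mult_L2 m u + mult_L2 m v" for u v
      by (cases u rule: L2_of_exhaust, cases v rule: L2_of_exhaust)
         (simp add: mult_L2_of' sq square_integrable_add distrib_left flip: L2_of_add)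
    show "mult_L2 m (r *\<^sub>R u) = r *\<^sub>R mult_L2 m u" for r u
      by (cases u rule: L2_of_exhaust)
         (simp add: mult_L2_of' sq square_integrable_scaleR flip: L2_of_scaleR)
  qed (simp add: n)
qed

text \<open>\<open>L2\<close> carries only the structure of a real inner product space, so
  multiplication by \<open>\<i>\<close> enters as an isometric operator. It is the map written out
  in \<open>GT_solution\<close>.\<close>

definition imult :: "L2 \<Rightarrow> L2" where
  "imult = mult_L2 (\<lambda>x. \<i>)"

lemma imult_L2_of: "square_integrable f \<Longrightarrow> imult (L2_of f) = L2_of (\<lambda>x. \<i> * f x)"
  unfolding imult_def by (rule mult_L2_of [of _ 1]) auto

lemma norm_imult [simp]: "norm (imult u) = norm u"
  and bounded_linear_imult: "bounded_linear imult"
  unfolding imult_def by (intro mult_L2_unimodular; simp)+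

lemma fourier_imult: "fourier (imult u) = imult (fourier u)"
proof -
  obtain f where f: "\<And>n. square_integrable (f n)" "\<And>n. integrable lborel (f n)"
    "(\<lambda>n :: nat. L2_of (f n)) \<longlonglongrightarrow> u" "(\<lambda>n. L2_of (ft (f n))) \<longlonglongrightarrow> fourier u"
    using L2_exhaust_limit [of u] by blast
  have "fourier (imult (L2_of (f n))) = imult (L2_of (ft (f n)))" for n
    using f by (simp add: imult_L2_of fourier_L2_of square_integrable_cmult plancherel ft_cmult [abs_def])
  moreover have "(\<lambda>n. fourier (imult (L2_of (f n)))) \<longlonglongrightarrow> fourier (imult u)"
    by (intro bounded_linear.tendsto [OF bounded_linear_fourier] bounded_linear.tendsto [OF bounded_linear_imult] f)
  ultimately have "(\<lambda>n. imult (L2_of (ft (f n)))) \<longlonglongrightarrow> fourier (imult u)"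
    by (simp only:)
  moreover have "(\<lambda>n. imult (L2_of (ft (f n)))) \<longlonglongrightarrow> imult (fourier u)"
    by (intro bounded_linear.tendsto [OF bounded_linear_imult] f)
  ultimately show ?thesis
    by (rule LIMSEQ_unique)
qed

definition propagator :: "real \<Rightarrow> L2 \<Rightarrow> L2" where
  "propagator t = mult_L2 (\<lambda>\<xi>. cis (- (t * \<xi>\<^sup>2)))"

lemma schroedinger_eq: "schroedinger t u = inv fourier (propagator t (fourier u))"
  by (simp add: schroedinger_def propagator_def cis_conv_exp)

lemma propagator_L2_of:
  "square_integrable f \<Longrightarrow> propagator t (L2_of f) = L2_of (\<lambda>\<xi>. cis (- (t * \<xi>\<^sup>2)) * f \<xi>)"
  unfolding propagator_def by (rule mult_L2_of [of _ 1]) auto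

lemma square_integrable_cis_mult:
  "g \<in> borel_measurable borel \<Longrightarrow> square_integrable f \<Longrightarrow> square_integrable (\<lambda>\<xi>. cis (g \<xi>) * f \<xi>)"
  by (rule square_integrable_mult_bounded [of _ 1]) auto

lemma norm_propagator [simp]: "norm (propagator t u) = norm u"
  and bounded_linear_propagator: "bounded_linear (propagator t)"
  unfolding propagator_def by (intro mult_L2_unimodular; simp)+

lemma propagator_propagator [simp]: "propagator s (propagator t u) = propagator (s + t) u"
  by (cases u rule: L2_of_exhaust)
     (simp add: propagator_L2_of square_integrable_cis_mult cis_mult ring_distribs add.commute flip: mult.assoc)

lemma propagator_0 [simp]: "propagator 0 u = u"
  by (cases u rule: L2_of_exhaust) (simp add: propagator_L2_of)

lemma propagator_imult: "propagator t (imult u) = imult (propagator t u)"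
  by (cases u rule: L2_of_exhaust)
     (simp add: propagator_L2_of imult_L2_of square_integrable_cis_mult square_integrable_cmult mult.left_commute)

text \<open>The group is strongly but not norm continuous. So the time is varied first with v fixed,
  by dominated convergence; replacing v by the moving argument then costs only its distance to v,
  because the operators are isometries.\<close>

lemma propagator_tendsto:
  assumes "t \<longlonglongrightarrow> s" "u \<longlonglongrightarrow> v"
  shows "(\<lambda>n. propagator (t n) (u n)) \<longlonglongrightarrow> propagator s v"
proof (cases v rule: L2_of_exhaust)
  case (1 f)
  note [measurable] = square_integrable_measurable [OF 1(1)]
  have "(\<lambda>n. L2_of (\<lambda>\<xi>. cis (- (t n * \<xi>\<^sup>2)) * f \<xi>)) \<longlonglongrightarrow> L2_of (\<lambda>\<xi>. cis (- (s * \<xi>\<^sup>2)) * f \<xi>)"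
  proof (rule L2_of_tendsto_dominated [OF _ _ 1(1)])
    show "(\<lambda>n. cis (- (t n * \<xi>\<^sup>2)) * f \<xi>) \<longlonglongrightarrow> cis (- (s * \<xi>\<^sup>2)) * f \<xi>" for \<xi>
      by (intro tendsto_intros isCont_tendsto_compose [where g = cis] assms continuous_intros)
  qed (auto simp: norm_mult)
  then have "(\<lambda>n. propagator (t n) v) \<longlonglongrightarrow> propagator s v"
    using 1 by (simp add: propagator_L2_of)
  moreover have "(\<lambda>n. propagator (t n) (u n) - propagator (t n) v) \<longlonglongrightarrow> 0"
  proof (rule tendsto_norm_zero_cancel)
    have "norm (propagator (t n) (u n) - propagator (t n) v) = norm (u n - v)" for n
      by (simp flip: linear_diff [OF bounded_linear.linear [OF bounded_linear_propagator]])
    moreover have "(\<lambda>n. norm (u n - v)) \<longlonglongrightarrow> 0"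
      using assms(2) by (intro tendsto_norm_zero LIM_zero)
    ultimately show "(\<lambda>n. norm (propagator (t n) (u n) - propagator (t n) v)) \<longlonglongrightarrow> 0"
      by simp
  qed
  ultimately have "(\<lambda>n. (propagator (t n) (u n) - propagator (t n) v) + propagator (t n) v) \<longlonglongrightarrow> 0 + propagator s v"
    by (intro tendsto_add)
  then show ?thesis by simp
qed

section \<open>Functions with bounded and integrable Fourier transform\<close>

definition bounded_L1 :: "real \<Rightarrow> (real \<Rightarrow> complex) \<Rightarrow> bool" where
  "bounded_L1 M a \<longleftrightarrow> integrable lborel a \<and> (\<forall>x. cmod (a x) \<le> M)"

lemma bounded_L1D:
  assumes "bounded_L1 M a"
  shows "integrable lborel a" "cmod (a x) \<le> M" "a \<in> borel_measurable borel" "square_integrable a" "0 \<le> M"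
proof -
  show i: "integrable lborel a" and b: "cmod (a x) \<le> M" for x
    using assms by (auto simp: bounded_L1_def)
  show m [measurable]: "a \<in> borel_measurable borel"
    using borel_measurable_integrable [OF i] by simp
  show "0 \<le> M" using b [of 0] norm_ge_zero order_trans by blast
  have "integrable lborel (\<lambda>x. (cmod (a x))\<^sup>2)"
  proof (rule Bochner_Integration.integrable_bound)
    show "integrable lborel (\<lambda>x. M * cmod (a x))"
      using i by simp
    show "AE x in lborel. norm ((cmod (a x))\<^sup>2) \<le> norm (M * cmod (a x))"
      using b \<open>0 \<le> M\<close> by (intro AE_I2) (simp add: power2_eq_square mult_right_mono)
  qed measurable
  then show "square_integrable a"
    by (simp add: square_integrable_def)
qed

lemma bounded_L1_cis_mult:
  "bounded_L1 M a \<Longrightarrow> g \<in> borel_measurable borel \<Longrightarrow> bounded_L1 M (\<lambda>x. cis (g x) * a x)"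
  by (auto simp: bounded_L1_def norm_mult intro: integrable_cis_mult)

definition cubic_hat :: "L2 \<Rightarrow> L2" where
  "cubic_hat v = fourier (L2_of (cubic (rep_L2 (inv fourier v))))"

lemma inv_fourier_bounded_L1:
  assumes "bounded_L1 M a"
  shows "inv fourier (L2_of a) = L2_of (\<lambda>x. ft a (- x))" "square_integrable (\<lambda>x. ft a (- x))"
    and "cmod (ft a x) \<le> (LBINT x. cmod (a x))"
  using inv_fourier_L2_of [OF bounded_L1D(1,4) [OF assms]] norm_ft_le
    square_integrable_affine [OF plancherel(1) [OF bounded_L1D(1,4) [OF assms]], of "-1" 0]
  by simp_all

lemma borel_measurable_cubic [measurable]: "f \<in> borel_measurable borel \<Longrightarrow> cubic f \<in> borel_measurable borel"
  unfolding cubic_def [abs_def] by measurable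

lemma square_integrable_cubic:
  assumes "square_integrable f" "AE x in lborel. cmod (f x) \<le> B"
  shows "square_integrable (cubic f)"
proof (rule square_integrable_dominated [OF _ square_integrable_cmult [OF assms(1), of "of_real (B\<^sup>2)"]])
  note [measurable] = square_integrable_measurable [OF assms(1)]
  show "cubic f \<in> borel_measurable lborel" by measurable
  show "AE x in lborel. cmod (cubic f x) \<le> cmod (of_real (B\<^sup>2) * f x)"
    using assms(2)
    by eventually_elim (auto simp: cubic_def norm_mult norm_power intro!: mult_right_mono power_mono)
qed

text \<open>An integrable Fourier transform makes the physical function bounded, so its cube is
  again square integrable. For such data \<open>L2_of\<close> therefore never falls back to its
  default value.\<close>

lemma cubic_hat_bounded_L1:
  assumes "bounded_L1 M a"
  shows "cubic_hat (L2_of a) = fourier (L2_of (cubic (\<lambda>x. ft a (- x))))"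
    and "square_integrable (cubic (rep_L2 (inv fourier (L2_of a))))"
    and "square_integrable (cubic (\<lambda>x. ft a (- x)))"
proof -
  note a = inv_fourier_bounded_L1 [OF assms]
  have ae: "AE x in lborel. rep_L2 (inv fourier (L2_of a)) x = ft a (- x)"
    unfolding a(1) by (rule AE_rep_L2_of [OF a(2)])
  then have "AE x in lborel. cmod (rep_L2 (inv fourier (L2_of a)) x) \<le> (LBINT x. cmod (a x))"
    by eventually_elim (simp add: a(3))
  then show 1: "square_integrable (cubic (rep_L2 (inv fourier (L2_of a))))"
    by (rule square_integrable_cubic [OF square_integrable_rep_L2])
  show 2: "square_integrable (cubic (\<lambda>x. ft a (- x)))"
    by (rule square_integrable_cubic [OF a(2)]) (auto intro: a(3))
  show "cubic_hat (L2_of a) = fourier (L2_of (cubic (\<lambda>x. ft a (- x))))"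
    unfolding cubic_hat_def using ae
    by (intro arg_cong [where f = fourier] L2_of_cong_AE 1 2) (auto elim!: eventually_mono simp: cubic_def)
qed

section \<open>The cubic nonlinearity as a trilinear form\<close>

abbreviation lborel2 :: "(real \<times> real) measure" where
  "lborel2 \<equiv> lborel \<Otimes>\<^sub>M lborel"

lemma sigma_finite_lborel2: "sigma_finite_measure lborel2"
  by (simp add: lborel_prod lborel.sigma_finite_measure_axioms)

lemma measurable_kernel:
  assumes "case_prod k \<in> borel_measurable (borel \<Otimes>\<^sub>M borel)"
    and "f \<in> borel_measurable N" "g \<in> borel_measurable N"
  shows "(\<lambda>x. k (f x) (g x)) \<in> borel_measurable N"
  using measurable_compose [OF measurable_Pair [OF assms(2,3)] assms(1)] by simp

lemma nn_integral_pair_mult: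
  fixes f g :: "real \<Rightarrow> ennreal"
  assumes [measurable]: "f \<in> borel_measurable borel" "g \<in> borel_measurable borel"
  shows "(\<integral>\<^sup>+z. f (fst z) * g (snd z) \<partial>lborel2) = (\<integral>\<^sup>+x. f x \<partial>lborel) * (\<integral>\<^sup>+y. g y \<partial>lborel)"
proof -
  have "(\<integral>\<^sup>+z. f (fst z) * g (snd z) \<partial>lborel2) = (\<integral>\<^sup>+x. \<integral>\<^sup>+y. f x * g y \<partial>lborel \<partial>lborel)"
    by (subst lborel.nn_integral_fst [symmetric]) auto
  then show ?thesis
    by (simp add: nn_integral_cmult nn_integral_multc)
qed

lemma integrable_pair_mult:
  fixes f g :: "real \<Rightarrow> complex"
  assumes "integrable lborel f" "integrable lborel g"
  shows "integrable lborel2 (\<lambda>z. f (fst z) * g (snd z))"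
    and "(LINT z|lborel2. f (fst z) * g (snd z)) = (LBINT x. f x) * (LBINT y. g y)"
proof -
  have *: "integrable (lborel \<Otimes>\<^sub>M lborel) (\<lambda>(x, y). f x * g y)"
    using assms by (intro integrable_mult_pair) (auto intro: lborel.sigma_finite_measure_axioms)
  then show "integrable lborel2 (\<lambda>z. f (fst z) * g (snd z))"
    by (simp add: split_beta')
  have "(LINT z|lborel2. f (fst z) * g (snd z)) = (LBINT x. LBINT y. f x * g y)"
    using lborel_pair.integral_fst [OF *] by (simp add: split_beta')
  then show "(LINT z|lborel2. f (fst z) * g (snd z)) = (LBINT x. f x) * (LBINT y. g y)"
    by simp
qed

lemma ennreal_norm_integral_le:
  "ennreal (norm (LINT x|M. f x)) \<le> (\<integral>\<^sup>+x. ennreal (norm (f x)) \<partial>M)"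
  using integral_norm_bound_ennreal [of M f] not_integrable_integral_eq [of M f]
  by (cases "integrable M f") auto

text \<open>The frequencies are \<xi>1 = fst z, \<xi>3 = snd z and \<xi>2 = \<xi>1 + \<xi>3 - \<xi>;
  the middle argument b is the conjugated factor, taken at \<xi>2. The constant 1/(2 pi) is what the
  unitary normalization leaves over.\<close>

definition trilinear :: "(real \<Rightarrow> real \<Rightarrow> complex) \<Rightarrow> (real \<Rightarrow> complex) \<Rightarrow> (real \<Rightarrow> complex) \<Rightarrow> (real \<Rightarrow> complex) \<Rightarrow> real \<Rightarrow> complex" where
  "trilinear k a b c \<xi> = (LINT z|lborel2. k (fst z - \<xi>) (snd z - \<xi>) * a (fst z) * c (snd z) * cnj (b (fst z + snd z - \<xi>)))
     / of_real (2 * pi)"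

lemma measurable_trilinear [measurable]:
  assumes [measurable]: "case_prod k \<in> borel_measurable (borel \<Otimes>\<^sub>M borel)"
    "a \<in> borel_measurable borel" "b \<in> borel_measurable borel" "c \<in> borel_measurable borel"
  shows "trilinear k a b c \<in> borel_measurable borel"
proof -
  note [measurable] = measurable_kernel [OF assms(1)]
  show ?thesis
    unfolding trilinear_def [abs_def] by measurable
qed

text \<open>The conjugated factor is left out on purpose: the same Q then serves for the supremum
  bound and for the L^1 bound of the trilinear form, each of them inherited from that
  factor.\<close>

definition weight_bound :: "(real \<Rightarrow> real \<Rightarrow> real) \<Rightarrow> (real \<Rightarrow> complex) \<Rightarrow> (real \<Rightarrow> complex) \<Rightarrow> real \<Rightarrow> bool" where
  "weight_bound \<kappa> a c Q \<longleftrightarrow> (\<forall>\<xi>. (\<integral>\<^sup>+z. ennreal (\<kappa> (fst z - \<xi>) (snd z - \<xi>) * cmod (a (fst z)) * cmod (c (snd z))) \<partial>lborel2) \<le> ennreal Q)"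

lemma norm_trilinear_le:
  "ennreal (cmod (trilinear k a b c \<xi>)) \<le> (\<integral>\<^sup>+z. ennreal (cmod (k (fst z - \<xi>) (snd z - \<xi>)) * cmod (a (fst z)) * cmod (c (snd z)) * cmod (b (fst z + snd z - \<xi>))) \<partial>lborel2)"
proof -
  let ?I = "LINT z|lborel2. k (fst z - \<xi>) (snd z - \<xi>) * a (fst z) * c (snd z) * cnj (b (fst z + snd z - \<xi>))"
  have "cmod ?I / (2 * pi) \<le> cmod ?I / 1"
    using pi_ge_two by (intro divide_left_mono) auto
  then have "ennreal (cmod (trilinear k a b c \<xi>)) \<le> ennreal (cmod ?I)"
    by (simp add: trilinear_def norm_divide norm_mult ennreal_leI)
  also have "\<dots> \<le> (\<integral>\<^sup>+z. ennreal (cmod (k (fst z - \<xi>) (snd z - \<xi>) * a (fst z) * c (snd z) * cnj (b (fst z + snd z - \<xi>)))) \<partial>lborel2)"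
    by (rule ennreal_norm_integral_le)
  finally show ?thesis
    by (simp add: norm_mult)
qed

lemma trilinear_bound:
  assumes [measurable]: "case_prod \<kappa> \<in> borel_measurable (borel \<Otimes>\<^sub>M borel)"
    "a \<in> borel_measurable borel" "c \<in> borel_measurable borel"
    and k: "\<And>p q. cmod (k p q) \<le> \<kappa> p q" and b: "\<And>x. cmod (b x) \<le> M"
    and Q: "weight_bound \<kappa> a c Q" and "0 \<le> Q"
  shows "cmod (trilinear k a b c \<xi>) \<le> M * Q"
proof -
  note [measurable] = measurable_kernel [OF assms(1)]
  have "0 \<le> M" using b [of 0] norm_ge_zero order_trans by blast
  have \<kappa>: "0 \<le> \<kappa> p q" for p q using k [of p q] norm_ge_zero order_trans by blast
  have "ennreal (cmod (trilinear k a b c \<xi>)) \<le> (\<integral>\<^sup>+z. ennreal M * ennreal (\<kappa> (fst z - \<xi>) (snd z - \<xi>) * cmod (a (fst z)) * cmod (c (snd z))) \<partial>lborel2)"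
  proof (rule order_trans [OF norm_trilinear_le], rule nn_integral_mono)
    fix z :: "real \<times> real"
    have "cmod (k (fst z - \<xi>) (snd z - \<xi>)) * cmod (a (fst z)) * cmod (c (snd z)) * cmod (b (fst z + snd z - \<xi>))
        \<le> \<kappa> (fst z - \<xi>) (snd z - \<xi>) * cmod (a (fst z)) * cmod (c (snd z)) * M"
      using k b \<kappa> by (intro mult_mono) auto
    then show "ennreal (cmod (k (fst z - \<xi>) (snd z - \<xi>)) * cmod (a (fst z)) * cmod (c (snd z)) * cmod (b (fst z + snd z - \<xi>)))
        \<le> ennreal M * ennreal (\<kappa> (fst z - \<xi>) (snd z - \<xi>) * cmod (a (fst z)) * cmod (c (snd z)))"
      using \<open>0 \<le> M\<close> \<kappa> by (simp add: mult.commute flip: ennreal_mult)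
  qed
  also have "\<dots> = ennreal M * (\<integral>\<^sup>+z. ennreal (\<kappa> (fst z - \<xi>) (snd z - \<xi>) * cmod (a (fst z)) * cmod (c (snd z))) \<partial>lborel2)"
    by (rule nn_integral_cmult) measurable
  also have "\<dots> \<le> ennreal M * ennreal Q"
    using Q by (intro mult_left_mono) (auto simp: weight_bound_def)
  finally show ?thesis
    using \<open>0 \<le> M\<close> \<open>0 \<le> Q\<close> by (simp flip: ennreal_mult)
qed

text \<open>The L^1 bound follows from the same Q by Tonelli's theorem: for fixed z the substitution
  of \<xi>1 + \<xi>3 - \<xi> for \<xi> moves the shift off b and sends (p, q) to (- q, - p), under
  which the majorant is invariant. What remains is the integral over z that Q bounds for each
  \<xi>.\<close>

lemma trilinear_bounded_L1:
  assumes [measurable]: "case_prod \<kappa> \<in> borel_measurable (borel \<Otimes>\<^sub>M borel)" "case_prod k \<in> borel_measurable (borel \<Otimes>\<^sub>M borel)"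
    and \<kappa>_even: "\<And>p q. \<kappa> (- q) (- p) = \<kappa> p q"
    and a [measurable]: "a \<in> borel_measurable borel" and c [measurable]: "c \<in> borel_measurable borel"
    and k: "\<And>p q. cmod (k p q) \<le> \<kappa> p q" and b: "bounded_L1 M b"
    and Q: "weight_bound \<kappa> a c Q" and "0 \<le> Q"
  shows "bounded_L1 (M * Q) (trilinear k a b c)" and "(LBINT x. cmod (trilinear k a b c x)) \<le> Q * (LBINT x. cmod (b x))"
proof -
  note [measurable] = bounded_L1D(3) [OF b]
  note [measurable] = measurable_kernel [OF assms(1)]
  interpret P: pair_sigma_finite "lborel :: real measure" lborel2
    by (intro pair_sigma_finite.intro sigma_finite_lborel2 lborel.sigma_finite_measure_axioms)
  have \<kappa>: "0 \<le> \<kappa> p q" for p q using k [of p q] norm_ge_zero order_trans by blast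
  define W where "W \<xi> z = ennreal (\<kappa> (fst z - \<xi>) (snd z - \<xi>) * cmod (a (fst z)) * cmod (c (snd z)))" for \<xi> z
  have [measurable]: "(\<lambda>(\<xi>, z). W \<xi> z) \<in> borel_measurable (lborel \<Otimes>\<^sub>M lborel2)"
    unfolding W_def by (simp add: split_beta')
  have [measurable]: "W \<xi> \<in> borel_measurable lborel2" "(\<lambda>\<xi>. W \<xi> z) \<in> borel_measurable lborel" for \<xi> z
    unfolding W_def by measurable
  have "(\<integral>\<^sup>+\<xi>. ennreal (cmod (trilinear k a b c \<xi>)) \<partial>lborel)
      \<le> (\<integral>\<^sup>+\<xi>. \<integral>\<^sup>+z. W \<xi> z * ennreal (cmod (b (fst z + snd z - \<xi>))) \<partial>lborel2 \<partial>lborel)"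
  proof (rule nn_integral_mono, rule order_trans [OF norm_trilinear_le], rule nn_integral_mono)
    fix \<xi> and z :: "real \<times> real"
    have "cmod (k (fst z - \<xi>) (snd z - \<xi>)) * cmod (a (fst z)) * cmod (c (snd z)) * cmod (b (fst z + snd z - \<xi>))
        \<le> \<kappa> (fst z - \<xi>) (snd z - \<xi>) * cmod (a (fst z)) * cmod (c (snd z)) * cmod (b (fst z + snd z - \<xi>))"
      using k \<kappa> by (intro mult_mono) auto
    then show "ennreal (cmod (k (fst z - \<xi>) (snd z - \<xi>)) * cmod (a (fst z)) * cmod (c (snd z)) * cmod (b (fst z + snd z - \<xi>)))
        \<le> W \<xi> z * ennreal (cmod (b (fst z + snd z - \<xi>)))"
      using \<kappa> by (simp add: W_def flip: ennreal_mult)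
  qed
  also have "\<dots> = (\<integral>\<^sup>+z. \<integral>\<^sup>+\<xi>. W \<xi> z * ennreal (cmod (b (fst z + snd z - \<xi>))) \<partial>lborel \<partial>lborel2)"
    by (rule P.Fubini' [symmetric]) (simp add: split_beta')
  also have "\<dots> = (\<integral>\<^sup>+z. \<integral>\<^sup>+\<xi>. W \<xi> z * ennreal (cmod (b \<xi>)) \<partial>lborel \<partial>lborel2)"
  proof (rule nn_integral_cong)
    fix z :: "real \<times> real"
    have "(\<integral>\<^sup>+\<xi>. W \<xi> z * ennreal (cmod (b (fst z + snd z - \<xi>))) \<partial>lborel)
        = ennreal \<bar>-1\<bar> * (\<integral>\<^sup>+\<xi>. W ((fst z + snd z) + (-1) * \<xi>) z * ennreal (cmod (b (fst z + snd z - ((fst z + snd z) + (-1) * \<xi>)))) \<partial>lborel)"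
      by (rule nn_integral_real_affine) simp_all
    moreover have "W ((fst z + snd z) + (-1) * \<xi>) z = W \<xi> z" for \<xi>
      using \<kappa>_even [of "snd z - \<xi>" "fst z - \<xi>"] \<kappa>_even [of "fst z - \<xi>" "snd z - \<xi>"] by (simp add: W_def)
    ultimately show "(\<integral>\<^sup>+\<xi>. W \<xi> z * ennreal (cmod (b (fst z + snd z - \<xi>))) \<partial>lborel)
        = (\<integral>\<^sup>+\<xi>. W \<xi> z * ennreal (cmod (b \<xi>)) \<partial>lborel)"
      by simp
  qed
  also have "\<dots> = (\<integral>\<^sup>+\<xi>. \<integral>\<^sup>+z. W \<xi> z * ennreal (cmod (b \<xi>)) \<partial>lborel2 \<partial>lborel)"
    by (rule P.Fubini') (simp add: split_beta')
  also have "\<dots> = (\<integral>\<^sup>+\<xi>. (\<integral>\<^sup>+z. W \<xi> z \<partial>lborel2) * ennreal (cmod (b \<xi>)) \<partial>lborel)"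
    by (intro nn_integral_cong nn_integral_multc) measurable
  also have "\<dots> \<le> (\<integral>\<^sup>+\<xi>. ennreal Q * ennreal (cmod (b \<xi>)) \<partial>lborel)"
    using Q by (intro nn_integral_mono mult_right_mono) (auto simp: weight_bound_def W_def)
  also have "\<dots> = ennreal Q * ennreal (LBINT x. cmod (b x))"
    using bounded_L1D(1) [OF b] by (subst nn_integral_cmult) (auto simp: nn_integral_eq_integral)
  also have "\<dots> = ennreal (Q * (LBINT x. cmod (b x)))"
    using \<open>0 \<le> Q\<close> by (simp add: ennreal_mult integral_nonneg_AE)
  finally have *: "(\<integral>\<^sup>+\<xi>. ennreal (cmod (trilinear k a b c \<xi>)) \<partial>lborel) \<le> ennreal (Q * (LBINT x. cmod (b x)))" .
  have m: "trilinear k a b c \<in> borel_measurable lborel"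
    by simp
  have i: "integrable lborel (trilinear k a b c)"
    using * by (intro integrableI_bounded m) (auto simp: le_less_trans)
  then show "bounded_L1 (M * Q) (trilinear k a b c)"
    using trilinear_bound [OF assms(1) a c k bounded_L1D(2) [OF b] Q \<open>0 \<le> Q\<close>] by (simp add: bounded_L1_def)
  show "(LBINT x. cmod (trilinear k a b c x)) \<le> Q * (LBINT x. cmod (b x))"
    using * i \<open>0 \<le> Q\<close> by (simp add: nn_integral_eq_integral integral_nonneg_AE)
qed

lemma weight_bound_1:
  assumes "integrable lborel a" "integrable lborel c"
  shows "weight_bound (\<lambda>p q. 1) a c ((LBINT x. cmod (a x)) * (LBINT x. cmod (c x)))"
  unfolding weight_bound_def
proof
  fix \<xi> :: real
  note [measurable] = borel_measurable_integrable [OF assms(1)] borel_measurable_integrable [OF assms(2)]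
  have "(\<integral>\<^sup>+z. ennreal (1 * cmod (a (fst z)) * cmod (c (snd z))) \<partial>lborel2)
      = (\<integral>\<^sup>+z. ennreal (cmod (a (fst z))) * ennreal (cmod (c (snd z))) \<partial>lborel2)"
    by (simp add: ennreal_mult)
  also have "\<dots> = ennreal (LBINT x. cmod (a x)) * ennreal (LBINT x. cmod (c x))"
    using assms by (subst nn_integral_pair_mult) (auto simp: nn_integral_eq_integral)
  finally show "(\<integral>\<^sup>+z. ennreal (1 * cmod (a (fst z)) * cmod (c (snd z))) \<partial>lborel2)
      \<le> ennreal ((LBINT x. cmod (a x)) * (LBINT x. cmod (c x)))"
    by (simp add: ennreal_mult integral_nonneg_AE)
qed

lemma trilinear_1_bounded_L1:
  assumes a: "bounded_L1 M a"
  shows "bounded_L1 (M * (LBINT x. cmod (a x))\<^sup>2) (trilinear (\<lambda>p q. 1) a a a)"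
  using trilinear_bounded_L1(1) [of "\<lambda>p q. 1" "\<lambda>p q. 1" a a M a, OF _ _ _ bounded_L1D(3) [OF a] bounded_L1D(3) [OF a] _ a weight_bound_1 [OF bounded_L1D(1) [OF a] bounded_L1D(1) [OF a]]]
  by (simp add: power2_eq_square integral_nonneg_AE)

text \<open>The convolution theorem for three factors. With \<eta> = \<xi>1 + \<xi>3 - \<xi> the
  phase splits as x \<xi> = x \<xi>1 + x \<xi>3 - x \<eta>, and the minus sign belongs to the
  conjugated factor. The argument is - x because \<open>inv fourier\<close> is the reflected
  transform.\<close>

lemma ft_trilinear:
  assumes a: "bounded_L1 M a"
  shows "ft (trilinear (\<lambda>p q. 1) a a a) (- x) = cubic (\<lambda>x. ft a (- x)) x"
proof -
  note [measurable] = bounded_L1D(3) [OF a]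
  let ?s = "complex_of_real (sqrt (2 * pi))"
  have s: "?s * ?s = of_real (2 * pi)" "?s \<noteq> 0"
    by (simp_all flip: of_real_mult)
  interpret P: pair_sigma_finite lborel2 "lborel :: real measure"
    by (intro pair_sigma_finite.intro sigma_finite_lborel2 lborel.sigma_finite_measure_axioms)
  define F where "F z \<xi> = cis (x * \<xi>) * (a (fst z) * a (snd z) * cnj (a (fst z + snd z - \<xi>)))" for z \<xi>
  have shift: "integrable lborel (\<lambda>\<xi>. a (t - \<xi>))" for t
    using lborel_integrable_real_affine [OF bounded_L1D(1) [OF a], of "-1" t] by simp
  have shift_norm: "(LBINT \<xi>. cmod (a (t - \<xi>))) = (LBINT \<xi>. cmod (a \<xi>))" for t
    using lborel_integral_real_affine [of "-1" "\<lambda>\<xi>. cmod (a \<xi>)" t] by simp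
  have int: "integrable (lborel2 \<Otimes>\<^sub>M lborel) (\<lambda>(z, \<xi>). F z \<xi>)"
  proof (rule P.Fubini_integrable)
    show "(\<lambda>(z, \<xi>). F z \<xi>) \<in> borel_measurable (lborel2 \<Otimes>\<^sub>M lborel)"
      unfolding F_def by (simp add: split_beta')
    have "integrable lborel2 (\<lambda>z. of_real (LBINT \<xi>. cmod (a \<xi>)) * (a (fst z) * a (snd z)))"
      using integrable_pair_mult(1) [OF bounded_L1D(1) [OF a] bounded_L1D(1) [OF a]] by (rule integrable_mult_right)
    then have "integrable lborel2 (\<lambda>z. cmod (of_real (LBINT \<xi>. cmod (a \<xi>)) * (a (fst z) * a (snd z))))"
      by (rule integrable_norm)
    moreover have "(LBINT \<xi>. cmod (F z \<xi>)) = cmod (of_real (LBINT \<xi>. cmod (a \<xi>)) * (a (fst z) * a (snd z)))" for z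
      by (simp add: F_def norm_mult shift_norm integral_nonneg_AE)
    ultimately show "integrable lborel2 (\<lambda>z. LBINT \<xi>. norm (case (z, \<xi>) of (z, \<xi>) \<Rightarrow> F z \<xi>))"
      by simp
    show "AE z in lborel2. integrable lborel (\<lambda>\<xi>. case (z, \<xi>) of (z, \<xi>) \<Rightarrow> F z \<xi>)"
      using shift by (auto simp: F_def intro!: integrable_cis_mult AE_I2)
  qed
  have inner: "(LBINT \<xi>. F z \<xi>) = cis (x * fst z) * a (fst z) * (cis (x * snd z) * a (snd z)) * (?s * cnj (ft a (- x)))" for z
  proof -
    have "(LBINT \<xi>. F z \<xi>) = (LBINT \<eta>. F z ((fst z + snd z) + (-1) * \<eta>))"
      by (subst lborel_integral_real_affine [of "-1" _ "fst z + snd z"]) auto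
    also have "\<dots> = (LBINT \<eta>. (cis (x * fst z) * a (fst z) * (cis (x * snd z) * a (snd z))) * cnj (cis (- (\<eta> * (- x))) * a \<eta>))"
      by (intro Bochner_Integration.integral_cong refl)
         (simp add: F_def cis_cnj ring_distribs mult_ac cis_mult [symmetric] cis_divide [symmetric] divide_inverse)
    also have "\<dots> = cis (x * fst z) * a (fst z) * (cis (x * snd z) * a (snd z)) * (LBINT \<eta>. cnj (cis (- (\<eta> * (- x))) * a \<eta>))"
      by (rule integral_mult_right_zero)
    also have "(LBINT \<eta>. cnj (cis (- (\<eta> * (- x))) * a \<eta>)) = cnj (LBINT \<eta>. cis (- (\<eta> * (- x))) * a \<eta>)"
      by (rule Bochner_Integration.integral_cnj)
    also have "\<dots> = ?s * cnj (ft a (- x))"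
      using s(2) by (simp add: ft_def)
    finally show ?thesis .
  qed
  have "ft (trilinear (\<lambda>p q. 1) a a a) (- x) = (LBINT \<xi>. (LINT z|lborel2. F z \<xi>)) / of_real (2 * pi) / ?s"
    by (simp add: ft_def trilinear_def F_def mult.commute [of x])
  also have "(LBINT \<xi>. (LINT z|lborel2. F z \<xi>)) = (LINT z|lborel2. (LBINT \<xi>. F z \<xi>))"
    by (rule P.Fubini_integral [OF int])
  also have "\<dots> = (LINT z|lborel2. (cis (- (fst z * - x)) * a (fst z)) * (cis (- (snd z * - x)) * a (snd z))) * (?s * cnj (ft a (- x)))"
    by (simp add: inner mult.commute [of x])
  also have "(LINT z|lborel2. (cis (- (fst z * - x)) * a (fst z)) * (cis (- (snd z * - x)) * a (snd z)))
      = (LBINT y. cis (- (y * - x)) * a y) * (LBINT y. cis (- (y * - x)) * a y)"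
    by (rule integrable_pair_mult(2); rule integrable_cis_mult [OF bounded_L1D(1) [OF a]]; simp)
  also have "(LBINT y. cis (- (y * - x)) * a y) = ?s * ft a (- x)"
    using s(2) by (simp add: ft_def)
  also have "(?s * ft a (- x)) * (?s * ft a (- x)) * (?s * cnj (ft a (- x))) / of_real (2 * pi) / ?s
      = ft a (- x) * ft a (- x) * cnj (ft a (- x))"
    unfolding s(1) [symmetric] using s(2) by (simp add: field_simps)
  also have "\<dots> = cubic (\<lambda>x. ft a (- x)) x"
    by (simp add: cubic_def complex_norm_square mult_ac del: of_real_power)
  finally show ?thesis .
qed

text \<open>The convolution theorem computes the inverse transform of the trilinear form; applying
  \<open>fourier\<close> to both sides gives the claim.\<close>

lemma cubic_hat_L2_of:
  assumes a: "bounded_L1 M a"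
  shows "cubic_hat (L2_of a) = L2_of (trilinear (\<lambda>p q. 1) a a a)"
proof -
  note t = bounded_L1D [OF trilinear_1_bounded_L1 [OF a]]
  have "inv fourier (L2_of (trilinear (\<lambda>p q. 1) a a a)) = L2_of (cubic (\<lambda>x. ft a (- x)))"
    unfolding inv_fourier_L2_of [OF t(1,4)] ft_trilinear [OF a] ..
  then show ?thesis
    unfolding cubic_hat_bounded_L1(1) [OF a] by (metis fourier_inv_fourier)
qed

text \<open>The nonlinearity in the interaction picture: conjugated with the free flow for a time
  \<eta>, which will be \<sigma> + \<gamma> \<tau>.\<close>

definition dressed_cubic :: "real \<Rightarrow> L2 \<Rightarrow> L2" where
  "dressed_cubic \<eta> v = propagator (- \<eta>) (cubic_hat (propagator \<eta> v))"

lemma dressed_cubic_L2_of: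
  assumes a: "bounded_L1 M a"
  shows "dressed_cubic \<eta> (L2_of a) = L2_of (trilinear (\<lambda>p q. cis (2 * \<eta> * p * q)) a a a)"
proof -
  define b where "b \<xi> = cis (- (\<eta> * \<xi>\<^sup>2)) * a \<xi>" for \<xi>
  have b: "bounded_L1 M b"
    unfolding b_def by (rule bounded_L1_cis_mult [OF a]) simp
  \<comment> \<open>The resonance identity \<xi>^2 - y^2 - z^2 + (y + z - \<xi>)^2 = 2 (y - \<xi>)
    (z - \<xi>).\<close>
  have phase: "cis (\<eta> * \<xi>\<^sup>2) * cis (- (\<eta> * y\<^sup>2)) * cis (- (\<eta> * z\<^sup>2)) * cis (\<eta> * (y + z - \<xi>)\<^sup>2)
      = cis (2 * \<eta> * (y - \<xi>) * (z - \<xi>))" for \<xi> y z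
    by (simp add: cis_mult power2_eq_square algebra_simps)
  have b_eq: "cis (\<eta> * \<xi>\<^sup>2) * (1 * b y * b z * cnj (b (y + z - \<xi>)))
      = cis (2 * \<eta> * (y - \<xi>) * (z - \<xi>)) * a y * a z * cnj (a (y + z - \<xi>))" for \<xi> y z
    unfolding phase [symmetric] by (simp add: b_def cis_cnj mult_ac)
  have "dressed_cubic \<eta> (L2_of a) = L2_of (\<lambda>\<xi>. cis (\<eta> * \<xi>\<^sup>2) * trilinear (\<lambda>p q. 1) b b b \<xi>)"
    unfolding dressed_cubic_def propagator_L2_of [OF bounded_L1D(4) [OF a]] b_def [symmetric] cubic_hat_L2_of [OF b]
    by (subst propagator_L2_of [OF bounded_L1D(4) [OF trilinear_1_bounded_L1 [OF b]]]) simp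
  also have "(\<lambda>\<xi>. cis (\<eta> * \<xi>\<^sup>2) * trilinear (\<lambda>p q. 1) b b b \<xi>) = trilinear (\<lambda>p q. cis (2 * \<eta> * p * q)) a a a"
  proof
    fix \<xi>
    have "cis (\<eta> * \<xi>\<^sup>2) * trilinear (\<lambda>p q. 1) b b b \<xi>
        = (LINT z|lborel2. cis (\<eta> * \<xi>\<^sup>2) * (1 * b (fst z) * b (snd z) * cnj (b (fst z + snd z - \<xi>)))) / of_real (2 * pi)"
      unfolding trilinear_def by (simp only: integral_mult_right_zero times_divide_eq_right)
    also have "\<dots> = trilinear (\<lambda>p q. cis (2 * \<eta> * p * q)) a a a \<xi>"
      unfolding trilinear_def
      by (intro arg_cong2 [where f = "(/)"] Bochner_Integration.integral_cong refl)
         (simp only: b_eq)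
    finally show "cis (\<eta> * \<xi>\<^sup>2) * trilinear (\<lambda>p q. 1) b b b \<xi> = trilinear (\<lambda>p q. cis (2 * \<eta> * p * q)) a a a \<xi>" .
  qed
  finally show ?thesis .
qed

section \<open>Simultaneous bounds in \<open>L\<^sup>1\<close> and \<open>L\<^sup>\<infinity>\<close>\<close>

text \<open>Two kinds of test functions with their price c: an integrable \<phi> costs its L^1 norm
  and detects the supremum, while a \<phi> bounded by 1 costs N and detects the L^1 norm. Both have
  to lie in L^2 for the pairing to make sense.\<close>

definition dual_test :: "real \<Rightarrow> L2 \<Rightarrow> real \<Rightarrow> bool" where
  "dual_test N w c \<longleftrightarrow> (\<exists>\<phi>. square_integrable \<phi> \<and> w = L2_of \<phi> \<and>
     (integrable lborel \<phi> \<and> c = (LBINT x. cmod (\<phi> x)) \<or> (\<forall>x. cmod (\<phi> x) \<le> 1) \<and> c = N))"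

text \<open>
  \<open>L1_Linf N M v\<close> says that \<open>v\<close> has \<open>L\<^sup>\<infinity>\<close> norm at most \<open>M\<close> and \<open>L\<^sup>1\<close> norm at most \<open>N * M\<close>; see
  \<open>L1_LinfE\<close> and \<open>L1_Linf_L2_of\<close>. In this dual form the bound passes to limits and integrals.
\<close>

definition L1_Linf :: "real \<Rightarrow> real \<Rightarrow> L2 \<Rightarrow> bool" where
  "L1_Linf N M v \<longleftrightarrow> (\<forall>w c. dual_test N w c \<longrightarrow> v \<bullet> w \<le> M * c)"

lemma dual_test_nonneg: "dual_test N w c \<Longrightarrow> 0 \<le> N \<Longrightarrow> 0 \<le> c"
  by (auto simp: dual_test_def integral_nonneg_AE)

lemma L1_LinfD: "L1_Linf N M v \<Longrightarrow> dual_test N w c \<Longrightarrow> v \<bullet> w \<le> M * c"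
  by (simp add: L1_Linf_def)

lemma L1_Linf_mono: "L1_Linf N M v \<Longrightarrow> M \<le> M' \<Longrightarrow> 0 \<le> N \<Longrightarrow> L1_Linf N M' v"
  unfolding L1_Linf_def by (meson dual_test_nonneg mult_right_mono order_trans)

lemma L1_Linf_scaleR: "L1_Linf N M v \<Longrightarrow> 0 \<le> r \<Longrightarrow> L1_Linf N (r * M) (r *\<^sub>R v)"
  by (simp add: L1_Linf_def mult.assoc mult_left_mono)

lemma L1_Linf_lim:
  assumes "\<And>n. L1_Linf N M (v n)" "v \<longlonglongrightarrow> w"
  shows "L1_Linf N M w"
  unfolding L1_Linf_def
proof (intro allI impI)
  fix z c assume z: "dual_test N z c"
  have "(\<lambda>n. v n \<bullet> z) \<longlonglongrightarrow> w \<bullet> z"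
    by (intro tendsto_intros assms)
  then show "w \<bullet> z \<le> M * c"
    by (rule LIMSEQ_le_const2) (use assms(1) z L1_LinfD in blast)
qed

lemma L1_Linf_L2_of:
  assumes a: "bounded_L1 M a" and "(LBINT x. cmod (a x)) \<le> N * M"
  shows "L1_Linf N M (L2_of a)"
  unfolding L1_Linf_def
proof (intro allI impI)
  fix w c assume "dual_test N w c"
  then obtain \<phi> where \<phi>: "square_integrable \<phi>" "w = L2_of \<phi>"
    and c: "integrable lborel \<phi> \<and> c = (LBINT x. cmod (\<phi> x)) \<or> (\<forall>x. cmod (\<phi> x) \<le> 1) \<and> c = N"
    by (auto simp: dual_test_def)
  have le: "a x \<bullet> \<phi> x \<le> cmod (a x) * cmod (\<phi> x)" for x
    by (rule norm_cauchy_schwarz)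
  note int = integrable_inner_square_integrable [OF bounded_L1D(4) [OF a] \<phi>(1)]
  have eq: "L2_of a \<bullet> w = (LBINT x. a x \<bullet> \<phi> x)"
    using \<phi> bounded_L1D(4) [OF a] by (simp add: inner_L2_of)
  from c show "L2_of a \<bullet> w \<le> M * c"
  proof
    assume c: "integrable lborel \<phi> \<and> c = (LBINT x. cmod (\<phi> x))"
    have "(LBINT x. a x \<bullet> \<phi> x) \<le> (LBINT x. M * cmod (\<phi> x))"
      using c by (intro integral_mono int order_trans [OF le mult_right_mono [OF bounded_L1D(2) [OF a]]]) auto
    then show ?thesis using c by (simp add: eq)
  next
    assume c: "(\<forall>x. cmod (\<phi> x) \<le> 1) \<and> c = N"
    have "cmod (a x) * cmod (\<phi> x) \<le> cmod (a x)" for x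
      using c mult_left_mono [of "cmod (\<phi> x)" 1 "cmod (a x)"] by simp
    then have "(LBINT x. a x \<bullet> \<phi> x) \<le> (LBINT x. cmod (a x))"
      using bounded_L1D(1) [OF a] by (intro integral_mono int order_trans [OF le]) auto
    also have "\<dots> \<le> M * c"
      using assms(2) c by (simp add: mult.commute)
    finally show ?thesis by (simp add: eq)
  qed
qed

lemma inner_sgn_complex: "z \<bullet> sgn z = cmod z"
  by (cases "z = 0") (simp_all add: sgn_div_norm power2_norm_eq_inner [symmetric] power2_eq_square)

lemma integrable_indicator_bounded:
  assumes [measurable]: "A \<in> sets borel" and "A \<subseteq> {a..b::real}"
  shows "integrable lborel (indicat_real A)" "integrable lborel (\<lambda>x. s * indicator A x :: complex)"
proof -
  have "emeasure lborel A \<le> emeasure lborel {a..b}"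
    using assms by (intro emeasure_mono) auto
  also have "\<dots> < \<infinity>"
    by (simp add: emeasure_lborel_Icc_eq)
  finally show int: "integrable lborel (indicat_real A)"
    by (simp add: integrable_indicator_iff)
  have "integrable lborel (\<lambda>x. s * complex_of_real (indicator A x))"
    using int by (intro integrable_mult_right integrable_of_real)
  then show "integrable lborel (\<lambda>x. s * indicator A x :: complex)"
    by (rule Bochner_Integration.integrable_cong [THEN iffD1, rotated 2]) (auto simp: indicator_def)
qed

text \<open>Testing with the indicator of the unit interval and with its negative, each of price 1,
  bounds 0 by 2 M.\<close>

lemma L1_Linf_nonneg:
  assumes "L1_Linf N M v"
  shows "0 \<le> M"
proof -
  let ?\<phi> = "\<lambda>s x. s * indicator {0..1::real} x :: complex"
  have sq: "square_integrable (?\<phi> s)" for s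
    by (rule square_integrable_indicator [of _ 0 1]) auto
  have int: "integrable lborel (?\<phi> s)" for s
    by (rule integrable_indicator_bounded [of _ 0 1]) auto
  have one: "(LBINT x. cmod (?\<phi> s x)) = 1" if "cmod s = 1" for s
  proof -
    have "(LBINT x. cmod (?\<phi> s x)) = (LBINT x. indicator {0..1::real} x)"
      by (rule Bochner_Integration.integral_cong [OF refl]) (auto simp: indicator_def norm_mult that)
    then show ?thesis by simp
  qed
  have "dual_test N (L2_of (?\<phi> s)) 1" if "cmod s = 1" for s
    unfolding dual_test_def using sq int one [OF that] by (intro exI [of _ "?\<phi> s"]) simp
  then have "v \<bullet> L2_of (?\<phi> s) \<le> M" if "cmod s = 1" for s
    using L1_LinfD [OF assms, of "L2_of (?\<phi> s)" 1] that by simp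
  from this [of 1] this [of "-1"] have "v \<bullet> L2_of (?\<phi> 1) \<le> M" "v \<bullet> L2_of (?\<phi> (-1)) \<le> M"
    by simp_all
  moreover have "L2_of (?\<phi> (-1)) = - L2_of (?\<phi> 1)"
    using L2_of_scaleR [OF sq, of "-1" 1] by simp
  ultimately show ?thesis by simp
qed

text \<open>Duality read backwards. The sign of the function, restricted to the set where its
  modulus exceeds M, shows that this set is null; the sign on growing intervals gives the L^1 bound
  by monotone convergence.\<close>

lemma L1_LinfE:
  assumes v: "L1_Linf N M v"
  obtains a where "bounded_L1 M a" "(LBINT x. cmod (a x)) \<le> N * M" "v = L2_of a"
proof -
  define a0 where "a0 = rep_L2 v"
  have a0: "square_integrable a0" "v = L2_of a0" and [measurable]: "a0 \<in> borel_measurable borel"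
    using square_integrable_measurable [of a0] by (simp_all add: a0_def)
  have sgn_meas [measurable]: "(\<lambda>x. sgn (a0 x)) \<in> borel_measurable borel"
    unfolding sgn_div_norm by measurable
  have sgn_le: "cmod (sgn z) \<le> 1" for z :: complex
    by (simp add: norm_sgn)
  have "AE x in lborel. x \<in> {- real n..real n} \<longrightarrow> cmod (a0 x) \<le> M" for n
  proof -
    \<comment> \<open>The excess set is cut to a window, so that the test function is
      integrable.\<close>
    define A where "A = {x \<in> {- real n..real n}. M < cmod (a0 x)}"
    have A [measurable]: "A \<in> sets borel" and A_sub: "A \<subseteq> {- real n..real n}"
      unfolding A_def by auto
    define \<phi> where "\<phi> x = sgn (a0 x) * indicator A x" for x
    have ind: "square_integrable (\<lambda>x. 1 * indicator A x)"
      by (rule square_integrable_indicator [OF A A_sub])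
    have sq: "square_integrable \<phi>"
      unfolding \<phi>_def using square_integrable_mult_bounded [OF sgn_meas sgn_le ind] by simp
    have fin: "integrable lborel (indicat_real A)"
      by (rule integrable_indicator_bounded [OF A A_sub])
    have int: "integrable lborel \<phi>"
      by (rule Bochner_Integration.integrable_bound [OF fin])
         (use square_integrable_measurable [OF sq] in \<open>auto simp: \<phi>_def norm_mult indicator_def norm_sgn\<close>)
    have "v \<bullet> L2_of \<phi> \<le> M * (LBINT x. cmod (\<phi> x))"
      using sq int by (intro L1_LinfD [OF v]) (auto simp: dual_test_def)
    also have "\<dots> \<le> M * (LBINT x. indicator A x)"
      by (intro mult_left_mono integral_mono integrable_norm int fin L1_Linf_nonneg [OF v])
         (auto simp: \<phi>_def norm_mult indicator_def norm_sgn)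
    also have "v \<bullet> L2_of \<phi> = (LBINT x. cmod (a0 x) * indicator A x)"
      unfolding a0(2) inner_L2_of [OF a0(1) sq]
      by (rule Bochner_Integration.integral_cong [OF refl]) (auto simp: \<phi>_def indicator_def inner_sgn_complex)
    finally have le: "(LBINT x. cmod (a0 x) * indicator A x) \<le> (LBINT x. M * indicator A x)"
      by simp
    have int2: "integrable lborel (\<lambda>x. cmod (a0 x) * indicator A x)"
      using integrable_cmod_mult(1) [OF a0(1) ind]
      by (rule Bochner_Integration.integrable_cong [THEN iffD1, rotated 2]) (auto simp: indicator_def)
    have int3: "integrable lborel (\<lambda>x. cmod (a0 x) * indicator A x - M * indicator A x)"
      using int2 fin by simp
    have nn: "0 \<le> cmod (a0 x) * indicator A x - M * indicator A x" for x
      by (auto simp: A_def indicator_def)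
    have "(LBINT x. cmod (a0 x) * indicator A x - M * indicator A x) = 0"
      using le int2 fin nn by (intro antisym integral_nonneg_AE) auto
    then have "AE x in lborel. cmod (a0 x) * indicator A x - M * indicator A x = 0"
      using integral_nonneg_eq_0_iff_AE [OF int3] nn by simp
    then show ?thesis
      by eventually_elim (auto simp: A_def indicator_def)
  qed
  then have "AE x in lborel. \<forall>n::nat. x \<in> {- real n..real n} \<longrightarrow> cmod (a0 x) \<le> M"
    by (intro AE_all_countable [THEN iffD2] allI)
  then have AE_le: "AE x in lborel. cmod (a0 x) \<le> M"
  proof eventually_elim
    case (elim x)
    obtain n :: nat where "\<bar>x\<bar> \<le> real n"
      using real_arch_simple by blast
    then show ?case using elim by (auto simp: abs_le_iff)
  qed
  have part: "(\<integral>\<^sup>+x. ennreal (cmod (a0 x) * indicator {- real n..real n} x) \<partial>lborel) \<le> ennreal (N * M)" for n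
  proof -
    define \<phi> where "\<phi> x = sgn (a0 x) * indicator {- real n..real n} x" for x
    have ind: "square_integrable (\<lambda>x. 1 * indicator {- real n..real n} x)"
      by (rule square_integrable_indicator [of _ "- real n" "real n"]) auto
    have sq: "square_integrable \<phi>"
      unfolding \<phi>_def using square_integrable_mult_bounded [OF sgn_meas sgn_le ind] by simp
    have "v \<bullet> L2_of \<phi> \<le> M * N"
    proof (rule L1_LinfD [OF v])
      have "cmod (\<phi> x) \<le> 1" for x
        by (auto simp: \<phi>_def norm_mult indicator_def norm_sgn)
      then show "dual_test N (L2_of \<phi>) N"
        using sq by (auto simp: dual_test_def)
    qed
    also have "v \<bullet> L2_of \<phi> = (LBINT x. cmod (a0 x) * indicator {- real n..real n} x)"
      unfolding a0(2) inner_L2_of [OF a0(1) sq]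
      by (rule Bochner_Integration.integral_cong [OF refl]) (auto simp: \<phi>_def indicator_def inner_sgn_complex)
    finally have le: "(LBINT x. cmod (a0 x) * indicator {- real n..real n} x) \<le> N * M"
      by (simp add: mult.commute)
    have "integrable lborel (\<lambda>x. cmod (a0 x) * indicator {- real n..real n} x)"
      using integrable_cmod_mult(1) [OF a0(1) ind]
      by (rule Bochner_Integration.integrable_cong [THEN iffD1, rotated 2]) (auto simp: indicator_def)
    then show ?thesis
      using le by (subst nn_integral_eq_integral) (auto intro: ennreal_leI)
  qed
  have "(\<integral>\<^sup>+x. ennreal (cmod (a0 x)) \<partial>lborel)
      = (\<integral>\<^sup>+x. (SUP n. ennreal (cmod (a0 x) * indicator {- real n..real n} x)) \<partial>lborel)"
  proof (rule nn_integral_cong)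
    fix x :: real
    obtain n :: nat where n: "\<bar>x\<bar> \<le> real n"
      using real_arch_simple by blast
    show "ennreal (cmod (a0 x)) = (SUP n. ennreal (cmod (a0 x) * indicator {- real n..real n} x))"
    proof (rule antisym)
      show "ennreal (cmod (a0 x)) \<le> (SUP n. ennreal (cmod (a0 x) * indicator {- real n..real n} x))"
        using n by (intro SUP_upper2 [of n]) (auto simp: indicator_def)
      show "(SUP n. ennreal (cmod (a0 x) * indicator {- real n..real n} x)) \<le> ennreal (cmod (a0 x))"
        by (intro SUP_least) (auto simp: indicator_def)
    qed
  qed
  also have "\<dots> = (SUP n. \<integral>\<^sup>+x. ennreal (cmod (a0 x) * indicator {- real n..real n} x) \<partial>lborel)"
    by (rule nn_integral_monotone_convergence_SUP)
       (auto simp: mono_def le_fun_def indicator_def intro!: ennreal_leI)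
  also have "\<dots> \<le> ennreal (N * M)"
    by (intro SUP_least part)
  finally have L1: "(\<integral>\<^sup>+x. ennreal (cmod (a0 x)) \<partial>lborel) \<le> ennreal (N * M)" .
  then have int0: "integrable lborel a0"
    by (intro integrableI_bounded) (auto simp: le_less_trans)
  have NM: "0 \<le> N * M"
  proof -
    have "dual_test N 0 N"
      unfolding dual_test_def by (intro exI [of _ "\<lambda>x. 0"]) (simp add: L2_of_0)
    then show ?thesis using L1_LinfD [OF v, of 0 N] by (simp add: mult.commute)
  qed
  have L1': "(LBINT x. cmod (a0 x)) \<le> N * M"
    using L1 int0 NM by (simp add: nn_integral_eq_integral)
  \<comment> \<open>\<open>bounded_L1\<close> asks for the bound at every point, so the
    representative is set to 0 on the null set where it fails.\<close>
  define a where "a x = (if cmod (a0 x) \<le> M then a0 x else 0)" for x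
  have [measurable]: "a \<in> borel_measurable borel"
    unfolding a_def by measurable
  have AE_eq: "AE x in lborel. a x = a0 x"
    using AE_le by eventually_elim (simp add: a_def)
  have int: "integrable lborel a"
    using int0 AE_eq by (subst integrable_cong_AE [where g = a0]) auto
  have a: "bounded_L1 M a"
    using int L1_Linf_nonneg [OF v] by (auto simp: bounded_L1_def a_def)
  have "(LBINT x. cmod (a x)) = (LBINT x. cmod (a0 x))"
    using AE_eq by (intro integral_cong_AE) (auto elim: eventually_mono)
  moreover have "v = L2_of a"
    unfolding a0(2) using AE_eq bounded_L1D(4) [OF a] a0(1) by (intro L2_of_cong_AE) (auto elim: eventually_mono)
  ultimately show ?thesis
    using that a L1' by simp
qed

lemma norm_L1_Linf:
  assumes "L1_Linf N M v"
  shows "(norm v)\<^sup>2 \<le> N * M\<^sup>2"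
proof -
  obtain a where a: "bounded_L1 M a" "(LBINT x. cmod (a x)) \<le> N * M" "v = L2_of a"
    using assms by (rule L1_LinfE)
  have "(norm v)\<^sup>2 = (LBINT x. (cmod (a x))\<^sup>2)"
    using a bounded_L1D(4) [OF a(1)] by (simp add: norm_L2_of)
  also have "\<dots> \<le> (LBINT x. M * cmod (a x))"
    using bounded_L1D [OF a(1)] by (intro integral_mono) (auto simp: square_integrable_def power2_eq_square mult_right_mono)
  also have "\<dots> = M * (LBINT x. cmod (a x))" by simp
  also have "\<dots> \<le> M * (N * M)"
    using a(2) bounded_L1D(5) [OF a(1)] by (rule mult_left_mono)
  finally show ?thesis by (simp add: power2_eq_square mult_ac)
qed

lemma L1_Linf_imult:
  assumes "L1_Linf N M v"
  shows "L1_Linf N M (imult v)"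
proof -
  obtain a where a: "bounded_L1 M a" "(LBINT x. cmod (a x)) \<le> N * M" "v = L2_of a"
    using assms by (rule L1_LinfE)
  have "bounded_L1 M (\<lambda>x. \<i> * a x)"
    using a(1) by (auto simp: bounded_L1_def norm_mult)
  then show ?thesis
    using a by (simp add: imult_L2_of bounded_L1D(4) L1_Linf_L2_of norm_mult)
qed

lemma L1_Linf_propagator:
  assumes "L1_Linf N M v"
  shows "L1_Linf N M (propagator t v)"
proof -
  obtain a where a: "bounded_L1 M a" "(LBINT x. cmod (a x)) \<le> N * M" "v = L2_of a"
    using assms by (rule L1_LinfE)
  have "bounded_L1 M (\<lambda>\<xi>. cis (- (t * \<xi>\<^sup>2)) * a \<xi>)"
    by (rule bounded_L1_cis_mult [OF a(1)]) simp
  then show ?thesis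
    using a by (simp add: propagator_L2_of bounded_L1D(4) L1_Linf_L2_of norm_mult)
qed

lemma ft_bounded_L1_diff:
  assumes a: "bounded_L1 M a" and b: "bounded_L1 M' b"
  shows "inv fourier (L2_of a - L2_of b) = L2_of (\<lambda>x. ft a (- x) - ft b (- x))"
  using inv_fourier_bounded_L1(1,2) [OF a] inv_fourier_bounded_L1(1,2) [OF b]
  by (simp add: linear_diff [OF bounded_linear.linear [OF bounded_linear_inv_fourier]] L2_of_diff)

lemma cubic_diff_bound:
  assumes "cmod (f x) \<le> B" "cmod (g x) \<le> B"
  shows "cmod (cubic f x - cubic g x) \<le> 3 * B\<^sup>2 * cmod (f x - g x)"
proof -
  have "0 \<le> B" using assms(1) norm_ge_zero order_trans by blast
  define u v d where "u = f x" and "v = g x" and "d = u - v"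
  have uv: "cmod u \<le> B" "cmod v \<le> B"
    using assms by (simp_all add: u_def v_def)
  \<comment> \<open>One factor of u * cnj u * u is exchanged at a time; the three terms are the
    origin of the constant 3.\<close>
  have "cubic f x - cubic g x = u * cnj u * d + u * v * cnj d + v * cnj v * d"
    by (simp add: cubic_def complex_norm_square algebra_simps u_def v_def d_def del: of_real_power)
  also have "cmod \<dots> \<le> cmod (u * cnj u * d) + cmod (u * v * cnj d) + cmod (v * cnj v * d)"
    using norm_triangle_ineq [of "u * cnj u * d + u * v * cnj d" "v * cnj v * d"]
      norm_triangle_ineq [of "u * cnj u * d" "u * v * cnj d"] by linarith
  also have "\<dots> = (cmod u * cmod u + cmod u * cmod v + cmod v * cmod v) * cmod d"
    by (simp add: norm_mult distrib_right)
  also have "\<dots> \<le> (B * B + B * B + B * B) * cmod d"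
    using uv \<open>0 \<le> B\<close> by (intro mult_right_mono add_mono mult_mono) auto
  also have "\<dots> = 3 * B\<^sup>2 * cmod (f x - g x)"
    by (simp add: power2_eq_square d_def u_def v_def)
  finally show ?thesis .
qed

text \<open>By Plancherel's identity the estimate can be made in physical space, where the L^1 bound
  N * M becomes a supremum bound and \<open>cubic_diff_bound\<close> applies pointwise. The constant
  is crude and serves existence and continuity; the sizes of solutions are controlled by finer
  bounds.\<close>

lemma cubic_hat_lipschitz:
  assumes v: "L1_Linf N M v" and w: "L1_Linf N M w"
  shows "norm (cubic_hat v - cubic_hat w) \<le> 3 * (N * M)\<^sup>2 * norm (v - w)"
proof -
  obtain a where a: "bounded_L1 M a" "(LBINT x. cmod (a x)) \<le> N * M" "v = L2_of a"
    using v by (rule L1_LinfE)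
  obtain b where b: "bounded_L1 M b" "(LBINT x. cmod (b x)) \<le> N * M" "w = L2_of b"
    using w by (rule L1_LinfE)
  let ?f = "\<lambda>x. ft a (- x)" and ?g = "\<lambda>x. ft b (- x)"
  have le: "cmod (?f x) \<le> N * M" "cmod (?g x) \<le> N * M" for x
    using order_trans [OF inv_fourier_bounded_L1(3) [OF a(1)] a(2)] order_trans [OF inv_fourier_bounded_L1(3) [OF b(1)] b(2)]
    by auto
  note sq = cubic_hat_bounded_L1(3) [OF a(1)] cubic_hat_bounded_L1(3) [OF b(1)]
  have sq2: "square_integrable (\<lambda>x. ?f x - ?g x)"
    by (intro square_integrable_diff inv_fourier_bounded_L1(2) [OF a(1)] inv_fourier_bounded_L1(2) [OF b(1)])
  have "norm (cubic_hat v - cubic_hat w) = norm (L2_of (cubic ?f) - L2_of (cubic ?g))"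
    unfolding a(3) b(3) cubic_hat_bounded_L1(1) [OF a(1)] cubic_hat_bounded_L1(1) [OF b(1)]
    by (simp flip: linear_diff [OF bounded_linear.linear [OF bounded_linear_fourier]])
  also have "\<dots> = sqrt (LBINT x. (cmod (cubic ?f x - cubic ?g x))\<^sup>2)"
    using sq by (simp add: norm_L2_of square_integrable_diff flip: L2_of_diff)
  also have "\<dots> \<le> sqrt (LBINT x. (3 * (N * M)\<^sup>2)\<^sup>2 * (cmod (?f x - ?g x))\<^sup>2)"
  proof (intro real_sqrt_le_mono integral_mono)
    show "integrable lborel (\<lambda>x. (cmod (cubic ?f x - cubic ?g x))\<^sup>2)"
      using square_integrable_diff [OF sq] by (simp add: square_integrable_def)
    show "integrable lborel (\<lambda>x. (3 * (N * M)\<^sup>2)\<^sup>2 * (cmod (?f x - ?g x))\<^sup>2)"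
      using sq2 by (simp add: square_integrable_def)
    show "(cmod (cubic ?f x - cubic ?g x))\<^sup>2 \<le> (3 * (N * M)\<^sup>2)\<^sup>2 * (cmod (?f x - ?g x))\<^sup>2" for x
      unfolding power_mult_distrib [symmetric]
      by (intro power_mono cubic_diff_bound [where f = ?f and g = ?g] le) simp
  qed
  also have "\<dots> = 3 * (N * M)\<^sup>2 * norm (L2_of (\<lambda>x. ?f x - ?g x))"
    unfolding norm_L2_of [OF sq2] integral_mult_right_zero real_sqrt_mult real_sqrt_abs
    by (simp add: abs_mult)
  also have "norm (L2_of (\<lambda>x. ?f x - ?g x)) = norm (v - w)"
    unfolding ft_bounded_L1_diff [OF a(1) b(1), symmetric] a(3) b(3) by simp
  finally show ?thesis .
qed

section \<open>The averaged nonlinearity\<close>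

lemma cubic_hat_0 [simp]: "cubic_hat 0 = 0"
proof -
  have "bounded_L1 0 (\<lambda>x. 0)" by (simp add: bounded_L1_def)
  then have "cubic_hat (L2_of (\<lambda>x. 0)) = L2_of (trilinear (\<lambda>p q. 1) (\<lambda>x. 0) (\<lambda>x. 0) (\<lambda>x. 0))"
    by (rule cubic_hat_L2_of)
  then show ?thesis by (simp add: L2_of_0 trilinear_def [abs_def])
qed

lemma propagator_diff: "propagator t u - propagator t v = propagator t (u - v)"
  by (simp add: linear_diff [OF bounded_linear.linear [OF bounded_linear_propagator]])

lemma dressed_cubic_lipschitz:
  assumes "L1_Linf N M v" "L1_Linf N M w"
  shows "norm (dressed_cubic \<eta> v - dressed_cubic \<eta> w) \<le> 3 * (N * M)\<^sup>2 * norm (v - w)"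
  using cubic_hat_lipschitz [OF L1_Linf_propagator L1_Linf_propagator, OF assms, of \<eta> \<eta>]
  by (simp add: dressed_cubic_def propagator_diff)

lemma L1_Linf_0: "0 \<le> M \<Longrightarrow> 0 \<le> N \<Longrightarrow> L1_Linf N M 0"
  by (simp add: L1_Linf_def dual_test_nonneg)

lemma norm_dressed_cubic:
  assumes "L1_Linf N M v" "0 \<le> N"
  shows "norm (dressed_cubic \<eta> v) \<le> 3 * (N * M)\<^sup>2 * norm v"
proof -
  have "dressed_cubic \<eta> 0 = 0"
    by (simp add: dressed_cubic_def linear_0 [OF bounded_linear.linear [OF bounded_linear_propagator]])
  then show ?thesis
    using dressed_cubic_lipschitz [OF assms(1) L1_Linf_0 [OF L1_Linf_nonneg [OF assms(1)] assms(2)], of \<eta>] by simp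
qed

lemma dressed_cubic_tendsto:
  assumes \<eta>: "\<eta> \<longlonglongrightarrow> \<eta>'" and v: "v \<longlonglongrightarrow> w" and L1_Linf: "\<And>n. L1_Linf N M (v n)"
  shows "(\<lambda>n. dressed_cubic (\<eta> n) (v n)) \<longlonglongrightarrow> dressed_cubic \<eta>' w"
  unfolding dressed_cubic_def
proof (rule propagator_tendsto)
  let ?p = "\<lambda>n. propagator (\<eta> n) (v n)" and ?q = "propagator \<eta>' w"
  have pq: "?p \<longlonglongrightarrow> ?q"
    by (intro propagator_tendsto assms)
  have w: "L1_Linf N M w"
    by (rule L1_Linf_lim [OF L1_Linf v])
  show "(\<lambda>n. cubic_hat (?p n)) \<longlonglongrightarrow> cubic_hat ?q"
  proof (rule LIM_zero_cancel, rule tendsto_norm_zero_cancel, rule tendsto_sandwich [OF _ _ tendsto_const])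
    show "\<forall>\<^sub>F n in sequentially. norm (cubic_hat (?p n) - cubic_hat ?q) \<le> 3 * (N * M)\<^sup>2 * norm (?p n - ?q)"
      by (intro always_eventually allI cubic_hat_lipschitz L1_Linf_propagator L1_Linf w)
    have "(\<lambda>n. 3 * (N * M)\<^sup>2 * norm (?p n - ?q)) \<longlonglongrightarrow> 3 * (N * M)\<^sup>2 * norm (?q - ?q)"
      by (intro tendsto_intros pq)
    then show "(\<lambda>n. 3 * (N * M)\<^sup>2 * norm (?p n - ?q)) \<longlonglongrightarrow> 0" by simp
  qed simp
  show "(\<lambda>n. - \<eta> n) \<longlonglongrightarrow> - \<eta>'"
    by (intro tendsto_intros \<eta>)
qed

text \<open>With \<open>\<theta> = \<gamma> * \<tau>\<close> this is the full nonlinearity of the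
  interaction picture at time \<tau>.\<close>

definition mean_cubic :: "real \<Rightarrow> L2 \<Rightarrow> L2" where
  "mean_cubic \<theta> v = (LBINT \<sigma>=0..1. dressed_cubic (\<sigma> + \<theta>) v)"

lemma interval_integrable_continuous:
  fixes f :: "real \<Rightarrow> 'a::{banach,second_countable_topology}"
  assumes "continuous_on UNIV f"
  shows "interval_lebesgue_integrable lborel (ereal a) (ereal b) f"
  using assms by (intro interval_integrable_isCont) (auto simp: continuous_on_eq_continuous_at)

lemma continuous_dressed_cubic:
  assumes "L1_Linf N M v"
  shows "continuous_on UNIV (\<lambda>\<sigma>. dressed_cubic (\<sigma> + \<theta>) v)"
  unfolding continuous_on_sequentially comp_def
  using dressed_cubic_tendsto [OF tendsto_add [OF _ tendsto_const] tendsto_const assms] by blast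

lemma dressed_cubic_integrable:
  assumes "L1_Linf N M v"
  shows "interval_lebesgue_integrable lborel 0 1 (\<lambda>\<sigma>. dressed_cubic (\<sigma> + \<theta>) v)"
  using interval_integrable_continuous [OF continuous_dressed_cubic [OF assms], of 0 1] by (simp add: zero_ereal_def one_ereal_def)

lemma set_integrable_01:
  "interval_lebesgue_integrable lborel 0 1 f \<longleftrightarrow> set_integrable lborel {0<..<1::real} f"
  by (simp add: interval_lebesgue_integrable_def zero_ereal_def one_ereal_def)

lemma interval_integral_01: "(LBINT x=0..1. f x) = (LBINT x:{0<..<1::real}. f x)"
  by (simp add: interval_lebesgue_integral_def zero_ereal_def one_ereal_def)

lemma norm_interval_integral_01:
  fixes f :: "real \<Rightarrow> 'a::{banach,second_countable_topology}"
  assumes "interval_lebesgue_integrable lborel 0 1 f" "\<And>x. norm (f x) \<le> B"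
  shows "norm (LBINT x=0..1. f x) \<le> B"
proof -
  have "0 \<le> B" using assms(2) [of 0] norm_ge_zero order_trans by blast
  have "norm (LBINT x=0..1. f x) \<le> (LBINT x. norm (indicator {0<..<1::real} x *\<^sub>R f x))"
    unfolding interval_integral_01 set_lebesgue_integral_def by (rule integral_norm_bound)
  also have "\<dots> \<le> (LBINT x. B * indicator {0<..<1::real} x)"
  proof (rule integral_mono)
    show "integrable lborel (\<lambda>x. norm (indicator {0<..<1::real} x *\<^sub>R f x))"
      using assms(1) by (simp only: set_integrable_01 set_integrable_def integrable_norm)
    show "integrable lborel (\<lambda>x. B * indicator {0<..<1::real} x)"
      by (intro integrable_mult_right integrable_indicator_bounded [of _ 0 1]) auto
  qed (use assms(2) \<open>0 \<le> B\<close> in \<open>auto simp: indicator_def\<close>)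
  finally show ?thesis by simp
qed

lemma mean_cubic_lipschitz:
  assumes "L1_Linf N M v" "L1_Linf N M w"
  shows "norm (mean_cubic \<theta> v - mean_cubic \<theta> w) \<le> 3 * (N * M)\<^sup>2 * norm (v - w)"
proof -
  have "mean_cubic \<theta> v - mean_cubic \<theta> w = (LBINT \<sigma>=0..1. dressed_cubic (\<sigma> + \<theta>) v - dressed_cubic (\<sigma> + \<theta>) w)"
    unfolding mean_cubic_def by (intro interval_lebesgue_integral_diff(2) [symmetric] dressed_cubic_integrable [OF assms(1)] dressed_cubic_integrable [OF assms(2)])
  also have "norm \<dots> \<le> 3 * (N * M)\<^sup>2 * norm (v - w)"
    by (intro norm_interval_integral_01 interval_lebesgue_integral_diff(1) dressed_cubic_integrable [OF assms(1)]
        dressed_cubic_integrable [OF assms(2)] dressed_cubic_lipschitz assms)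
  finally show ?thesis .
qed

lemma mean_cubic_tendsto:
  assumes \<theta>: "\<theta> \<longlonglongrightarrow> \<theta>'" and v: "v \<longlonglongrightarrow> w" and L1_Linf: "\<And>n. L1_Linf N M (v n)" and "0 \<le> N"
  shows "(\<lambda>n. mean_cubic (\<theta> n) (v n)) \<longlonglongrightarrow> mean_cubic \<theta>' w"
proof -
  have w: "L1_Linf N M w"
    by (rule L1_Linf_lim [OF L1_Linf v])
  obtain B where B: "\<And>n. norm (v n) \<le> B"
    using convergent_imp_Bseq [OF convergentI [OF v]] by (auto simp: Bseq_def)
  let ?B = "3 * (N * M)\<^sup>2 * B"
  have le: "norm (dressed_cubic \<eta> (v n)) \<le> ?B" for \<eta> n
    using norm_dressed_cubic [OF L1_Linf \<open>0 \<le> N\<close>, of \<eta> n] mult_left_mono [OF B, of "3 * (N * M)\<^sup>2" n] by simp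
  have "0 \<le> ?B" using le [of 0 0] norm_ge_zero order_trans by blast
  have "(\<lambda>n. LBINT x. indicator {0<..<1::real} x *\<^sub>R dressed_cubic (x + \<theta> n) (v n))
      \<longlonglongrightarrow> (LBINT x. indicator {0<..<1::real} x *\<^sub>R dressed_cubic (x + \<theta>') w)"
  proof (rule integral_dominated_convergence)
    show "integrable lborel (\<lambda>x. ?B * indicator {0<..<1::real} x)"
      by (intro integrable_mult_right integrable_indicator_bounded [of _ 0 1]) auto
    show "AE x in lborel. (\<lambda>n. indicator {0<..<1::real} x *\<^sub>R dressed_cubic (x + \<theta> n) (v n))
        \<longlonglongrightarrow> indicator {0<..<1} x *\<^sub>R dressed_cubic (x + \<theta>') w"
      by (intro AE_I2 tendsto_scaleR tendsto_const dressed_cubic_tendsto [OF _ v L1_Linf] tendsto_add \<theta>)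
    show "AE x in lborel. norm (indicator {0<..<1::real} x *\<^sub>R dressed_cubic (x + \<theta> n) (v n)) \<le> ?B * indicator {0<..<1} x" for n
      using le \<open>0 \<le> ?B\<close> by (intro AE_I2) (auto simp: indicator_def)
    show "(\<lambda>x. indicator {0<..<1::real} x *\<^sub>R dressed_cubic (x + \<theta>') w) \<in> borel_measurable lborel"
      using dressed_cubic_integrable [OF w, of \<theta>'] unfolding set_integrable_01 set_integrable_def by (rule borel_measurable_integrable)
    show "(\<lambda>x. indicator {0<..<1::real} x *\<^sub>R dressed_cubic (x + \<theta> n) (v n)) \<in> borel_measurable lborel" for n
      using dressed_cubic_integrable [OF L1_Linf, of "\<theta> n"] unfolding set_integrable_01 set_integrable_def by (rule borel_measurable_integrable)
  qed
  then show ?thesis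
    by (simp add: mean_cubic_def interval_integral_01 set_lebesgue_integral_def)
qed

lemma interval_integral_bounded_linear:
  fixes T :: "'a::{banach,second_countable_topology} \<Rightarrow> 'b::{banach,second_countable_topology}"
  assumes "bounded_linear T" "interval_lebesgue_integrable lborel a b f"
  shows "(LBINT x=a..b. T (f x)) = T (LBINT x=a..b. f x)"
    and "interval_lebesgue_integrable lborel a b (\<lambda>x. T (f x))"
proof -
  interpret bounded_linear T by fact
  have *: "indicator A x *\<^sub>R T (f x) = T (indicator A x *\<^sub>R f x)" for A :: "real set" and x
    by (simp add: scaleR)
  show "(LBINT x=a..b. T (f x)) = T (LBINT x=a..b. f x)"
    using assms(2) unfolding interval_lebesgue_integral_def interval_lebesgue_integrable_def
      set_lebesgue_integral_def set_integrable_def *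
    by (auto simp: integral_bounded_linear [OF assms(1)] linear_neg [OF linear])
  show "interval_lebesgue_integrable lborel a b (\<lambda>x. T (f x))"
    using assms(2) unfolding interval_lebesgue_integrable_def set_integrable_def *
    by (auto intro: integrable_bounded_linear [OF assms(1)])
qed

text \<open>A Bochner integral of equivalence classes is not pointwise by definition. Both sides
  have the same inner product with every w by Fubini's theorem, whose hypothesis comes from the
  majorant h, uniform in \<sigma>.\<close>

lemma L2_of_interval_integral:
  assumes [measurable]: "(\<lambda>(\<sigma>, \<xi>). g \<sigma> \<xi>) \<in> borel_measurable (borel \<Otimes>\<^sub>M borel)"
    and h: "square_integrable h" and gh: "\<And>\<sigma> \<xi>. cmod (g \<sigma> \<xi>) \<le> cmod (h \<xi>)"
    and int: "interval_lebesgue_integrable lborel 0 1 (\<lambda>\<sigma>. L2_of (g \<sigma>))"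
  shows "(LBINT \<sigma>=0..1. L2_of (g \<sigma>)) = L2_of (\<lambda>\<xi>. LBINT \<sigma>=0..1. g \<sigma> \<xi>)"
proof -
  let ?I = "{0<..<1::real}"
  have sq: "square_integrable (g \<sigma>)" for \<sigma>
    by (rule square_integrable_dominated [OF _ h]) (auto simp: gh)
  have int_g: "interval_lebesgue_integrable lborel 0 1 (\<lambda>\<sigma>. g \<sigma> \<xi>)" for \<xi>
    unfolding set_integrable_01 set_integrable_def
  proof (rule Bochner_Integration.integrable_bound)
    show "integrable lborel (\<lambda>\<sigma>. cmod (h \<xi>) * indicator ?I \<sigma>)"
      by (intro integrable_mult_right integrable_indicator_bounded [of _ 0 1]) auto
  qed (auto simp: indicator_def gh)
  have "cmod (LBINT \<sigma>=0..1. g \<sigma> \<xi>) \<le> cmod (h \<xi>)" for \<xi>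
    by (rule norm_interval_integral_01 [OF int_g gh])
  moreover have meas: "(\<lambda>\<xi>. LBINT \<sigma>=0..1. g \<sigma> \<xi>) \<in> borel_measurable lborel"
    unfolding interval_integral_01 set_lebesgue_integral_def by measurable
  ultimately have sqI: "square_integrable (\<lambda>\<xi>. LBINT \<sigma>=0..1. g \<sigma> \<xi>)"
    by (intro square_integrable_dominated [OF _ h]) auto
  have "(LBINT \<sigma>=0..1. L2_of (g \<sigma>)) \<bullet> w = L2_of (\<lambda>\<xi>. LBINT \<sigma>=0..1. g \<sigma> \<xi>) \<bullet> w" for w
  proof (cases w rule: L2_of_exhaust)
    case (1 f)
    note [measurable] = square_integrable_measurable [OF 1(1)]
    have intF: "integrable (lborel \<Otimes>\<^sub>M lborel) (\<lambda>(\<sigma>, \<xi>). indicator ?I \<sigma> *\<^sub>R (g \<sigma> \<xi> \<bullet> f \<xi>))"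
    proof (rule Bochner_Integration.integrable_bound)
      have "integrable lborel (indicat_real ?I)"
        by (rule integrable_indicator_bounded [of _ 0 1]) auto
      then show "integrable (lborel \<Otimes>\<^sub>M lborel) (\<lambda>(\<sigma>, \<xi>). indicator ?I \<sigma> * (cmod (h \<xi>) * cmod (f \<xi>)))"
        by (intro integrable_mult_pair integrable_cmod_mult(1) h 1) (auto intro: lborel.sigma_finite_measure_axioms)
      have "\<bar>g \<sigma> \<xi> \<bullet> f \<xi>\<bar> \<le> cmod (h \<xi>) * cmod (f \<xi>)" for \<sigma> \<xi>
        by (rule order_trans [OF Cauchy_Schwarz_ineq2]) (intro mult_right_mono gh norm_ge_zero)
      then show "AE x in lborel \<Otimes>\<^sub>M lborel. norm (case x of (\<sigma>, \<xi>) \<Rightarrow> indicator ?I \<sigma> *\<^sub>R (g \<sigma> \<xi> \<bullet> f \<xi>))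
          \<le> norm (case x of (\<sigma>, \<xi>) \<Rightarrow> indicator ?I \<sigma> * (cmod (h \<xi>) * cmod (f \<xi>)))"
        by (intro AE_I2) (auto simp: indicator_def abs_mult)
    qed measurable
    have "(LBINT \<sigma>=0..1. L2_of (g \<sigma>)) \<bullet> w = (LBINT \<sigma>=0..1. L2_of (g \<sigma>) \<bullet> w)"
      by (rule interval_integral_bounded_linear(1) [OF bounded_linear_inner_left int, symmetric])
    also have "\<dots> = (LBINT \<sigma>. LBINT \<xi>. indicator ?I \<sigma> *\<^sub>R (g \<sigma> \<xi> \<bullet> f \<xi>))"
      using 1 sq by (simp add: interval_integral_01 set_lebesgue_integral_def inner_L2_of)
    also have "\<dots> = (LBINT \<xi>. LBINT \<sigma>. indicator ?I \<sigma> *\<^sub>R (g \<sigma> \<xi> \<bullet> f \<xi>))"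
      by (rule lborel_pair.Fubini_integral [OF intF, symmetric])
    also have "\<dots> = (LBINT \<xi>. (LBINT \<sigma>=0..1. g \<sigma> \<xi>) \<bullet> f \<xi>)"
      unfolding interval_integral_bounded_linear(1) [OF bounded_linear_inner_left int_g, symmetric]
      by (simp add: interval_integral_01 set_lebesgue_integral_def)
    also have "\<dots> = L2_of (\<lambda>\<xi>. LBINT \<sigma>=0..1. g \<sigma> \<xi>) \<bullet> w"
      using 1 sqI by (simp add: inner_L2_of)
    finally show ?thesis .
  qed
  then show ?thesis
    by (metis inner_diff_left inner_eq_zero_iff right_minus_eq)
qed

section \<open>The averaged phase as a kernel\<close>

definition mean_phase :: "real \<Rightarrow> real \<Rightarrow> real \<Rightarrow> complex" where
  "mean_phase \<theta> p q = (LBINT \<sigma>=0..1. cis (2 * (\<sigma> + \<theta>) * p * q))"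

text \<open>This is min (1, 1/|p q|). The case distinction matters for p q = 0, where 1/0 = 0 would
  make the minimum vanish.\<close>

definition phase_bound :: "real \<Rightarrow> real \<Rightarrow> real" where
  "phase_bound p q = (if \<bar>p * q\<bar> \<le> 1 then 1 else 1 / \<bar>p * q\<bar>)"

lemma measurable_mean_phase [measurable]: "case_prod (mean_phase \<theta>) \<in> borel_measurable (borel \<Otimes>\<^sub>M borel)"
  unfolding mean_phase_def interval_integral_01 set_lebesgue_integral_def split_beta' by measurable

lemma measurable_phase_bound [measurable]: "case_prod phase_bound \<in> borel_measurable (borel \<Otimes>\<^sub>M borel)"
  unfolding phase_bound_def split_beta' by measurable

lemma phase_bound_nonneg: "0 \<le> phase_bound p q"
  by (simp add: phase_bound_def)

lemma phase_bound_even: "phase_bound (- q) (- p) = phase_bound p q"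
  by (simp add: phase_bound_def mult.commute)

lemma mean_phase_eq:
  assumes "p * q \<noteq> 0"
  shows "mean_phase \<theta> p q = (cis (2 * (1 + \<theta>) * p * q) - cis (2 * \<theta> * p * q)) / (2 * \<i> * of_real (p * q))"
proof -
  let ?F = "\<lambda>\<sigma>. cis (2 * (\<sigma> + \<theta>) * p * q) / (2 * \<i> * of_real (p * q))"
  have "(LBINT \<sigma>=ereal 0..ereal 1. cis (2 * (\<sigma> + \<theta>) * p * q)) = ?F 1 - ?F 0"
  proof (rule interval_integral_FTC_finite)
    show "continuous_on {min 0 1..max 0 1} (\<lambda>\<sigma>. cis (2 * (\<sigma> + \<theta>) * p * q))"
      by (intro continuous_intros)
    show "(?F has_vector_derivative cis (2 * (x + \<theta>) * p * q)) (at x within {min 0 1..max 0 1})" for x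
    proof -
      let ?f = "\<lambda>z. exp (\<i> * (2 * (z + of_real \<theta>) * of_real p * of_real q)) / (2 * \<i> * of_real (p * q))"
      have "(?f has_field_derivative exp (\<i> * (2 * (of_real x + of_real \<theta>) * of_real p * of_real q))) (at (of_real x))"
        using assms by (auto intro!: derivative_eq_intros)
      then have "((\<lambda>\<sigma>. ?f (of_real \<sigma>)) has_vector_derivative exp (\<i> * (2 * (of_real x + of_real \<theta>) * of_real p * of_real q)))
          (at x within {min 0 1..max 0 1})"
        by (rule has_vector_derivative_real_field)
      then show ?thesis
        by (simp add: cis_conv_exp)
    qed
  qed
  then show ?thesis
    by (simp add: mean_phase_def zero_ereal_def one_ereal_def diff_divide_distrib)
qed

lemma continuous_cis_mean_phase: "interval_lebesgue_integrable lborel 0 1 (\<lambda>\<sigma>. cis (2 * (\<sigma> + \<theta>) * p * q))"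
  using interval_integrable_continuous [of "\<lambda>\<sigma>. cis (2 * (\<sigma> + \<theta>) * p * q)" 0 1]
  by (simp add: zero_ereal_def one_ereal_def continuous_intros)

lemma mean_phase_le: "cmod (mean_phase \<theta> p q) \<le> phase_bound p q"
proof (cases "\<bar>p * q\<bar> \<le> 1")
  case True
  have "cmod (mean_phase \<theta> p q) \<le> 1"
    unfolding mean_phase_def by (rule norm_interval_integral_01 [OF continuous_cis_mean_phase]) simp
  with True show ?thesis by (simp add: phase_bound_def)
next
  case False
  then have nz: "p * q \<noteq> 0" by auto
  have "cmod (mean_phase \<theta> p q) \<le> (1 + 1) / (2 * \<bar>p * q\<bar>)"
    unfolding mean_phase_eq [OF nz] norm_divide
    by (intro frac_le order_trans [OF norm_triangle_ineq4]) (use nz in \<open>auto simp: norm_mult abs_mult\<close>)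
  with False show ?thesis by (simp add: phase_bound_def)
qed

lemma integrable_trilinear:
  assumes a: "bounded_L1 M a"
  shows "integrable lborel2 (\<lambda>z. a (fst z) * a (snd z) * cnj (a (fst z + snd z - \<xi>)))"
proof (rule Bochner_Integration.integrable_bound)
  note [measurable] = bounded_L1D(3) [OF a]
  show "integrable lborel2 (\<lambda>z. of_real M * (a (fst z) * a (snd z)))"
    by (intro integrable_mult_right integrable_pair_mult(1) bounded_L1D(1) [OF a])
  show "AE z in lborel2. cmod (a (fst z) * a (snd z) * cnj (a (fst z + snd z - \<xi>))) \<le> cmod (of_real M * (a (fst z) * a (snd z)))"
  proof (intro AE_I2)
    fix z
    have "cmod (a (fst z)) * cmod (a (snd z)) * cmod (a (fst z + snd z - \<xi>)) \<le> cmod (a (fst z)) * cmod (a (snd z)) * M"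
      using bounded_L1D(2) [OF a] by (intro mult_left_mono) auto
    then show "cmod (a (fst z) * a (snd z) * cnj (a (fst z + snd z - \<xi>))) \<le> cmod (of_real M * (a (fst z) * a (snd z)))"
      using bounded_L1D(5) [OF a] by (simp add: norm_mult mult.commute)
  qed
qed (use bounded_L1D(3) [OF a] in measurable)

lemma integral_trilinear_mean_phase:
  assumes a: "bounded_L1 M a"
  shows "(LBINT \<sigma>=0..1. trilinear (\<lambda>p q. cis (2 * (\<sigma> + \<theta>) * p * q)) a a a \<xi>) = trilinear (mean_phase \<theta>) a a a \<xi>"
proof -
  note [measurable] = bounded_L1D(3) [OF a]
  let ?I = "{0<..<1::real}"
  interpret P: pair_sigma_finite "lborel :: real measure" lborel2
    by (intro pair_sigma_finite.intro sigma_finite_lborel2 lborel.sigma_finite_measure_axioms)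
  define A where "A z = a (fst z) * a (snd z) * cnj (a (fst z + snd z - \<xi>))" for z
  have [measurable]: "A \<in> borel_measurable lborel2"
    unfolding A_def by measurable
  define c where "c \<sigma> z = cis (2 * (\<sigma> + \<theta>) * (fst z - \<xi>) * (snd z - \<xi>))" for \<sigma> and z :: "real \<times> real"
  have intF: "integrable (lborel \<Otimes>\<^sub>M lborel2) (\<lambda>(\<sigma>, z). indicator ?I \<sigma> *\<^sub>R (c \<sigma> z * A z))"
  proof (rule Bochner_Integration.integrable_bound)
    show "integrable (lborel \<Otimes>\<^sub>M lborel2) (\<lambda>(\<sigma>, z). (1 * indicator ?I \<sigma> :: complex) * A z)"
      unfolding A_def
      by (intro integrable_mult_pair integrable_trilinear [OF a] integrable_indicator_bounded [of _ 0 1] sigma_finite_lborel2)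
         (auto intro: lborel.sigma_finite_measure_axioms)
    show "(\<lambda>(\<sigma>, z). indicator ?I \<sigma> *\<^sub>R (c \<sigma> z * A z)) \<in> borel_measurable (lborel \<Otimes>\<^sub>M lborel2)"
      unfolding c_def by measurable
  qed (auto simp: indicator_def norm_mult c_def)
  have trilinear_eq: "trilinear k a a a \<xi> = (LINT z|lborel2. k (fst z - \<xi>) (snd z - \<xi>) * A z) / of_real (2 * pi)" for k
    by (simp add: trilinear_def A_def mult.assoc)
  have "(LBINT \<sigma>=0..1. trilinear (\<lambda>p q. cis (2 * (\<sigma> + \<theta>) * p * q)) a a a \<xi>)
      = (LBINT \<sigma>. (LINT z|lborel2. indicator ?I \<sigma> *\<^sub>R (c \<sigma> z * A z))) / of_real (2 * pi)"
    unfolding trilinear_eq interval_integral_01 set_lebesgue_integral_def c_def by (simp add: scaleR_conv_of_real)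
  also have "(LBINT \<sigma>. (LINT z|lborel2. indicator ?I \<sigma> *\<^sub>R (c \<sigma> z * A z)))
      = (LINT z|lborel2. (LBINT \<sigma>. indicator ?I \<sigma> *\<^sub>R (c \<sigma> z * A z)))"
    by (rule P.Fubini_integral [OF intF, symmetric])
  also have "\<dots> = (LINT z|lborel2. mean_phase \<theta> (fst z - \<xi>) (snd z - \<xi>) * A z)"
    unfolding mean_phase_def interval_integral_01 set_lebesgue_integral_def c_def by (simp add: scaleR_conv_of_real flip: mult.assoc)
  finally show ?thesis
    by (simp add: trilinear_eq)
qed

lemma mean_cubic_L2_of:
  assumes a: "bounded_L1 M a"
  shows "mean_cubic \<theta> (L2_of a) = L2_of (trilinear (mean_phase \<theta>) a a a)"
proof -
  note [measurable] = bounded_L1D(3) [OF a]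
  \<comment> \<open>The least N admissible in \<open>L1_Linf\<close>; for M = 0 the quotient is 0,
    which is right because a then vanishes.\<close>
  define N where "N = (LBINT x. cmod (a x)) / M"
  \<comment> \<open>The trilinear form of the moduli dominates the integrand for all \<sigma> at
    once.\<close>
  define c where "c x = complex_of_real (cmod (a x))" for x
  have c: "bounded_L1 M c"
    using a by (auto simp: bounded_L1_def c_def [abs_def])
  have h: "square_integrable (trilinear (\<lambda>p q. 1) c c c)"
    by (rule bounded_L1D(4) [OF trilinear_1_bounded_L1 [OF c]])
  have L1_Linf: "L1_Linf N M (L2_of a)"
  proof (rule L1_Linf_L2_of [OF a])
    show "(LBINT x. cmod (a x)) \<le> N * M"
    proof (cases "M = 0")
      case True
      then have "a x = 0" for x using bounded_L1D(2) [OF a, of x] by simp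
      then show ?thesis by (simp add: True)
    qed (simp add: N_def)
  qed
  have "mean_cubic \<theta> (L2_of a) = (LBINT \<sigma>=0..1. L2_of (trilinear (\<lambda>p q. cis (2 * (\<sigma> + \<theta>) * p * q)) a a a))"
    by (simp add: mean_cubic_def dressed_cubic_L2_of [OF a])
  also have "\<dots> = L2_of (\<lambda>\<xi>. LBINT \<sigma>=0..1. trilinear (\<lambda>p q. cis (2 * (\<sigma> + \<theta>) * p * q)) a a a \<xi>)"
  proof (rule L2_of_interval_integral [OF _ h])
    show "(\<lambda>(\<sigma>, \<xi>). trilinear (\<lambda>p q. cis (2 * (\<sigma> + \<theta>) * p * q)) a a a \<xi>) \<in> borel_measurable (borel \<Otimes>\<^sub>M borel)"
      unfolding trilinear_def split_beta' by measurable
    show "interval_lebesgue_integrable lborel 0 1 (\<lambda>\<sigma>. L2_of (trilinear (\<lambda>p q. cis (2 * (\<sigma> + \<theta>) * p * q)) a a a))"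
      using dressed_cubic_integrable [OF L1_Linf, of \<theta>] by (simp add: dressed_cubic_L2_of [OF a])
    fix \<sigma> \<xi>
    have "cmod (LINT z|lborel2. cis (2 * (\<sigma> + \<theta>) * (fst z - \<xi>) * (snd z - \<xi>)) * a (fst z) * a (snd z) * cnj (a (fst z + snd z - \<xi>)))
        \<le> (LINT z|lborel2. cmod (cis (2 * (\<sigma> + \<theta>) * (fst z - \<xi>) * (snd z - \<xi>)) * a (fst z) * a (snd z) * cnj (a (fst z + snd z - \<xi>))))"
      by (rule integral_norm_bound)
    also have "\<dots> = cmod (LINT z|lborel2. of_real (cmod (a (fst z)) * cmod (a (snd z)) * cmod (a (fst z + snd z - \<xi>))))"
      by (simp add: norm_mult integral_nonneg_AE del: of_real_mult)
    finally show "cmod (trilinear (\<lambda>p q. cis (2 * (\<sigma> + \<theta>) * p * q)) a a a \<xi>) \<le> cmod (trilinear (\<lambda>p q. 1) c c c \<xi>)"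
      unfolding trilinear_def norm_divide by (intro divide_right_mono) (simp_all add: c_def)
  qed
  finally show ?thesis
    by (simp only: integral_trilinear_mean_phase [OF a])
qed

section \<open>Estimates of the trilinear form\<close>

lemma nn_integral_abs_le:
  fixes f :: "real \<Rightarrow> ennreal"
  assumes [measurable]: "f \<in> borel_measurable borel"
  shows "(\<integral>\<^sup>+x. f \<bar>x\<bar> \<partial>lborel) \<le> 2 * (\<integral>\<^sup>+x. f x * indicator {0..} x \<partial>lborel)"
proof -
  have "(\<integral>\<^sup>+x. f \<bar>x\<bar> \<partial>lborel) \<le> (\<integral>\<^sup>+x. f x * indicator {0..} x + f (- x) * indicator {0..} (- x) \<partial>lborel)"
    by (intro nn_integral_mono) (auto simp: indicator_def abs_if)
  also have "\<dots> = (\<integral>\<^sup>+x. f x * indicator {0..} x \<partial>lborel) + (\<integral>\<^sup>+x. f (- x) * indicator {0..} (- x) \<partial>lborel)"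
    by (rule nn_integral_add) measurable
  also have "(\<integral>\<^sup>+x. f (- x) * indicator {0..} (- x) \<partial>lborel) = (\<integral>\<^sup>+x. f x * indicator {0..} x \<partial>lborel)"
    using nn_integral_real_affine [of "\<lambda>x. f x * indicator {0..} x" "-1" 0] by simp
  finally show ?thesis
    by (simp add: mult_2)
qed

lemma nn_integral_powr_from_0:
  assumes "e > -1" "b \<ge> 0"
  shows "(\<integral>\<^sup>+x. ennreal (x powr e) * indicator {0..b} x \<partial>lborel) = ennreal (b powr (e + 1) / (e + 1))"
  by (rule nn_integral_has_integral_lebesgue' [OF _ has_integral_powr_from_0 [OF assms]]) simp

lemma nn_integral_powr_to_inf:
  assumes "e < -1" "b > 0"
  shows "(\<integral>\<^sup>+x. ennreal (x powr e) * indicator {b..} x \<partial>lborel) = ennreal (- (b powr (e + 1)) / (e + 1))"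
  by (rule nn_integral_has_integral_lebesgue' [OF _ has_integral_powr_to_inf [OF assms]]) simp

text \<open>The Schur test for the kernel \<open>min 1 (1 / \<bar>p * q\<bar>)\<close>, with weight \<open>\<bar>q\<bar> powr (- 1/2)\<close>.\<close>

lemma phase_bound_schur:
  assumes "p \<noteq> 0"
  shows "(\<integral>\<^sup>+q. ennreal (phase_bound p q * \<bar>q\<bar> powr (- 1/2)) \<partial>lborel) \<le> ennreal (8 * \<bar>p\<bar> powr (- 1/2))"
proof -
  define c where "c = \<bar>p\<bar>"
  have c: "c > 0" using assms by (simp add: c_def)
  let ?f = "\<lambda>q. ennreal (phase_bound p q * q powr (- 1/2))"
  have "(\<integral>\<^sup>+q. ennreal (phase_bound p q * \<bar>q\<bar> powr (- 1/2)) \<partial>lborel) = (\<integral>\<^sup>+q. ?f \<bar>q\<bar> \<partial>lborel)"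
    by (intro nn_integral_cong) (simp add: phase_bound_def abs_mult)
  also have "\<dots> \<le> 2 * (\<integral>\<^sup>+q. ?f q * indicator {0..} q \<partial>lborel)"
    by (rule nn_integral_abs_le) (use measurable_kernel [OF measurable_phase_bound] in measurable)
  \<comment> \<open>The kernel changes its form at q = 1/c. Each of the two powers integrates to 2
    c^(-1/2), and the two half-lines double the sum, which makes 8.\<close>
  also have "(\<integral>\<^sup>+q. ?f q * indicator {0..} q \<partial>lborel)
      \<le> (\<integral>\<^sup>+q. ennreal (q powr (- 1/2)) * indicator {0..1 / c} q + ennreal (1 / c) * (ennreal (q powr (- 3/2)) * indicator {1 / c..} q) \<partial>lborel)"
  proof (rule nn_integral_mono)
    fix q :: real
    consider "q < 0" | "0 \<le> q" "q \<le> 1 / c" | "1 / c < q" by linarith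
    then show "?f q * indicator {0..} q \<le> ennreal (q powr (- 1/2)) * indicator {0..1 / c} q
        + ennreal (1 / c) * (ennreal (q powr (- 3/2)) * indicator {1 / c..} q)"
    proof cases
      case 1
      then show ?thesis by (simp add: indicator_def)
    next
      case 2
      then have "phase_bound p q \<le> 1"
        using c by (auto simp: phase_bound_def abs_mult c_def field_simps)
      then have "?f q \<le> ennreal (q powr (- 1/2))"
        by (intro ennreal_leI) (simp add: mult_left_le_one_le phase_bound_nonneg)
      with 2 have "?f q * indicator {0..} q \<le> ennreal (q powr (- 1/2)) * indicator {0..1 / c} q"
        by (simp add: indicator_def)
      then show ?thesis
        by (rule order_trans) (rule add_increasing2 [OF zero_le order_refl])
    next
      case 3
      then have q: "q > 0" using c by (meson divide_pos_pos less_trans zero_less_one)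
      then have "1 < c * q" using 3 c by (simp add: field_simps)
      then have "phase_bound p q = 1 / (c * q)"
        using q by (auto simp: phase_bound_def abs_mult c_def)
      moreover have "q powr (- 3/2) = q powr (- 1/2) / q"
        using q powr_diff [of q "- 1/2" 1] by simp
      ultimately have "?f q = ennreal (1 / c) * ennreal (q powr (- 3/2))"
        using c q by (simp flip: ennreal_mult)
      with 3 q show ?thesis
        by (simp add: indicator_def)
    qed
  qed
  also have "\<dots> = ennreal ((1 / c) powr (1/2) / (1/2)) + ennreal (1 / c) * ennreal (- ((1 / c) powr (- 1/2)) / (- 1/2))"
    using c nn_integral_powr_from_0 [of "- 1/2" "1 / c"] nn_integral_powr_to_inf [of "- 3/2" "1 / c"]
    by (subst nn_integral_add) (simp_all add: nn_integral_cmult)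
  also have "\<dots> = ennreal (4 * c powr (- 1/2))"
  proof -
    have "(- 1/2 :: real) = - (1/2)" by simp
    then have "c powr (- 1/2) = inverse (c powr (1/2))"
      by (simp only: powr_minus)
    then have 1: "(1 / c) powr (1/2) = c powr (- 1/2)"
      using c by (simp only: inverse_eq_divide [symmetric] inverse_powr less_imp_le)
    have 2: "(1 / c) * (1 / c) powr (- 1/2) = c powr (- 1/2)"
    proof -
      have "(1 + - 1/2 :: real) = 1/2" by simp
      then have "(1 / c) * (1 / c) powr (- 1/2) = (1 / c) powr (1/2)"
        using c powr_add [of "1 / c" 1 "- 1/2"] by (simp only: powr_one zero_less_divide_1_iff less_imp_le)
      with 1 show ?thesis by simp
    qed
    have "ennreal (1 / c) * ennreal (- ((1 / c) powr (- 1/2)) / (- 1/2)) = ennreal (2 * ((1 / c) * (1 / c) powr (- 1/2)))"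
      using c by (simp flip: ennreal_mult)
    then show ?thesis
      unfolding 1 2 using c by (simp flip: ennreal_plus)
  qed
  also have "2 * ennreal (4 * c powr (- 1/2)) = ennreal (8 * \<bar>p\<bar> powr (- 1/2))"
    by (subst ennreal_numeral [symmetric], subst ennreal_mult [symmetric]) (simp_all add: c_def)
  finally show ?thesis
    by (simp add: mult_left_mono)
qed

lemma nn_integral_lborel2:
  assumes "F \<in> borel_measurable lborel2"
  shows "(\<integral>\<^sup>+z. F z \<partial>lborel2) = (\<integral>\<^sup>+x. \<integral>\<^sup>+y. F (x, y) \<partial>lborel \<partial>lborel)"
  using lborel.nn_integral_fst [OF assms] by simp

text \<open>The inequality between arithmetic and geometric mean for A r and B / r with r = s / t,
  in the shape in which the Schur weights appear.\<close>

lemma weighted_amgm: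
  fixes A B s t :: real
  assumes "s > 0" "t > 0"
  shows "A * B \<le> 1/2 * (A\<^sup>2 * s\<^sup>2 * inverse (t\<^sup>2)) + 1/2 * (B\<^sup>2 * t\<^sup>2 * inverse (s\<^sup>2))"
proof -
  define r where "r = s / t"
  have r: "r > 0" using assms by (simp add: r_def)
  have "0 \<le> (A * r - B / r)\<^sup>2" by simp
  also have "(A * r - B / r)\<^sup>2 = A\<^sup>2 * r\<^sup>2 + B\<^sup>2 / r\<^sup>2 - 2 * (A * B)"
    using r by (simp add: power2_diff power_mult_distrib power_divide)
  finally have "2 * (A * B) \<le> A\<^sup>2 * r\<^sup>2 + B\<^sup>2 / r\<^sup>2" by simp
  moreover have "A\<^sup>2 * s\<^sup>2 * inverse (t\<^sup>2) = A\<^sup>2 * r\<^sup>2"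
    unfolding r_def power_divide by (simp add: divide_inverse)
  moreover have "B\<^sup>2 * t\<^sup>2 * inverse (s\<^sup>2) = B\<^sup>2 / r\<^sup>2"
    unfolding r_def power_divide by (simp add: divide_inverse)
  ultimately show ?thesis by linarith
qed

text \<open>Schur's test. The weights |p|^(1/2) and |q|^(-1/2) split the integrand into two mirror
  images, and integrating the inner variable by \<open>phase_bound_schur\<close> leaves 4 |a|^2 for
  each. The points p = 0 and q = 0, where the weights degenerate, form null sets.\<close>

lemma weight_bound_L2:
  assumes a: "square_integrable a"
  shows "weight_bound phase_bound a a (8 * (norm (L2_of a))\<^sup>2)"
  unfolding weight_bound_def
proof
  fix \<xi> :: real
  note [measurable] = square_integrable_measurable [OF a] measurable_kernel [OF measurable_phase_bound]
  let ?F = "\<lambda>x y. ennreal (phase_bound (x - \<xi>) (y - \<xi>) * cmod (a x) * cmod (a y))"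
  define T where "T x y = ennreal (1/2 * (cmod (a x))\<^sup>2 * \<bar>x - \<xi>\<bar> powr (1/2)) * ennreal (phase_bound (x - \<xi>) (y - \<xi>) * \<bar>y - \<xi>\<bar> powr (- 1/2))" for x y
  have T_meas [measurable]: "(\<lambda>(x, y). T x y) \<in> borel_measurable (lborel \<Otimes>\<^sub>M lborel)"
    unfolding T_def split_beta' by measurable
  have [measurable]: "(\<lambda>(x, y). T y x) \<in> borel_measurable (lborel \<Otimes>\<^sub>M lborel)"
    unfolding T_def split_beta' by measurable
  have le: "?F x y \<le> T x y + T y x" if "x \<noteq> \<xi>" "y \<noteq> \<xi>" for x y
  proof -
    define s t where "s = \<bar>x - \<xi>\<bar> powr (1/4)" and "t = \<bar>y - \<xi>\<bar> powr (1/4)"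
    have st: "s > 0" "t > 0" using that by (simp_all add: s_def t_def)
    have s: "\<bar>x - \<xi>\<bar> powr (1/2) = s\<^sup>2" "\<bar>x - \<xi>\<bar> powr (- 1/2) = inverse (s\<^sup>2)"
      using that by (simp_all add: s_def powr_minus power2_eq_square flip: powr_add)
    have t: "\<bar>y - \<xi>\<bar> powr (1/2) = t\<^sup>2" "\<bar>y - \<xi>\<bar> powr (- 1/2) = inverse (t\<^sup>2)"
      using that by (simp_all add: t_def powr_minus power2_eq_square flip: powr_add)
    have "cmod (a x) * cmod (a y) \<le> 1/2 * ((cmod (a x))\<^sup>2 * s\<^sup>2 * inverse (t\<^sup>2)) + 1/2 * ((cmod (a y))\<^sup>2 * t\<^sup>2 * inverse (s\<^sup>2))"
      by (rule weighted_amgm [OF st])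
    then have "phase_bound (x - \<xi>) (y - \<xi>) * (cmod (a x) * cmod (a y))
        \<le> phase_bound (x - \<xi>) (y - \<xi>) * (1/2 * ((cmod (a x))\<^sup>2 * s\<^sup>2 * inverse (t\<^sup>2)) + 1/2 * ((cmod (a y))\<^sup>2 * t\<^sup>2 * inverse (s\<^sup>2)))"
      by (rule mult_left_mono) (rule phase_bound_nonneg)
    also have "\<dots> = 1/2 * (cmod (a x))\<^sup>2 * s\<^sup>2 * (phase_bound (x - \<xi>) (y - \<xi>) * inverse (t\<^sup>2))
        + 1/2 * (cmod (a y))\<^sup>2 * t\<^sup>2 * (phase_bound (y - \<xi>) (x - \<xi>) * inverse (s\<^sup>2))"
      by (simp add: algebra_simps phase_bound_def)
    finally show ?thesis
      unfolding T_def s t by (simp add: phase_bound_nonneg mult.assoc flip: ennreal_mult ennreal_plus)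
  qed
  have "(\<integral>\<^sup>+z. ?F (fst z) (snd z) \<partial>lborel2) = (\<integral>\<^sup>+x. \<integral>\<^sup>+y. ?F x y \<partial>lborel \<partial>lborel)"
    by (subst nn_integral_lborel2) simp_all
  also have "\<dots> \<le> (\<integral>\<^sup>+x. \<integral>\<^sup>+y. T x y + T y x \<partial>lborel \<partial>lborel)"
  proof (rule nn_integral_mono_AE, rule eventually_mono [OF AE_lborel_singleton [of \<xi>]])
    fix x assume x: "x \<noteq> \<xi>"
    show "(\<integral>\<^sup>+y. ?F x y \<partial>lborel) \<le> (\<integral>\<^sup>+y. T x y + T y x \<partial>lborel)"
      by (rule nn_integral_mono_AE, rule eventually_mono [OF AE_lborel_singleton [of \<xi>]]) (rule le [OF x])
  qed
  also have "\<dots> = (\<integral>\<^sup>+x. (\<integral>\<^sup>+y. T x y \<partial>lborel) + (\<integral>\<^sup>+y. T y x \<partial>lborel) \<partial>lborel)"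
    by (intro nn_integral_cong nn_integral_add) measurable
  also have "\<dots> = (\<integral>\<^sup>+x. \<integral>\<^sup>+y. T x y \<partial>lborel \<partial>lborel) + (\<integral>\<^sup>+x. \<integral>\<^sup>+y. T y x \<partial>lborel \<partial>lborel)"
    by (rule nn_integral_add) measurable
  also have "(\<integral>\<^sup>+x. \<integral>\<^sup>+y. T y x \<partial>lborel \<partial>lborel) = (\<integral>\<^sup>+x. \<integral>\<^sup>+y. T x y \<partial>lborel \<partial>lborel)"
    by (rule lborel_pair.Fubini') measurable
  also have "(\<integral>\<^sup>+x. \<integral>\<^sup>+y. T x y \<partial>lborel \<partial>lborel) \<le> (\<integral>\<^sup>+x. ennreal (4 * (cmod (a x))\<^sup>2) \<partial>lborel)"
  proof (rule nn_integral_mono_AE, rule eventually_mono [OF AE_lborel_singleton [of \<xi>]])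
    fix x assume x: "x \<noteq> \<xi>"
    have "(\<integral>\<^sup>+y. T x y \<partial>lborel) = ennreal (1/2 * (cmod (a x))\<^sup>2 * \<bar>x - \<xi>\<bar> powr (1/2))
        * (\<integral>\<^sup>+y. ennreal (phase_bound (x - \<xi>) (y - \<xi>) * \<bar>y - \<xi>\<bar> powr (- 1/2)) \<partial>lborel)"
      unfolding T_def by (rule nn_integral_cmult) measurable
    also have "(\<integral>\<^sup>+y. ennreal (phase_bound (x - \<xi>) (y - \<xi>) * \<bar>y - \<xi>\<bar> powr (- 1/2)) \<partial>lborel)
        = (\<integral>\<^sup>+q. ennreal (phase_bound (x - \<xi>) q * \<bar>q\<bar> powr (- 1/2)) \<partial>lborel)"
      by (subst nn_integral_real_affine [of _ 1 \<xi>]) simp_all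
    also have "ennreal (1/2 * (cmod (a x))\<^sup>2 * \<bar>x - \<xi>\<bar> powr (1/2)) * \<dots>
        \<le> ennreal (1/2 * (cmod (a x))\<^sup>2 * \<bar>x - \<xi>\<bar> powr (1/2)) * ennreal (8 * \<bar>x - \<xi>\<bar> powr (- 1/2))"
      using x by (intro mult_left_mono phase_bound_schur) auto
    also have "\<dots> = ennreal (4 * (cmod (a x))\<^sup>2)"
      using x by (simp add: powr_minus flip: ennreal_mult)
    finally show "(\<integral>\<^sup>+y. T x y \<partial>lborel) \<le> ennreal (4 * (cmod (a x))\<^sup>2)" .
  qed
  also have "(\<integral>\<^sup>+x. ennreal (4 * (cmod (a x))\<^sup>2) \<partial>lborel) = ennreal (4 * (norm (L2_of a))\<^sup>2)"
    using norm_L2_of_ennreal [OF a] by (simp add: ennreal_mult nn_integral_cmult)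
  finally have "(\<integral>\<^sup>+z. ?F (fst z) (snd z) \<partial>lborel2) \<le> ennreal (4 * (norm (L2_of a))\<^sup>2) + ennreal (4 * (norm (L2_of a))\<^sup>2)"
    by (simp add: add_mono)
  then show "(\<integral>\<^sup>+z. ?F (fst z) (snd z) \<partial>lborel2) \<le> ennreal (8 * (norm (L2_of a))\<^sup>2)"
    by (simp flip: ennreal_plus)
qed

text \<open>Interpolating \<open>min 1 (1 / \<bar>p * q\<bar>) \<le> \<bar>p * q\<bar> powr (- 11/12)\<close> makes the weight a product.\<close>

lemma phase_bound_le_powr:
  assumes "p \<noteq> 0" "q \<noteq> 0"
  shows "phase_bound p q \<le> \<bar>p\<bar> powr (- 11/12) * \<bar>q\<bar> powr (- 11/12)"
proof -
  define r where "r = \<bar>p * q\<bar>"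
  have r: "r > 0" using assms by (simp add: r_def)
  have "phase_bound p q \<le> r powr (- 11/12)"
  proof (cases "r \<le> 1")
    case True
    then show ?thesis
      using powr_mono' [of "- 11/12" 0 r] r by (simp add: phase_bound_def r_def)
  next
    case False
    then show ?thesis
      using powr_mono [of "- 1" "- 11/12" r] r by (simp add: phase_bound_def r_def powr_minus inverse_eq_divide)
  qed
  also have "r powr (- 11/12) = \<bar>p\<bar> powr (- 11/12) * \<bar>q\<bar> powr (- 11/12)"
    by (simp add: r_def abs_mult powr_mult)
  finally show ?thesis .
qed

text \<open>Split at |x - \<xi>| = m^12. Near \<xi> the bound M is integrated against the power,
  which gives 2 * 12 m * M; farther away the power is at most m^(-11), against an L^1 norm of at
  most m^12 M. Together this is 24 + 1 = 25.\<close>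

lemma fractional_integral_le:
  assumes a: "bounded_L1 M a" and L1: "(LBINT x. cmod (a x)) \<le> m ^ 12 * M" and m: "m > 0"
  shows "(\<integral>\<^sup>+x. ennreal (\<bar>x - \<xi>\<bar> powr (- 11/12) * cmod (a x)) \<partial>lborel) \<le> ennreal (25 * m * M)"
proof -
  note [measurable] = bounded_L1D(3) [OF a]
  have M: "0 \<le> M" by (rule bounded_L1D(5) [OF a])
  let ?N = "m ^ 12"
  have N: "?N > 0" using m by simp
  have N_powr: "?N powr e = m powr (12 * e)" for e
  proof -
    have "?N = m powr 12" using m by simp
    then show ?thesis by (simp only: powr_powr)
  qed
  have "(\<integral>\<^sup>+x. ennreal (\<bar>x - \<xi>\<bar> powr (- 11/12) * cmod (a x)) \<partial>lborel)
      \<le> (\<integral>\<^sup>+x. ennreal M * (ennreal (\<bar>x - \<xi>\<bar> powr (- 11/12)) * indicator {0..?N} \<bar>x - \<xi>\<bar>)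
          + ennreal (?N powr (- 11/12)) * ennreal (cmod (a x)) \<partial>lborel)"
  proof (rule nn_integral_mono)
    fix x
    show "ennreal (\<bar>x - \<xi>\<bar> powr (- 11/12) * cmod (a x))
        \<le> ennreal M * (ennreal (\<bar>x - \<xi>\<bar> powr (- 11/12)) * indicator {0..?N} \<bar>x - \<xi>\<bar>)
          + ennreal (?N powr (- 11/12)) * ennreal (cmod (a x))"
    proof (cases "\<bar>x - \<xi>\<bar> \<le> ?N")
      case True
      have "\<bar>x - \<xi>\<bar> powr (- 11/12) * cmod (a x) \<le> M * \<bar>x - \<xi>\<bar> powr (- 11/12)"
        using bounded_L1D(2) [OF a, of x] by (simp add: mult.commute mult_right_mono)
      then have "ennreal (\<bar>x - \<xi>\<bar> powr (- 11/12) * cmod (a x)) \<le> ennreal M * ennreal (\<bar>x - \<xi>\<bar> powr (- 11/12))"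
        using M by (simp flip: ennreal_mult)
      with True show ?thesis
        by (simp add: indicator_def add_increasing2)
    next
      case False
      then have "\<bar>x - \<xi>\<bar> powr (- 11/12) \<le> ?N powr (- 11/12)"
        using N by (intro powr_mono2') auto
      then have "\<bar>x - \<xi>\<bar> powr (- 11/12) * cmod (a x) \<le> ?N powr (- 11/12) * cmod (a x)"
        by (rule mult_right_mono) simp
      with False show ?thesis
        by (simp add: indicator_def flip: ennreal_mult)
    qed
  qed
  also have "\<dots> = ennreal M * (\<integral>\<^sup>+x. ennreal (\<bar>x - \<xi>\<bar> powr (- 11/12)) * indicator {0..?N} \<bar>x - \<xi>\<bar> \<partial>lborel)
      + ennreal (?N powr (- 11/12)) * ennreal (LBINT x. cmod (a x))"
    using bounded_L1D(1) [OF a] by (subst nn_integral_add) (simp_all add: nn_integral_cmult nn_integral_eq_integral)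
  also have "(\<integral>\<^sup>+x. ennreal (\<bar>x - \<xi>\<bar> powr (- 11/12)) * indicator {0..?N} \<bar>x - \<xi>\<bar> \<partial>lborel)
      = (\<integral>\<^sup>+x. ennreal (\<bar>x\<bar> powr (- 11/12)) * indicator {0..?N} \<bar>x\<bar> \<partial>lborel)"
    by (subst nn_integral_real_affine [of _ 1 \<xi>]) simp_all
  also have "\<dots> \<le> 2 * (\<integral>\<^sup>+x. ennreal (x powr (- 11/12)) * indicator {0..?N} x * indicator {0..} x \<partial>lborel)"
    using nn_integral_abs_le [of "\<lambda>x. ennreal (x powr (- 11/12)) * indicator {0..?N} x"] by simp
  also have "(\<integral>\<^sup>+x. ennreal (x powr (- 11/12)) * indicator {0..?N} x * indicator {0..} x \<partial>lborel)
      = (\<integral>\<^sup>+x. ennreal (x powr (- 11/12)) * indicator {0..?N} x \<partial>lborel)"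
    by (intro nn_integral_cong) (simp add: indicator_def)
  also have "\<dots> = ennreal (?N powr (- 11/12 + 1) / (- 11/12 + 1))"
    using N by (intro nn_integral_powr_from_0) auto
  also have "?N powr (- 11/12 + 1) / (- 11/12 + 1) = 12 * m"
    using m by (simp add: N_powr)
  also have "2 * ennreal (12 * m) = ennreal (24 * m)"
    using m by (subst ennreal_numeral [symmetric], subst ennreal_mult [symmetric]) simp_all
  also have "ennreal (?N powr (- 11/12)) * ennreal (LBINT x. cmod (a x)) \<le> ennreal (?N powr (- 11/12)) * ennreal (?N * M)"
    using L1 by (intro mult_left_mono ennreal_leI) auto
  also have "ennreal (?N powr (- 11/12)) * ennreal (?N * M) = ennreal (m * M)"
  proof -
    have "?N powr (- 11/12) * ?N = ?N powr (- 11/12 + 1)"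
      using N powr_add [of ?N "- 11/12" 1] by simp
    also have "\<dots> = m"
      using m by (simp add: N_powr)
    finally have e: "?N powr (- 11/12) * (?N * M) = m * M"
      by (simp only: mult.assoc [symmetric])
    have "ennreal (?N powr (- 11/12)) * ennreal (?N * M) = ennreal (?N powr (- 11/12) * (?N * M))"
      using M N by (intro ennreal_mult [symmetric]) auto
    then show ?thesis by (simp only: e)
  qed
  also have "ennreal M * ennreal (24 * m) + ennreal (m * M) = ennreal (25 * m * M)"
    using m M by (simp add: algebra_simps flip: ennreal_mult ennreal_plus)
  finally show ?thesis
    by (simp add: add_mono mult_left_mono)
qed

text \<open>The product majorant decouples the two variables, so that two applications of
  \<open>fractional_integral_le\<close> suffice, each at the price of one m.\<close>

lemma weight_bound_product:
  assumes a: "bounded_L1 A a" "(LBINT x. cmod (a x)) \<le> m ^ 12 * A"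
    and c: "bounded_L1 C c" "(LBINT x. cmod (c x)) \<le> m ^ 12 * C" and m: "m > 0"
  shows "weight_bound phase_bound a c ((25 * m)\<^sup>2 * A * C)"
  unfolding weight_bound_def
proof
  fix \<xi> :: real
  note [measurable] = bounded_L1D(3) [OF a(1)] bounded_L1D(3) [OF c(1)] measurable_kernel [OF measurable_phase_bound]
  let ?F = "\<lambda>x y. ennreal (phase_bound (x - \<xi>) (y - \<xi>) * cmod (a x) * cmod (c y))"
  let ?A = "\<lambda>x. ennreal (\<bar>x - \<xi>\<bar> powr (- 11/12) * cmod (a x))" and ?C = "\<lambda>x. ennreal (\<bar>x - \<xi>\<bar> powr (- 11/12) * cmod (c x))"
  have le: "?F x y \<le> ?A x * ?C y" if "x \<noteq> \<xi>" "y \<noteq> \<xi>" for x y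
  proof -
    have "phase_bound (x - \<xi>) (y - \<xi>) * (cmod (a x) * cmod (c y))
        \<le> (\<bar>x - \<xi>\<bar> powr (- 11/12) * \<bar>y - \<xi>\<bar> powr (- 11/12)) * (cmod (a x) * cmod (c y))"
      using that by (intro mult_right_mono phase_bound_le_powr) auto
    then show ?thesis
      by (simp add: mult_ac flip: ennreal_mult)
  qed
  have "(\<integral>\<^sup>+z. ?F (fst z) (snd z) \<partial>lborel2) = (\<integral>\<^sup>+x. \<integral>\<^sup>+y. ?F x y \<partial>lborel \<partial>lborel)"
    by (subst nn_integral_lborel2) simp_all
  also have "\<dots> \<le> (\<integral>\<^sup>+x. \<integral>\<^sup>+y. ?A x * ?C y \<partial>lborel \<partial>lborel)"
  proof (rule nn_integral_mono_AE, rule eventually_mono [OF AE_lborel_singleton [of \<xi>]])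
    fix x assume x: "x \<noteq> \<xi>"
    show "(\<integral>\<^sup>+y. ?F x y \<partial>lborel) \<le> (\<integral>\<^sup>+y. ?A x * ?C y \<partial>lborel)"
      by (rule nn_integral_mono_AE, rule eventually_mono [OF AE_lborel_singleton [of \<xi>]]) (rule le [OF x])
  qed
  also have "\<dots> = (\<integral>\<^sup>+x. ?A x \<partial>lborel) * (\<integral>\<^sup>+y. ?C y \<partial>lborel)"
    by (simp add: nn_integral_cmult nn_integral_multc)
  also have "\<dots> \<le> ennreal (25 * m * A) * ennreal (25 * m * C)"
    by (intro mult_mono fractional_integral_le a c m) auto
  also have "\<dots> = ennreal ((25 * m)\<^sup>2 * A * C)"
    using m bounded_L1D(5) [OF a(1)] bounded_L1D(5) [OF c(1)] by (simp add: power2_eq_square mult_ac flip: ennreal_mult)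
  finally show "(\<integral>\<^sup>+z. ?F (fst z) (snd z) \<partial>lborel2) \<le> ennreal ((25 * m)\<^sup>2 * A * C)" .
qed

section \<open>Bounds for the averaged nonlinearity and for its differences\<close>

lemma L1_Linf_mean_cubic_weight:
  assumes a: "bounded_L1 M a" "(LBINT x. cmod (a x)) \<le> N * M" and Q: "weight_bound phase_bound a a Q" "0 \<le> Q"
  shows "L1_Linf N (Q * M) (mean_cubic \<theta> (L2_of a))"
proof -
  note t = trilinear_bounded_L1 [OF measurable_phase_bound measurable_mean_phase phase_bound_even bounded_L1D(3) [OF a(1)] bounded_L1D(3) [OF a(1)] mean_phase_le a(1) Q, of \<theta>]
  have "(LBINT x. cmod (trilinear (mean_phase \<theta>) a a a x)) \<le> Q * (N * M)"
    using t(2) mult_left_mono [OF a(2) Q(2)] by linarith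
  then show ?thesis
    unfolding mean_cubic_L2_of [OF a(1)] using t(1) by (intro L1_Linf_L2_of) (simp_all add: mult_ac)
qed

text \<open>Linear in M as long as the L^2 norm is fixed, so that the bound on the solution grows at
  most exponentially. Global existence rests on this.\<close>

lemma L1_Linf_mean_cubic:
  assumes "L1_Linf N M v"
  shows "L1_Linf N (8 * (norm v)\<^sup>2 * M) (mean_cubic \<theta> v)"
proof -
  obtain a where a: "bounded_L1 M a" "(LBINT x. cmod (a x)) \<le> N * M" "v = L2_of a"
    using assms by (rule L1_LinfE)
  show ?thesis
    unfolding a(3) by (rule L1_Linf_mean_cubic_weight [OF a(1,2) weight_bound_L2 [OF bounded_L1D(4) [OF a(1)]]]) simp
qed

text \<open>The bound for short times: cubic in M, but with a factor of order m^2 only. For data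
  whose squared L^2 norm is of order m^12 M^2, \<open>L1_Linf_mean_cubic\<close> would cost m^12 in
  its place.\<close>

lemma L1_Linf_mean_cubic_product:
  assumes "L1_Linf (m ^ 12) M v" "m > 0"
  shows "L1_Linf (m ^ 12) ((25 * m)\<^sup>2 * M ^ 3) (mean_cubic \<theta> v)"
proof -
  obtain a where a: "bounded_L1 M a" "(LBINT x. cmod (a x)) \<le> m ^ 12 * M" "v = L2_of a"
    using assms(1) by (rule L1_LinfE)
  have "L1_Linf (m ^ 12) ((25 * m)\<^sup>2 * M * M * M) (mean_cubic \<theta> v)"
    unfolding a(3) by (rule L1_Linf_mean_cubic_weight [OF a(1,2) weight_bound_product [OF a(1,2) a(1,2) assms(2)]])
      (simp add: bounded_L1D(5) [OF a(1)])
  then show ?thesis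
    by (simp add: power3_eq_cube mult.assoc)
qed

lemma integrable_trilinear_mean_phase:
  assumes [measurable]: "case_prod k \<in> borel_measurable (borel \<Otimes>\<^sub>M borel)" and k: "\<And>p q. cmod (k p q) \<le> 1"
    and a: "bounded_L1 A a" and b: "bounded_L1 B b" and c: "bounded_L1 C c"
  shows "integrable lborel2 (\<lambda>z. k (fst z - \<xi>) (snd z - \<xi>) * a (fst z) * c (snd z) * cnj (b (fst z + snd z - \<xi>)))"
proof (rule Bochner_Integration.integrable_bound)
  note [measurable] = bounded_L1D(3) [OF a] bounded_L1D(3) [OF b] bounded_L1D(3) [OF c] measurable_kernel [OF assms(1)]
  show "integrable lborel2 (\<lambda>z. of_real B * (a (fst z) * c (snd z)))"
    by (intro integrable_mult_right integrable_pair_mult(1) bounded_L1D(1) [OF a] bounded_L1D(1) [OF c])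
  show "(\<lambda>z. k (fst z - \<xi>) (snd z - \<xi>) * a (fst z) * c (snd z) * cnj (b (fst z + snd z - \<xi>))) \<in> borel_measurable lborel2"
    by measurable
  show "AE z in lborel2. cmod (k (fst z - \<xi>) (snd z - \<xi>) * a (fst z) * c (snd z) * cnj (b (fst z + snd z - \<xi>)))
      \<le> cmod (of_real B * (a (fst z) * c (snd z)))"
  proof (intro AE_I2)
    fix z
    have "cmod (k (fst z - \<xi>) (snd z - \<xi>)) * (cmod (a (fst z)) * cmod (c (snd z))) * cmod (b (fst z + snd z - \<xi>))
        \<le> 1 * (cmod (a (fst z)) * cmod (c (snd z))) * B"
      using bounded_L1D(2) [OF b] k by (intro mult_mono) auto
    then show "cmod (k (fst z - \<xi>) (snd z - \<xi>) * a (fst z) * c (snd z) * cnj (b (fst z + snd z - \<xi>)))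
        \<le> cmod (of_real B * (a (fst z) * c (snd z)))"
      using bounded_L1D(5) [OF b] by (simp add: norm_mult mult_ac)
  qed
qed

lemma bounded_L1_add: "bounded_L1 A a \<Longrightarrow> bounded_L1 B b \<Longrightarrow> bounded_L1 (A + B) (\<lambda>x. a x + b x)"
  by (auto simp: bounded_L1_def intro: norm_triangle_mono)

lemma phase_bound_le_1: "phase_bound p q \<le> 1"
  by (auto simp: phase_bound_def divide_simps)

text \<open>Telescoping through the three arguments: those before the difference are already b,
  those after it are still a.\<close>

lemma trilinear_add_diff:
  assumes b: "bounded_L1 B b" and d: "bounded_L1 D d"
  defines "a \<equiv> \<lambda>x. b x + d x"
  shows "trilinear (mean_phase \<theta>) a a a \<xi> - trilinear (mean_phase \<theta>) b b b \<xi>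
    = trilinear (mean_phase \<theta>) d a a \<xi> + trilinear (mean_phase \<theta>) b d a \<xi> + trilinear (mean_phase \<theta>) b b d \<xi>"
proof -
  have a: "bounded_L1 (B + D) a"
    unfolding a_def by (rule bounded_L1_add [OF b d])
  have k: "cmod (mean_phase \<theta> p q) \<le> 1" for p q
    using mean_phase_le phase_bound_le_1 order_trans by blast
  let ?I = "\<lambda>x y z w. mean_phase \<theta> (fst w - \<xi>) (snd w - \<xi>) * x (fst w) * z (snd w) * cnj (y (fst w + snd w - \<xi>))"
  note int = integrable_trilinear_mean_phase [OF measurable_mean_phase k]
  have i: "integrable lborel2 (?I d a a)" "integrable lborel2 (?I b d a)" "integrable lborel2 (?I b b d)" "integrable lborel2 (?I b b b)"
    by (rule int [OF d a a], rule int [OF b d a], rule int [OF b b d], rule int [OF b b b])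
  have "(LINT w|lborel2. ?I a a a w) = (LINT w|lborel2. ?I d a a w + ?I b d a w + ?I b b d w + ?I b b b w)"
    by (rule Bochner_Integration.integral_cong [OF refl]) (simp add: a_def algebra_simps)
  also have "\<dots> = (LINT w|lborel2. ?I d a a w) + (LINT w|lborel2. ?I b d a w) + (LINT w|lborel2. ?I b b d w) + (LINT w|lborel2. ?I b b b w)"
    using i by (simp add: Bochner_Integration.integral_add)
  finally show ?thesis
    unfolding trilinear_def by (simp add: add_divide_distrib)
qed

text \<open>Controls the error of replacing the solution by its data inside the nonlinearity.
  Product weights bound the difference uniformly in frequency, so that an integrable test function
  pays only its L^1 norm.\<close>

lemma mean_cubic_diff_dual_test:
  assumes v: "L1_Linf (m ^ 12) M v" and w: "L1_Linf (m ^ 12) M w" and vw: "L1_Linf (m ^ 12) D (v - w)" and m: "m > 0"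
    and "D \<le> M" and \<phi>: "square_integrable \<phi>" "integrable lborel \<phi>"
  shows "\<bar>(mean_cubic \<theta> v - mean_cubic \<theta> w) \<bullet> L2_of \<phi>\<bar> \<le> 7 * (25 * m)\<^sup>2 * M\<^sup>2 * D * (LBINT x. cmod (\<phi> x))"
proof -
  obtain b where b: "bounded_L1 M b" "(LBINT x. cmod (b x)) \<le> m ^ 12 * M" "w = L2_of b"
    using w by (rule L1_LinfE)
  obtain d where d: "bounded_L1 D d" "(LBINT x. cmod (d x)) \<le> m ^ 12 * D" "v - w = L2_of d"
    using vw by (rule L1_LinfE)
  \<comment> \<open>v is represented by b + d, so that the decomposition holds at every point; the
    price is the bound 2 M in place of M.\<close>
  define a where "a x = b x + d x" for x
  have M: "0 \<le> M" and D: "0 \<le> D"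
    using bounded_L1D(5) [OF b(1)] bounded_L1D(5) [OF d(1)] by auto
  have a: "bounded_L1 (2 * M) a"
    using bounded_L1_add [OF b(1) d(1)] \<open>D \<le> M\<close> by (auto simp: bounded_L1_def a_def [abs_def] intro: order_trans)
  have "(LBINT x. cmod (a x)) \<le> (LBINT x. cmod (b x) + cmod (d x))"
    using bounded_L1D(1) [OF a] bounded_L1D(1) [OF b(1)] bounded_L1D(1) [OF d(1)]
    by (intro integral_mono) (auto simp: a_def norm_triangle_ineq)
  also have "\<dots> \<le> m ^ 12 * M + m ^ 12 * D"
    using b d bounded_L1D(1) [OF b(1)] bounded_L1D(1) [OF d(1)] by simp
  also have "\<dots> \<le> m ^ 12 * M + m ^ 12 * M"
    using \<open>D \<le> M\<close> m by simp
  finally have a1: "(LBINT x. cmod (a x)) \<le> m ^ 12 * (2 * M)" by (simp add: mult_ac)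
  have v_eq: "v = L2_of a"
    using b(3) d(3) bounded_L1D(4) [OF b(1)] bounded_L1D(4) [OF d(1)] by (simp add: a_def [abs_def] L2_of_add) (metis add_diff_cancel_left' diff_add_cancel add.commute)
  let ?B = "7 * (25 * m)\<^sup>2 * M\<^sup>2 * D"
  define h where "h \<xi> = trilinear (mean_phase \<theta>) a a a \<xi> - trilinear (mean_phase \<theta>) b b b \<xi>" for \<xi>
  have h_le: "cmod (h \<xi>) \<le> ?B" for \<xi>
  proof -
    have h_eq: "h \<xi> = trilinear (mean_phase \<theta>) d a a \<xi> + trilinear (mean_phase \<theta>) b d a \<xi> + trilinear (mean_phase \<theta>) b b d \<xi>"
      unfolding h_def a_def by (rule trilinear_add_diff [OF b(1) d(1)])
    have 0: "cmod (h \<xi>) \<le> cmod (trilinear (mean_phase \<theta>) d a a \<xi>) + cmod (trilinear (mean_phase \<theta>) b d a \<xi>) + cmod (trilinear (mean_phase \<theta>) b b d \<xi>)"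
      unfolding h_eq by (intro norm_triangle_le add_right_mono norm_triangle_ineq)
    have 1: "cmod (trilinear (mean_phase \<theta>) d a a \<xi>) \<le> (2 * M) * ((25 * m)\<^sup>2 * D * (2 * M))"
      using M D by (intro trilinear_bound [OF measurable_phase_bound bounded_L1D(3) [OF d(1)] bounded_L1D(3) [OF a] mean_phase_le bounded_L1D(2) [OF a]
        weight_bound_product [OF d(1,2) a a1 m]]) simp
    have 2: "cmod (trilinear (mean_phase \<theta>) b d a \<xi>) \<le> D * ((25 * m)\<^sup>2 * M * (2 * M))"
      using M D by (intro trilinear_bound [OF measurable_phase_bound bounded_L1D(3) [OF b(1)] bounded_L1D(3) [OF a] mean_phase_le bounded_L1D(2) [OF d(1)]
        weight_bound_product [OF b(1,2) a a1 m]]) simp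
    have 3: "cmod (trilinear (mean_phase \<theta>) b b d \<xi>) \<le> M * ((25 * m)\<^sup>2 * M * D)"
      using M D by (intro trilinear_bound [OF measurable_phase_bound bounded_L1D(3) [OF b(1)] bounded_L1D(3) [OF d(1)] mean_phase_le bounded_L1D(2) [OF b(1)]
        weight_bound_product [OF b(1,2) d(1,2) m]]) simp
    \<comment> \<open>The constant is 7 = 4 + 2 + 1, according to how many factors carry the bound 2
      M.\<close>
    have "(2 * M) * ((25 * m)\<^sup>2 * D * (2 * M)) + D * ((25 * m)\<^sup>2 * M * (2 * M)) + M * ((25 * m)\<^sup>2 * M * D) = ?B"
      by (simp add: power2_eq_square)
    with 0 1 2 3 show ?thesis by linarith
  qed
  have t: "square_integrable (trilinear (mean_phase \<theta>) c c c)" if "bounded_L1 C c" for c C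
    by (rule bounded_L1D(4) [OF trilinear_bounded_L1(1) [OF measurable_phase_bound measurable_mean_phase phase_bound_even bounded_L1D(3) [OF that] bounded_L1D(3) [OF that] mean_phase_le that
          weight_bound_L2 [OF bounded_L1D(4) [OF that]]]]) simp
  have h: "square_integrable h" "mean_cubic \<theta> v - mean_cubic \<theta> w = L2_of h"
    unfolding v_eq b(3) mean_cubic_L2_of [OF a] mean_cubic_L2_of [OF b(1)] h_def
    using t [OF a] t [OF b(1)] by (simp_all add: square_integrable_diff L2_of_diff)
  have "\<bar>L2_of h \<bullet> L2_of \<phi>\<bar> \<le> (LBINT x. \<bar>h x \<bullet> \<phi> x\<bar>)"
    using h(1) \<phi>(1) integral_norm_bound [of lborel "\<lambda>x. h x \<bullet> \<phi> x"] by (simp add: inner_L2_of)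
  also have "\<dots> \<le> (LBINT x. ?B * cmod (\<phi> x))"
  proof (rule integral_mono)
    show "integrable lborel (\<lambda>x. \<bar>h x \<bullet> \<phi> x\<bar>)"
      by (intro integrable_abs integrable_inner_square_integrable h \<phi>)
    show "integrable lborel (\<lambda>x. ?B * cmod (\<phi> x))"
      using \<phi>(2) by simp
    show "\<bar>h x \<bullet> \<phi> x\<bar> \<le> ?B * cmod (\<phi> x)" for x
      using order_trans [OF Cauchy_Schwarz_ineq2 mult_right_mono [OF h_le]] by simp
  qed
  finally show ?thesis
    using h(2) by simp
qed

section \<open>Global solutions\<close>

text \<open>The integrals are oriented, so that for b < a the integral of h is not positive; hence
  the absolute value on the right.\<close>

lemma norm_interval_integral_le:
  fixes g :: "real \<Rightarrow> 'a::{banach,second_countable_topology}" and h :: "real \<Rightarrow> real"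
  assumes g: "continuous_on UNIV g" and h: "continuous_on UNIV h"
    and le: "\<And>x. x \<in> closed_segment a b \<Longrightarrow> norm (g x) \<le> h x"
  shows "norm (LBINT x=ereal a..ereal b. g x) \<le> \<bar>LBINT x=ereal a..ereal b. h x\<bar>"
proof -
  have main: "norm (LBINT x=ereal a..ereal b. g x) \<le> (LBINT x=ereal a..ereal b. h x)"
    if "a \<le> b" and le: "\<And>x. a \<le> x \<Longrightarrow> x \<le> b \<Longrightarrow> norm (g x) \<le> h x" for a b
  proof -
    have int: "set_integrable lborel {a<..<b} g" "set_integrable lborel {a<..<b} h"
      using interval_integrable_continuous [OF g, of a b] interval_integrable_continuous [OF h, of a b] \<open>a \<le> b\<close>
      by (simp_all add: interval_lebesgue_integrable_def)
    have "norm (LBINT x:{a<..<b}. g x) \<le> (LBINT x. norm (indicator {a<..<b} x *\<^sub>R g x))"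
      unfolding set_lebesgue_integral_def by (rule integral_norm_bound)
    also have "\<dots> \<le> (LBINT x:{a<..<b}. h x)"
      unfolding set_lebesgue_integral_def
      using int le unfolding set_integrable_def
      by (intro integral_mono integrable_norm) (auto simp: indicator_def)
    finally show ?thesis
      using \<open>a \<le> b\<close> by (simp add: interval_lebesgue_integral_def)
  qed
  show ?thesis
  proof (cases "a \<le> b")
    case True
    then show ?thesis
      using main [OF True] le by (auto simp: closed_segment_eq_real_ivl intro: order_trans)
  next
    case False
    then have "norm (LBINT x=ereal b..ereal a. g x) \<le> (LBINT x=ereal b..ereal a. h x)"
      using le by (intro main) (auto simp: closed_segment_eq_real_ivl)
    then show ?thesis
      using interval_integral_endpoints_reverse [of "ereal a" "ereal b" g] interval_integral_endpoints_reverse [of "ereal a" "ereal b" h]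
      by simp
  qed
qed

lemma interval_integral_const_real: "(LBINT x=ereal a..ereal b. c) = (b - a) *\<^sub>R c"
  for c :: "'a::{banach,second_countable_topology}"
proof (cases "a \<le> b")
  case True
  then show ?thesis
    by (simp add: interval_lebesgue_integral_def set_lebesgue_integral_def)
next
  case False
  then show ?thesis
    by (simp add: interval_lebesgue_integral_def set_lebesgue_integral_def flip: scaleR_minus_left)
qed

lemma interval_integral_diff_endpoints:
  fixes g :: "real \<Rightarrow> 'a::{banach,second_countable_topology}"
  assumes g: "continuous_on UNIV g"
  shows "(LBINT x=ereal c..ereal b. g x) - (LBINT x=ereal c..ereal a. g x) = (LBINT x=ereal a..ereal b. g x)"
proof -
  have "(LBINT x=ereal c..ereal a. g x) + (LBINT x=ereal a..ereal b. g x) = (LBINT x=ereal c..ereal b. g x)"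
    by (rule interval_integral_sum) (simp add: interval_integrable_continuous [OF g] flip: ereal_min ereal_max)
  then show ?thesis by (metis add_diff_cancel_left')
qed

lemma interval_integral_has_vector_derivative:
  fixes g :: "real \<Rightarrow> 'a::{banach,second_countable_topology}"
  assumes g: "continuous_on UNIV g"
  shows "((\<lambda>t. LBINT x=ereal a..ereal t. g x) has_vector_derivative g t) (at t)"
  unfolding has_vector_derivative_def has_derivative_at_alt
proof (intro conjI allI impI)
  show "bounded_linear (\<lambda>h. h *\<^sub>R g t)"
    by (rule bounded_linear_scaleR_left)
  fix e :: real assume "e > 0"
  have "isCont g t" using g by (simp add: continuous_on_eq_continuous_at)
  then obtain d where d: "d > 0" "\<And>x. \<bar>x - t\<bar> < d \<Longrightarrow> norm (g x - g t) < e"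
    using \<open>e > 0\<close> unfolding continuous_at_eps_delta by (auto simp: dist_norm)
  have "norm ((LBINT x=ereal a..ereal s. g x) - (LBINT x=ereal a..ereal t. g x) - (s - t) *\<^sub>R g t) \<le> e * norm (s - t)"
    if "norm (s - t) < d" for s
  proof -
    have cg: "continuous_on UNIV (\<lambda>x. g x - g t)"
      by (intro continuous_intros g)
    have "(LBINT x=ereal a..ereal s. g x) - (LBINT x=ereal a..ereal t. g x) - (s - t) *\<^sub>R g t
        = (LBINT x=ereal t..ereal s. g x) - (LBINT x=ereal t..ereal s. g t)"
      by (simp only: interval_integral_diff_endpoints [OF g] interval_integral_const_real)
    also have "\<dots> = (LBINT x=ereal t..ereal s. g x - g t)"
      by (intro interval_lebesgue_integral_diff(2) [symmetric] interval_integrable_continuous g continuous_on_const)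
    also have "norm \<dots> \<le> \<bar>LBINT x=ereal t..ereal s. e\<bar>"
    proof (rule norm_interval_integral_le [OF cg])
      fix x assume "x \<in> closed_segment t s"
      then have "\<bar>x - t\<bar> < d"
        using that by (auto simp: closed_segment_eq_real_ivl split: if_splits)
      then show "norm (g x - g t) \<le> e"
        using d(2) by (intro less_imp_le)
    qed simp
    also have "\<dots> = e * norm (s - t)"
      using \<open>e > 0\<close> by (simp add: interval_integral_const_real abs_mult)
    finally show ?thesis .
  qed
  with d(1) show "\<exists>d>0. \<forall>y. norm (y - t) < d \<longrightarrow>
      norm ((LBINT x=ereal a..ereal y. g x) - (LBINT x=ereal a..ereal t. g x) - (y - t) *\<^sub>R g t) \<le> e * norm (y - t)"
    by blast
qed

lemma continuous_interval_integral:
  fixes g :: "real \<Rightarrow> 'a::{banach,second_countable_topology}"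
  assumes g: "continuous_on UNIV g"
  shows "continuous_on UNIV (\<lambda>t. LBINT x=ereal a..ereal t. g x)"
  using has_vector_derivative_continuous [OF interval_integral_has_vector_derivative [OF g]]
  by (simp add: continuous_on_eq_continuous_at)

text \<open>The a priori bounds depend on |t|, which is not differentiable at 0. For t < 0 an
  antiderivative is - F (- x), and the sign disappears in the absolute value.\<close>

lemma interval_integral_even:
  fixes h F :: "real \<Rightarrow> real"
  assumes F: "\<And>x. (F has_real_derivative h x) (at x)" and h: "continuous_on UNIV h"
  shows "\<bar>LBINT x=ereal 0..ereal t. h \<bar>x\<bar>\<bar> = \<bar>F \<bar>t\<bar> - F 0\<bar>"
proof -
  have cont: "continuous_on A (\<lambda>x. h \<bar>x\<bar>)" for A
    by (rule continuous_on_compose2 [OF h]) (auto intro: continuous_intros)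
  show ?thesis
  proof (cases "0 \<le> t")
    case True
    have "(LBINT x=ereal 0..ereal t. h \<bar>x\<bar>) = F t - F 0"
    proof (rule interval_integral_FTC_finite [OF cont])
      fix x assume "min 0 t \<le> x" "x \<le> max 0 t"
      then show "(F has_vector_derivative h \<bar>x\<bar>) (at x within {min 0 t..max 0 t})"
        using F [of x] True by (simp add: has_real_derivative_iff_has_vector_derivative has_vector_derivative_at_within)
    qed
    with True show ?thesis by simp
  next
    case False
    have "(LBINT x=ereal 0..ereal t. h \<bar>x\<bar>) = - F (- t) - - F (- 0)"
    proof (rule interval_integral_FTC_finite [OF cont])
      fix x assume "min 0 t \<le> x" "x \<le> max 0 t"
      then have x: "\<bar>x\<bar> = - x" using False by simp
      have "((\<lambda>x. - F (- x)) has_real_derivative h (- x)) (at x)"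
        by (rule derivative_eq_intros DERIV_chain2 [OF F] refl | simp)+
      then show "((\<lambda>x. - F (- x)) has_vector_derivative h \<bar>x\<bar>) (at x within {min 0 t..max 0 t})"
        by (simp add: x has_real_derivative_iff_has_vector_derivative has_vector_derivative_at_within)
    qed
    with False show ?thesis by simp
  qed
qed

text \<open>
  Contraction principle in the space of continuous functions that are bounded by a multiple of \<open>W\<close>;
  the weight grows so fast that it absorbs the time-dependent Lipschitz constant \<open>L\<close>.
\<close>

lemma picard:
  fixes f :: "real \<Rightarrow> 'a::{banach,second_countable_topology} \<Rightarrow> 'a"
  assumes S: "\<And>t. closed (S t)" "\<And>t. 0 \<in> S t"
    and cont: "\<And>v. continuous_on UNIV v \<Longrightarrow> (\<And>t. v t \<in> S t) \<Longrightarrow> continuous_on UNIV (\<lambda>\<tau>. f \<tau> (v \<tau>))"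
    and lip: "\<And>t x y. x \<in> S t \<Longrightarrow> y \<in> S t \<Longrightarrow> norm (f t x - f t y) \<le> L t * norm (x - y)"
    and inv: "\<And>v t. continuous_on UNIV v \<Longrightarrow> (\<And>t. v t \<in> S t) \<Longrightarrow> w0 + (LBINT \<tau>=ereal 0..ereal t. f \<tau> (v \<tau>)) \<in> S t"
    and L: "continuous_on UNIV L" "\<And>t. 0 \<le> L t"
    and W: "continuous_on UNIV W" "\<And>t. 0 < W t" "\<And>t. \<bar>LBINT \<tau>=ereal 0..ereal t. L \<tau> * W \<tau>\<bar> \<le> W t / 2"
    and B: "\<And>t x. x \<in> S t \<Longrightarrow> norm x \<le> B * W t"
  obtains v where "continuous_on UNIV v" "\<And>t. v t \<in> S t" "\<And>t. v t = w0 + (LBINT \<tau>=ereal 0..ereal t. f \<tau> (v \<tau>))"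
proof -
  \<comment> \<open>\<open>lift\<close> and \<open>unl\<close> multiply and divide by the weight, so
    that the weighted supremum norm becomes the ordinary one of bounded continuous
    functions.\<close>
  define lift :: "(real \<Rightarrow>\<^sub>C 'a) \<Rightarrow> real \<Rightarrow> 'a" where "lift \<phi> t = W t *\<^sub>R apply_bcontfun \<phi> t" for \<phi> t
  define unl :: "(real \<Rightarrow> 'a) \<Rightarrow> (real \<Rightarrow>\<^sub>C 'a)" where "unl v = Bcontfun (\<lambda>t. inverse (W t) *\<^sub>R v t)" for v
  have W_nz: "W t \<noteq> 0" for t using W(2) [of t] by simp
  have unl: "apply_bcontfun (unl v) = (\<lambda>t. inverse (W t) *\<^sub>R v t)" if "continuous_on UNIV v" "\<And>t. v t \<in> S t" for v
  proof -
    have "norm (inverse (W t) *\<^sub>R v t) \<le> B" for t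
      using B [OF that(2), of t] W(2) [of t] by (simp add: field_simps abs_of_pos)
    then have "(\<lambda>t. inverse (W t) *\<^sub>R v t) \<in> bcontfun"
      using that(1) W_nz by (auto simp: bcontfun_def bounded_iff intro!: continuous_intros W(1))
    then show ?thesis
      by (simp add: unl_def Bcontfun_inverse)
  qed
  have lift_unl: "lift (unl v) = v" if "continuous_on UNIV v" "\<And>t. v t \<in> S t" for v
    by (rule ext) (simp add: lift_def unl [OF that] W_nz)
  have lift_cont: "continuous_on UNIV (lift \<phi>)" for \<phi>
    unfolding lift_def by (intro continuous_on_scaleR W(1) continuous_on_apply_bcontfun)
  define s where "s = {\<phi>. \<forall>t. lift \<phi> t \<in> S t}"
  define T where "T v t = w0 + (LBINT \<tau>=ereal 0..ereal t. f \<tau> (v \<tau>))" for v t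
  have T: "continuous_on UNIV (T v)" "T v t \<in> S t" if "continuous_on UNIV v" "\<And>t. v t \<in> S t" for v t
    using inv [OF that] unfolding T_def
    by (auto intro!: continuous_intros continuous_interval_integral cont [OF that])
  have app_tendsto: "(\<lambda>n. apply_bcontfun (X n) t) \<longlonglongrightarrow> apply_bcontfun x t"
    if "X \<longlonglongrightarrow> x" for X :: "nat \<Rightarrow> real \<Rightarrow>\<^sub>C 'a" and x t
  proof (rule tendsto_dist_iff [THEN iffD2], rule tendsto_sandwich [OF _ _ tendsto_const])
    show "(\<lambda>n. dist (X n) x) \<longlonglongrightarrow> 0"
      using that by (rule tendsto_dist_iff [THEN iffD1])
  qed (auto intro: always_eventually dist_bounded)
  have "closed s"
    unfolding closed_sequential_limits
  proof (intro allI impI, elim conjE)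
    fix X x assume X: "\<forall>n. X n \<in> s" and x: "X \<longlonglongrightarrow> x"
    have "lift x t \<in> S t" for t
    proof (rule closed_sequentially [OF S(1)])
      show "lift (X n) t \<in> S t" for n
        using X by (simp add: s_def)
      show "(\<lambda>n. lift (X n) t) \<longlonglongrightarrow> lift x t"
        unfolding lift_def by (intro tendsto_intros app_tendsto x)
    qed
    then show "x \<in> s" by (simp add: s_def)
  qed
  note complete = complete_eq_closed [THEN iffD2, OF this]
  have "s \<noteq> {}"
    using lift_unl [of "\<lambda>t. 0"] S(2) by (auto simp: s_def intro!: exI [of _ "unl (\<lambda>t. 0)"])
  moreover have "(\<lambda>\<phi>. unl (T (lift \<phi>))) ` s \<subseteq> s"
    using T lift_cont by (auto simp: s_def lift_unl)
  moreover have "dist (unl (T (lift \<phi>))) (unl (T (lift \<psi>))) \<le> 1/2 * dist \<phi> \<psi>" if "\<phi> \<in> s" "\<psi> \<in> s" for \<phi> \<psi>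
  proof (rule dist_bound)
    fix t
    have in_S: "\<And>t. lift \<phi> t \<in> S t" "\<And>t. lift \<psi> t \<in> S t" using that by (auto simp: s_def)
    note c = cont [OF lift_cont in_S(1)] cont [OF lift_cont in_S(2)]
    have "T (lift \<phi>) t - T (lift \<psi>) t = (LBINT \<tau>=ereal 0..ereal t. f \<tau> (lift \<phi> \<tau>) - f \<tau> (lift \<psi> \<tau>))"
      unfolding T_def add_diff_cancel_left
      by (intro interval_lebesgue_integral_diff(2) [symmetric] interval_integrable_continuous c)
    also have "norm \<dots> \<le> \<bar>LBINT \<tau>=ereal 0..ereal t. L \<tau> * W \<tau> * dist \<phi> \<psi>\<bar>"
    proof (rule norm_interval_integral_le)
      fix \<tau>
      have "norm (lift \<phi> \<tau> - lift \<psi> \<tau>) = W \<tau> * dist (apply_bcontfun \<phi> \<tau>) (apply_bcontfun \<psi> \<tau>)"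
        using W(2) [of \<tau>] by (simp add: lift_def dist_norm flip: scaleR_diff_right)
      also have "\<dots> \<le> W \<tau> * dist \<phi> \<psi>"
        using W(2) [of \<tau>] by (intro mult_left_mono dist_bounded) auto
      finally have "L \<tau> * norm (lift \<phi> \<tau> - lift \<psi> \<tau>) \<le> L \<tau> * (W \<tau> * dist \<phi> \<psi>)"
        using L(2) by (rule mult_left_mono)
      then show "norm (f \<tau> (lift \<phi> \<tau>) - f \<tau> (lift \<psi> \<tau>)) \<le> L \<tau> * W \<tau> * dist \<phi> \<psi>"
        using lip [OF in_S(1) in_S(2), of \<tau>] by simp
    qed (intro continuous_intros c L W)+
    also have "\<dots> = \<bar>LBINT \<tau>=ereal 0..ereal t. L \<tau> * W \<tau>\<bar> * dist \<phi> \<psi>"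
      by (simp add: abs_mult)
    \<comment> \<open>Here the weight absorbs the Lipschitz constant: the integral of L W returns at
      most half of W, for every t.\<close>
    also have "\<dots> \<le> W t / 2 * dist \<phi> \<psi>"
      by (intro mult_right_mono W(3)) simp
    finally have "norm (T (lift \<phi>) t - T (lift \<psi>) t) \<le> W t / 2 * dist \<phi> \<psi>" .
    then have "inverse (W t) * norm (T (lift \<phi>) t - T (lift \<psi>) t) \<le> 1/2 * dist \<phi> \<psi>"
      using W(2) [of t] by (simp add: field_simps)
    then show "dist (apply_bcontfun (unl (T (lift \<phi>))) t) (apply_bcontfun (unl (T (lift \<psi>))) t) \<le> 1/2 * dist \<phi> \<psi>"
      using W(2) [of t] T lift_cont in_S
      by (simp add: unl dist_norm flip: scaleR_diff_right)
  qed
  ultimately have "\<exists>!\<phi>\<in>s. unl (T (lift \<phi>)) = \<phi>"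
    by (intro Banach_fix [OF complete, of "1/2"]) auto
  then obtain \<phi> where \<phi>: "\<phi> \<in> s" "unl (T (lift \<phi>)) = \<phi>" by blast
  have in_S: "\<And>t. lift \<phi> t \<in> S t" using \<phi>(1) by (simp add: s_def)
  have "lift \<phi> = lift (unl (T (lift \<phi>)))" by (simp add: \<phi>(2))
  also have "\<dots> = T (lift \<phi>)"
    by (intro lift_unl T lift_cont in_S)
  finally have "lift \<phi> t = T (lift \<phi>) t" for t by (rule fun_cong)
  then have "lift \<phi> t = w0 + (LBINT \<tau>=ereal 0..ereal t. f \<tau> (lift \<phi> \<tau>))" for t
    unfolding T_def .
  then show ?thesis
    by (rule that [OF lift_cont in_S])
qed

section \<open>Integrals of dual bounds, the cut-off and conservation of mass\<close>

lemma dual_test_uminus: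
  assumes "dual_test N w c"
  shows "dual_test N (- w) c"
proof -
  obtain \<phi> where \<phi>: "square_integrable \<phi>" "w = L2_of \<phi>"
    "integrable lborel \<phi> \<and> c = (LBINT x. cmod (\<phi> x)) \<or> (\<forall>x. cmod (\<phi> x) \<le> 1) \<and> c = N"
    using assms by (auto simp: dual_test_def)
  have "- w = L2_of (\<lambda>x. - \<phi> x)"
    using L2_of_scaleR [OF \<phi>(1), of "-1"] \<phi>(2) by simp
  then show ?thesis
    unfolding dual_test_def using \<phi> by (intro exI [of _ "\<lambda>x. - \<phi> x"]) (auto intro: square_integrable_uminus)
qed

lemma L1_Linf_abs: "L1_Linf N M v \<Longrightarrow> dual_test N w c \<Longrightarrow> \<bar>v \<bullet> w\<bar> \<le> M * c"
  using L1_LinfD [of N M v w c] L1_LinfD [of N M v "- w" c] dual_test_uminus [of N w c] by auto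

text \<open>The benefit of the dual form: a pairing commutes with the Bochner integral, so bounds on
  the integrand can be integrated, and no representatives jointly measurable in time and frequency
  have to be chosen.\<close>

lemma L1_Linf_interval_integral:
  assumes w: "L1_Linf N A w" and g: "continuous_on UNIV g" and h: "continuous_on UNIV h" and "0 \<le> N"
    and gh: "\<And>x. x \<in> closed_segment 0 t \<Longrightarrow> L1_Linf N (h x) (g x)"
  shows "L1_Linf N (A + \<bar>LBINT x=ereal 0..ereal t. h x\<bar>) (w + (LBINT x=ereal 0..ereal t. g x))"
  unfolding L1_Linf_def
proof (intro allI impI)
  fix z c assume z: "dual_test N z c"
  then have "0 \<le> c" using \<open>0 \<le> N\<close> by (rule dual_test_nonneg)
  have "(LBINT x=ereal 0..ereal t. g x) \<bullet> z = (LBINT x=ereal 0..ereal t. g x \<bullet> z)"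
    by (intro interval_integral_bounded_linear(1) [symmetric] bounded_linear_inner_left interval_integrable_continuous g)
  also have "\<dots> \<le> \<bar>LBINT x=ereal 0..ereal t. h x * c\<bar>"
  proof -
    have "norm (LBINT x=ereal 0..ereal t. g x \<bullet> z) \<le> \<bar>LBINT x=ereal 0..ereal t. h x * c\<bar>"
      by (intro norm_interval_integral_le continuous_intros g h) (use L1_Linf_abs [OF gh z] in simp)
    then show ?thesis by simp
  qed
  also have "\<dots> = \<bar>LBINT x=ereal 0..ereal t. h x\<bar> * c"
    using \<open>0 \<le> c\<close> by (simp add: abs_mult)
  finally show "(w + (LBINT x=ereal 0..ereal t. g x)) \<bullet> z \<le> (A + \<bar>LBINT x=ereal 0..ereal t. h x\<bar>) * c"
    using L1_LinfD [OF w z] by (simp add: inner_add_left distrib_right)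
qed

text \<open>For r > 0 this is the radial retraction onto the closed ball of radius r. As a scaling
  by a factor in [0, 1] it respects the bounds \<open>L1_Linf\<close>.\<close>

definition radial :: "real \<Rightarrow> 'a::real_normed_vector \<Rightarrow> 'a" where
  "radial r v = (r / max r (norm v)) *\<^sub>R v"

lemma radial_eq: "0 < r \<Longrightarrow> norm v \<le> r \<Longrightarrow> radial r v = v"
  by (simp add: radial_def max_def)

lemma norm_radial: "0 < r \<Longrightarrow> norm (radial r v) \<le> r"
  by (simp add: radial_def max_def divide_simps)

lemma L1_Linf_radial:
  assumes "0 < r" "L1_Linf N M v" "0 \<le> N"
  shows "L1_Linf N M (radial r v)"
proof (rule L1_Linf_mono)
  have q: "0 \<le> r / max r (norm v)" "r / max r (norm v) \<le> 1"
    using assms(1) by (auto simp: divide_simps max_def)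
  show "L1_Linf N (r / max r (norm v) * M) (radial r v)"
    unfolding radial_def by (rule L1_Linf_scaleR [OF assms(2) q(1)])
  show "r / max r (norm v) * M \<le> M"
    using q L1_Linf_nonneg [OF assms(2)] by (intro mult_left_le_one_le) auto
qed (rule assms)

text \<open>One term moves the vector, the other the scaling factor, and each is bounded by the
  distance. The constant 2 holds in every normed space.\<close>

lemma radial_lipschitz:
  assumes "0 < r"
  shows "norm (radial r v - radial r w) \<le> 2 * norm (v - w)"
proof -
  define A B where "A = max r (norm v)" and "B = max r (norm w)"
  have AB: "r \<le> A" "r \<le> B" "norm w \<le> B" "0 < A" "0 < B"
    using assms by (auto simp: A_def B_def)
  have AB_diff: "\<bar>B - A\<bar> \<le> norm (v - w)"
    using norm_triangle_ineq3 [of v w] by (auto simp: A_def B_def max_def)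
  have "radial r v - radial r w = (r / A) *\<^sub>R (v - w) + (r / A * ((B - A) / B)) *\<^sub>R w"
  proof -
    have "r / A * ((B - A) / B) = r / A - r / B"
      using AB by (simp add: field_simps)
    then show ?thesis
      by (simp add: radial_def A_def B_def scaleR_diff_left scaleR_diff_right)
  qed
  also have "norm \<dots> \<le> norm ((r / A) *\<^sub>R (v - w)) + norm ((r / A * ((B - A) / B)) *\<^sub>R w)"
    by (rule norm_triangle_ineq)
  also have "norm ((r / A) *\<^sub>R (v - w)) \<le> 1 * norm (v - w)"
    unfolding norm_scaleR using AB assms by (intro mult_right_mono) auto
  also have "norm ((r / A * ((B - A) / B)) *\<^sub>R w) \<le> norm (v - w)"
  proof -
    have "norm ((r / A * ((B - A) / B)) *\<^sub>R w) = (r / A) * (\<bar>B - A\<bar> * (norm w / B))"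
      using AB assms by (simp add: abs_mult abs_of_pos)
    also have "\<dots> \<le> 1 * (norm (v - w) * 1)"
      using AB AB_diff assms by (intro mult_mono) auto
    finally show ?thesis by simp
  qed
  finally show ?thesis by simp
qed

text \<open>Conservation of mass: with \<open>U\<close> the physical-space function, \<open>U \<bullet> (\<i> * \<bar>U\<bar>\<^sup>2 * U)\<close> vanishes pointwise.\<close>

lemma inner_imult_dressed_cubic:
  assumes "L1_Linf N M v"
  shows "v \<bullet> imult (dressed_cubic \<eta> v) = 0"
proof -
  obtain a where a: "bounded_L1 M a" "(LBINT x. cmod (a x)) \<le> N * M" "propagator \<eta> v = L2_of a"
    using L1_Linf_propagator [OF assms] by (rule L1_LinfE)
  define U where "U = rep_L2 (inv fourier (propagator \<eta> v))"
  have U: "square_integrable U" "L2_of U = inv fourier (propagator \<eta> v)" "square_integrable (cubic U)"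
    using cubic_hat_bounded_L1(2) [OF a(1)] by (simp_all add: U_def a(3))
  have dressed_cubic: "dressed_cubic \<eta> v = propagator (- \<eta>) (fourier (L2_of (cubic U)))"
    by (simp add: dressed_cubic_def cubic_hat_def U_def)
  have v: "v = propagator (- \<eta>) (fourier (L2_of U))"
    by (simp add: U(2))
  have "v \<bullet> imult (dressed_cubic \<eta> v) = propagator (- \<eta>) (fourier (L2_of U)) \<bullet> propagator (- \<eta>) (fourier (imult (L2_of (cubic U))))"
    unfolding dressed_cubic by (subst v) (simp add: propagator_imult fourier_imult)
  also have "\<dots> = L2_of U \<bullet> imult (L2_of (cubic U))"
    by (simp add: inner_isometry bounded_linear.linear bounded_linear_propagator bounded_linear_fourier)
  also have "\<dots> = (LBINT x. U x \<bullet> (\<i> * cubic U x))"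
    unfolding imult_L2_of [OF U(3)] by (rule inner_L2_of [OF U(1) square_integrable_cmult [OF U(3)]])
  also have "\<dots> = (LBINT (x::real). 0)"
    by (rule Bochner_Integration.integral_cong [OF refl]) (simp add: cubic_def inner_complex_def)
  finally show ?thesis by simp
qed

lemma inner_imult_mean_cubic:
  assumes "L1_Linf N M v"
  shows "v \<bullet> imult (mean_cubic \<theta> v) = 0"
proof -
  have bl: "bounded_linear (\<lambda>w. v \<bullet> imult w)"
    by (rule bounded_linear_compose [OF bounded_linear_inner_right bounded_linear_imult])
  have "v \<bullet> imult (mean_cubic \<theta> v) = (LBINT \<sigma>=0..1. v \<bullet> imult (dressed_cubic (\<sigma> + \<theta>) v))"
    unfolding mean_cubic_def by (rule interval_integral_bounded_linear(1) [OF bl dressed_cubic_integrable [OF assms], symmetric])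
  then show ?thesis
    by (simp add: inner_imult_dressed_cubic [OF assms])
qed

text \<open>Along a convergent sequence of times the exponential bounds have a common majorant, as
  \<open>mean_cubic_tendsto\<close> requires.\<close>

lemma continuous_mean_cubic:
  assumes v: "continuous_on UNIV v" and L1_Linf: "\<And>t. L1_Linf N (M * exp (\<kappa> * \<bar>t\<bar>)) (v t)" and "0 \<le> N" "0 \<le> \<kappa>"
  shows "continuous_on UNIV (\<lambda>\<tau>. mean_cubic (\<gamma> * \<tau>) (v \<tau>))"
  unfolding continuous_on_sequentially comp_def
proof (intro allI impI ballI, elim conjE)
  fix x and t :: "nat \<Rightarrow> real"
  assume t: "t \<longlonglongrightarrow> x"
  obtain T where T: "\<And>n. \<bar>t n\<bar> \<le> T"
    using convergent_imp_Bseq [OF convergentI [OF t]] by (auto simp: Bseq_def)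
  have M: "0 \<le> M"
    using L1_Linf_nonneg [OF L1_Linf [of 0]] by simp
  have vt: "(\<lambda>n. v (t n)) \<longlonglongrightarrow> v x"
    using v t by (auto simp: continuous_on_sequentially comp_def)
  have "L1_Linf N (M * exp (\<kappa> * T)) (v (t n))" for n
    by (rule L1_Linf_mono [OF L1_Linf _ \<open>0 \<le> N\<close>]) (use M T \<open>0 \<le> \<kappa>\<close> in \<open>intro mult_left_mono exp_le_cancel_iff [THEN iffD2]; auto\<close>)
  then show "(\<lambda>n. mean_cubic (\<gamma> * t n) (v (t n))) \<longlonglongrightarrow> mean_cubic (\<gamma> * x) (v x)"
    by (intro mean_cubic_tendsto [OF _ vt _ \<open>0 \<le> N\<close>] tendsto_intros t)
qed

lemma continuous_radial: "0 < r \<Longrightarrow> continuous_on UNIV v \<Longrightarrow> continuous_on UNIV (\<lambda>t. radial r (v t))"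
  unfolding radial_def by (intro continuous_intros) (auto simp: max_def)

text \<open>
  The equation for \<open>v t = exp (- i \<gamma> t \<partial>\<^sub>x\<^sup>2) u t\<close> on the Fourier side. The nonlinearity is cut off outside the ball
  that contains the data in \<open>L\<^sup>2\<close>; conservation of the \<open>L\<^sup>2\<close> norm removes the cut-off again.
\<close>

lemma interaction_solution:
  assumes w0: "L1_Linf (m ^ 12) M w0" "w0 \<noteq> 0" and m: "0 < m" and t0: "(25 * m)\<^sup>2 * (2 * M) ^ 3 * t0 \<le> M"
  obtains v \<kappa> where "continuous_on UNIV v" "0 \<le> \<kappa>" "\<And>t. L1_Linf (m ^ 12) (M * exp (\<kappa> * \<bar>t\<bar>)) (v t)"
    "\<And>t. v t = w0 + (LBINT \<tau>=ereal 0..ereal t. imult (mean_cubic (\<gamma> * \<tau>) (v \<tau>)))"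
    "\<And>t. \<bar>t\<bar> \<le> t0 \<Longrightarrow> L1_Linf (m ^ 12) (2 * M) (v t)"
proof -
  let ?N = "m ^ 12"
  have N: "0 \<le> ?N" "0 < ?N" using m by simp_all
  have M: "0 \<le> M" by (rule L1_Linf_nonneg [OF w0(1)])
  define r where "r = norm w0"
  have r: "0 < r" using w0(2) by (simp add: r_def)
  \<comment> \<open>The growth rate given by \<open>L1_Linf_mean_cubic\<close> on the ball of radius
    r.\<close>
  define \<kappa> where "\<kappa> = 8 * r\<^sup>2"
  have \<kappa>: "0 < \<kappa>" using r by (simp add: \<kappa>_def)
  define E where "E t = M * exp (\<kappa> * \<bar>t\<bar>)" for t
  \<comment> \<open>The factor 3 of \<open>mean_cubic_lipschitz\<close> times the 2 of
    \<open>radial_lipschitz\<close>; the square of E t then brings exp (2 \<kappa> |t|) into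
    L.\<close>
  define c where "c = 6 * ?N\<^sup>2 * M\<^sup>2"
  have c: "0 \<le> c" by (simp add: c_def)
  \<comment> \<open>Makes c / (2 \<kappa> \<beta>) at most 1/2 and is at least 1, so that W also
    dominates exp (\<kappa> |t|).\<close>
  define \<beta> where "\<beta> = c / \<kappa> + 1"
  have \<beta>: "1 \<le> \<beta>" using c \<kappa> by (simp add: \<beta>_def)
  define L where "L t = c * exp (2 * \<kappa> * \<bar>t\<bar>)" for t
  \<comment> \<open>The Lipschitz constant grows exponentially, so the weight grows doubly
    exponentially: then the integral of L W is again a multiple of W, up to a constant.\<close>
  define W where "W t = exp (\<beta> * exp (2 * \<kappa> * \<bar>t\<bar>))" for t
  \<comment> \<open>The short-time bound is built into the invariant set, so that no separate
    continuity argument in time is needed; the hypothesis on t0 is what makes it reproduce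
    itself.\<close>
  define S where "S t = {v. L1_Linf ?N (E t) v \<and> (\<bar>t\<bar> \<le> t0 \<longrightarrow> L1_Linf ?N (2 * M) v)}" for t
  define f where "f \<tau> v = imult (mean_cubic (\<gamma> * \<tau>) (radial r v))" for \<tau> v
  have E: "0 \<le> E t" for t using M by (simp add: E_def)
  have f_cont: "continuous_on UNIV (\<lambda>\<tau>. f \<tau> (v \<tau>))"
    if v: "continuous_on UNIV v" and vS: "\<And>t. v t \<in> S t" for v
    unfolding f_def
    by (intro continuous_on_compose2 [OF linear_continuous_on [OF bounded_linear_imult]]
        continuous_mean_cubic [OF continuous_radial [OF r v] L1_Linf_radial [OF r _ N(1)] N(1)])
       (use vS \<kappa> in \<open>auto simp: S_def E_def\<close>)
  have int_exp: "\<bar>LBINT x=ereal 0..ereal t. \<kappa> * E x\<bar> = E t - M" for t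
  proof -
    have "\<bar>LBINT x=ereal 0..ereal t. (\<lambda>y. \<kappa> * (M * exp (\<kappa> * y))) \<bar>x\<bar>\<bar> = \<bar>M * exp (\<kappa> * \<bar>t\<bar>) - M * exp (\<kappa> * 0)\<bar>"
      by (rule interval_integral_even) (auto intro!: derivative_eq_intros continuous_intros)
    also have "\<dots> = E t - M"
      using M \<kappa> by (simp add: E_def mult_le_cancel_left1)
    finally show ?thesis by (simp add: E_def)
  qed
  have "\<exists>v. continuous_on UNIV v \<and> (\<forall>t. v t \<in> S t) \<and> (\<forall>t. v t = w0 + (LBINT \<tau>=ereal 0..ereal t. f \<tau> (v \<tau>)))"
  proof (rule picard [of S f L w0 W "sqrt ?N * M"])
    show "closed (S t)" for t
      unfolding closed_sequential_limits S_def by (auto intro: L1_Linf_lim)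
    show "0 \<in> S t" for t
      using E M N(1) by (auto simp: S_def intro!: L1_Linf_0)
    show "continuous_on UNIV (\<lambda>\<tau>. f \<tau> (v \<tau>))" if "continuous_on UNIV v" "\<And>t. v t \<in> S t" for v
      using that by (rule f_cont)
    show "norm (f t x - f t y) \<le> L t * norm (x - y)" if "x \<in> S t" "y \<in> S t" for t x y
    proof -
      have "norm (f t x - f t y) = norm (mean_cubic (\<gamma> * t) (radial r x) - mean_cubic (\<gamma> * t) (radial r y))"
        by (simp add: f_def flip: linear_diff [OF bounded_linear.linear [OF bounded_linear_imult]])
      also have "\<dots> \<le> 3 * (?N * E t)\<^sup>2 * norm (radial r x - radial r y)"
        using that by (intro mean_cubic_lipschitz L1_Linf_radial r N) (auto simp: S_def)
      also have "\<dots> \<le> 3 * (?N * E t)\<^sup>2 * (2 * norm (x - y))"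
        by (intro mult_left_mono radial_lipschitz r) simp
      also have "\<dots> = L t * norm (x - y)"
      proof -
        have "exp (\<kappa> * \<bar>t\<bar>) ^ 2 = exp (2 * \<kappa> * \<bar>t\<bar>)"
          by (simp add: mult.assoc flip: exp_of_nat_mult)
        then show ?thesis
          by (simp add: L_def c_def E_def power_mult_distrib mult_ac)
      qed
      finally show ?thesis .
    qed
    show "w0 + (LBINT \<tau>=ereal 0..ereal t. f \<tau> (v \<tau>)) \<in> S t" if v: "continuous_on UNIV v" "\<And>t. v t \<in> S t" for v t
    proof -
      have "L1_Linf ?N (M + \<bar>LBINT x=ereal 0..ereal t. \<kappa> * E x\<bar>) (w0 + (LBINT \<tau>=ereal 0..ereal t. f \<tau> (v \<tau>)))"
      proof (rule L1_Linf_interval_integral [OF w0(1) f_cont [OF v] _ N(1)])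
        show "continuous_on UNIV (\<lambda>x. \<kappa> * E x)"
          unfolding E_def by (intro continuous_intros)
        fix x
        have b: "L1_Linf ?N (E x) (radial r (v x))"
          using v(2) [of x] by (intro L1_Linf_radial r N) (auto simp: S_def)
        have "8 * (norm (radial r (v x)))\<^sup>2 * E x \<le> \<kappa> * E x"
          unfolding \<kappa>_def using norm_radial [OF r, of "v x"] E by (intro mult_right_mono mult_left_mono power_mono) auto
        then show "L1_Linf ?N (\<kappa> * E x) (f x (v x))"
          unfolding f_def by (intro L1_Linf_imult L1_Linf_mono [OF L1_Linf_mean_cubic [OF b] _ N(1)])
      qed
      then have 1: "L1_Linf ?N (E t) (w0 + (LBINT \<tau>=ereal 0..ereal t. f \<tau> (v \<tau>)))"
        unfolding int_exp by simp
      have 2: "L1_Linf ?N (2 * M) (w0 + (LBINT \<tau>=ereal 0..ereal t. f \<tau> (v \<tau>)))" if t: "\<bar>t\<bar> \<le> t0"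
      proof -
        let ?C = "(25 * m)\<^sup>2 * (2 * M) ^ 3"
        have "L1_Linf ?N (M + \<bar>LBINT x=ereal 0..ereal t. ?C\<bar>) (w0 + (LBINT \<tau>=ereal 0..ereal t. f \<tau> (v \<tau>)))"
        proof (rule L1_Linf_interval_integral [OF w0(1) f_cont [OF v] _ N(1)])
          fix x assume "x \<in> closed_segment 0 t"
          then have "\<bar>x\<bar> \<le> t0"
            using t by (auto simp: closed_segment_eq_real_ivl split: if_splits)
          then have b: "L1_Linf ?N (2 * M) (radial r (v x))"
            using v(2) [of x] by (intro L1_Linf_radial r N) (auto simp: S_def)
          show "L1_Linf ?N ?C (f x (v x))"
            unfolding f_def by (intro L1_Linf_imult L1_Linf_mean_cubic_product b m)
        qed simp
        moreover have "M + \<bar>LBINT x=ereal 0..ereal t. ?C\<bar> \<le> 2 * M"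
        proof -
          have "\<bar>LBINT x=ereal 0..ereal t. ?C\<bar> = ?C * \<bar>t\<bar>"
            using M by (simp add: interval_integral_const_real abs_mult)
          also have "\<dots> \<le> ?C * t0"
            using t M by (intro mult_left_mono) auto
          finally show ?thesis using t0 by simp
        qed
        ultimately show ?thesis
          by (rule L1_Linf_mono [OF _ _ N(1)])
      qed
      show ?thesis using 1 2 by (simp add: S_def)
    qed
    show "continuous_on UNIV L" "continuous_on UNIV W"
      unfolding L_def W_def by (intro continuous_intros)+
    show "0 \<le> L t" "0 < W t" for t
      using c by (simp_all add: L_def W_def)
    show "\<bar>LBINT \<tau>=ereal 0..ereal t. L \<tau> * W \<tau>\<bar> \<le> W t / 2" for t
    proof -
      let ?F = "\<lambda>y. c / (2 * \<kappa> * \<beta>) * exp (\<beta> * exp (2 * \<kappa> * y))"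
      have "\<bar>LBINT x=ereal 0..ereal t. (\<lambda>y. c * exp (2 * \<kappa> * y) * exp (\<beta> * exp (2 * \<kappa> * y))) \<bar>x\<bar>\<bar> = \<bar>?F \<bar>t\<bar> - ?F 0\<bar>"
      proof (rule interval_integral_even)
        show "(?F has_real_derivative c * exp (2 * \<kappa> * y) * exp (\<beta> * exp (2 * \<kappa> * y))) (at y)" for y
          using \<kappa> \<beta> by (auto intro!: derivative_eq_intros)
      qed (intro continuous_intros)
      also have "\<dots> = c / (2 * \<kappa> * \<beta>) * \<bar>W \<bar>t\<bar> - W 0\<bar>"
      proof -
        have k: "0 \<le> c / (2 * \<kappa> * \<beta>)" using c \<kappa> \<beta> by simp
        have "?F \<bar>t\<bar> - ?F 0 = c / (2 * \<kappa> * \<beta>) * (W \<bar>t\<bar> - W 0)"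
          by (simp add: W_def right_diff_distrib)
        then show ?thesis by (simp only: abs_mult abs_of_nonneg [OF k])
      qed
      also have "\<dots> \<le> 1/2 * W t"
      proof (rule mult_mono)
        show "c / (2 * \<kappa> * \<beta>) \<le> 1/2"
        proof -
          have "2 * \<kappa> * \<beta> = 2 * (c + \<kappa>)"
            using \<kappa> by (simp add: \<beta>_def distrib_left)
          then have "c / (2 * \<kappa> * \<beta>) = c / (2 * (c + \<kappa>))" by (simp only:)
          also have "\<dots> \<le> 1/2" using c \<kappa> by (simp add: divide_simps)
          finally show ?thesis .
        qed
        have "W 0 \<le> W t" "0 \<le> W 0"
          using \<kappa> \<beta> by (auto simp: W_def)
        then show "\<bar>W \<bar>t\<bar> - W 0\<bar> \<le> W t"
          by (simp add: W_def)
      qed (use c \<kappa> \<beta> in auto)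
      finally show ?thesis by (simp add: L_def W_def mult.assoc)
    qed
    show "norm x \<le> sqrt ?N * M * W t" if "x \<in> S t" for t x
    proof -
      have "(norm x)\<^sup>2 \<le> ?N * (E t)\<^sup>2"
        using that by (intro norm_L1_Linf) (auto simp: S_def)
      also have "?N * (E t)\<^sup>2 = (sqrt ?N * E t)\<^sup>2"
        using N(1) by (simp only: power_mult_distrib real_sqrt_pow2)
      finally have 1: "norm x \<le> sqrt ?N * E t"
        by (rule power2_le_imp_le) (intro mult_nonneg_nonneg real_sqrt_ge_zero N(1) E)
      have "exp (\<kappa> * \<bar>t\<bar>) \<le> W t"
      proof -
        have "\<kappa> * \<bar>t\<bar> \<le> 1 + 2 * \<kappa> * \<bar>t\<bar>" using \<kappa> by simp
        also have "\<dots> \<le> exp (2 * \<kappa> * \<bar>t\<bar>)" by (rule exp_ge_add_one_self)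
        also have "\<dots> \<le> \<beta> * exp (2 * \<kappa> * \<bar>t\<bar>)" using \<beta> by simp
        finally show ?thesis by (simp add: W_def)
      qed
      then have "sqrt ?N * E t \<le> sqrt ?N * M * W t"
        unfolding E_def mult.assoc by (intro mult_left_mono M real_sqrt_ge_zero N(1))
      with 1 show ?thesis by (rule order_trans)
    qed
  qed blast
  then obtain v where v: "continuous_on UNIV v" "\<And>t. v t \<in> S t" "\<And>t. v t = w0 + (LBINT \<tau>=ereal 0..ereal t. f \<tau> (v \<tau>))"
    by blast
  note cont = f_cont [OF v(1,2)]
  \<comment> \<open>v(t) is a positive multiple of its cut-off, and the cut-off is orthogonal to i
    times its own nonlinearity; so the cut-off equation conserves mass as well.\<close>
  have deriv: "((\<lambda>t. v t \<bullet> v t) has_real_derivative 0) (at t)" for t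
  proof -
    have "((\<lambda>t. w0 + (LBINT \<tau>=ereal 0..ereal t. f \<tau> (v \<tau>))) has_vector_derivative 0 + f t (v t)) (at t)"
      by (intro has_vector_derivative_add has_vector_derivative_const interval_integral_has_vector_derivative cont)
    then have v': "(v has_vector_derivative f t (v t)) (at t)"
      by (simp flip: v(3))
    have "((\<lambda>t. v t \<bullet> v t) has_vector_derivative v t \<bullet> f t (v t) + f t (v t) \<bullet> v t) (at t)"
      by (rule bounded_bilinear.has_vector_derivative [OF bounded_bilinear_inner v' v'])
    moreover have "v t \<bullet> f t (v t) = 0"
    proof -
      let ?q = "max r (norm (v t)) / r"
      have q: "?q *\<^sub>R radial r (v t) = v t"
        using r by (simp add: radial_def max_def)
      have "L1_Linf ?N (E t) (radial r (v t))"
        using v(2) [of t] by (intro L1_Linf_radial r N) (auto simp: S_def)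
      then have "radial r (v t) \<bullet> f t (v t) = 0"
        unfolding f_def by (rule inner_imult_mean_cubic)
      then have "(?q *\<^sub>R radial r (v t)) \<bullet> f t (v t) = 0" by simp
      then show ?thesis unfolding q .
    qed
    ultimately show ?thesis
      by (simp add: has_real_derivative_iff_has_vector_derivative inner_commute)
  qed
  have "v t \<bullet> v t = v 0 \<bullet> v 0" for t
    by (rule DERIV_isconst_all [where f = "\<lambda>t. v t \<bullet> v t", rule_format]) (rule deriv)
  moreover have "v 0 = w0"
    using v(3) [of 0] by simp
  ultimately have "norm (v t) = r" for t
    by (simp add: norm_eq_sqrt_inner r_def)
  then have radial: "radial r (v t) = v t" for t
    using r by (simp add: radial_eq)
  show ?thesis
  proof (rule that [OF v(1) less_imp_le [OF \<kappa>]])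
    show "L1_Linf ?N (M * exp (\<kappa> * \<bar>t\<bar>)) (v t)" for t
      using v(2) [of t] by (simp add: S_def E_def)
    show "v t = w0 + (LBINT \<tau>=ereal 0..ereal t. imult (mean_cubic (\<gamma> * \<tau>) (v \<tau>)))" for t
      using v(3) [of t] by (simp add: f_def radial)
    show "L1_Linf ?N (2 * M) (v t)" if "\<bar>t\<bar> \<le> t0" for t
      using v(2) [of t] that by (simp add: S_def)
  qed
qed

text \<open>The dependence on t in the integrand sits in the bounded linear operator
  \<open>V t\<close>, which can be pulled out of both integrals. The propagators combine because
  \<gamma> (t - \<tau>) - \<sigma> = \<gamma> t - (\<sigma> + \<gamma> \<tau>).\<close>

lemma GT_solution_interaction:
  assumes v: "continuous_on UNIV v" and L1_Linf: "\<And>t. L1_Linf N (M * exp (\<kappa> * \<bar>t\<bar>)) (v t)" and "0 \<le> N" "0 \<le> \<kappa>"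
    and eq: "\<And>t. v t = w0 + (LBINT \<tau>=ereal 0..ereal t. imult (mean_cubic (\<gamma> * \<tau>) (v \<tau>)))"
  shows "GT_solution \<gamma> (inv fourier w0) (\<lambda>t. inv fourier (propagator (\<gamma> * t) (v t)))"
proof -
  let ?u = "\<lambda>t. inv fourier (propagator (\<gamma> * t) (v t))"
  define V where "V t = (\<lambda>w. inv fourier (propagator (\<gamma> * t) w))" for t
  have V: "bounded_linear (V t)" for t
    unfolding V_def by (rule bounded_linear_compose [OF bounded_linear_inv_fourier bounded_linear_propagator])
  have Gcont: "continuous_on UNIV (\<lambda>\<tau>. mean_cubic (\<gamma> * \<tau>) (v \<tau>))"
    by (rule continuous_mean_cubic [OF v L1_Linf assms(3,4)])
  have "continuous_on UNIV (\<lambda>t. propagator (\<gamma> * t) (v t))"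
    unfolding continuous_on_sequentially comp_def
    using v by (auto simp: continuous_on_sequentially comp_def intro!: propagator_tendsto tendsto_intros)
  then have 1: "continuous_on UNIV ?u"
    by (rule continuous_on_compose2 [OF linear_continuous_on [OF bounded_linear_inv_fourier]]) auto
  have sch: "schroedinger \<sigma> (?u \<tau>) = inv fourier (propagator (\<sigma> + \<gamma> * \<tau>) (v \<tau>))" for \<sigma> \<tau>
    by (simp add: schroedinger_eq)
  have 2: "square_integrable (cubic (rep_L2 (schroedinger \<sigma> (?u \<tau>))))" for \<sigma> \<tau>
  proof -
    obtain a where "bounded_L1 (M * exp (\<kappa> * \<bar>\<tau>\<bar>)) a" "propagator (\<sigma> + \<gamma> * \<tau>) (v \<tau>) = L2_of a"
      using L1_LinfE [OF L1_Linf_propagator [OF L1_Linf]] by metis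
    then show ?thesis
      using cubic_hat_bounded_L1(2) by (simp add: sch)
  qed
  have integrand: "GT_integrand \<gamma> ?u t \<tau> \<sigma> = V t (dressed_cubic (\<sigma> + \<gamma> * \<tau>) (v \<tau>))" for t \<tau> \<sigma>
  proof -
    have "GT_integrand \<gamma> ?u t \<tau> \<sigma> = inv fourier (propagator (\<gamma> * (t - \<tau>) - \<sigma>) (cubic_hat (propagator (\<sigma> + \<gamma> * \<tau>) (v \<tau>))))"
      unfolding GT_integrand_def sch by (simp add: schroedinger_eq cubic_hat_def)
    moreover have "\<gamma> * (t - \<tau>) - \<sigma> = \<gamma> * t + - (\<sigma> + \<gamma> * \<tau>)"
      by (simp add: algebra_simps)
    ultimately show ?thesis
      by (simp only: V_def dressed_cubic_def propagator_propagator)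
  qed
  have 3: "interval_lebesgue_integrable lborel 0 1 (GT_integrand \<gamma> ?u t \<tau>)"
    and inner: "(LBINT \<sigma>=0..1. GT_integrand \<gamma> ?u t \<tau> \<sigma>) = V t (mean_cubic (\<gamma> * \<tau>) (v \<tau>))" for t \<tau>
    using interval_integral_bounded_linear [OF V dressed_cubic_integrable [OF L1_Linf, of "\<gamma> * \<tau>"], of t \<tau>]
    by (simp_all add: integrand [abs_def] mean_cubic_def)
  have Gint: "interval_lebesgue_integrable lborel (ereal 0) (ereal t) (\<lambda>\<tau>. mean_cubic (\<gamma> * \<tau>) (v \<tau>))" for t
    by (rule interval_integrable_continuous [OF Gcont])
  have 4: "interval_lebesgue_integrable lborel 0 (ereal t) (\<lambda>\<tau>. LBINT \<sigma>=0..1. GT_integrand \<gamma> ?u t \<tau> \<sigma>)" for t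
    using interval_integral_bounded_linear(2) [OF V Gint] unfolding inner by (simp only: zero_ereal_def)
  have 5: "?u t = schroedinger (\<gamma> * t) (inv fourier w0)
      + mult_L2 (\<lambda>x. \<i>) (LBINT \<tau>=0..ereal t. (LBINT \<sigma>=0..1. GT_integrand \<gamma> ?u t \<tau> \<sigma>))" for t
  proof -
    have "(LBINT \<tau>=0..ereal t. (LBINT \<sigma>=0..1. GT_integrand \<gamma> ?u t \<tau> \<sigma>)) = V t (LBINT \<tau>=ereal 0..ereal t. mean_cubic (\<gamma> * \<tau>) (v \<tau>))"
      using interval_integral_bounded_linear(1) [OF V Gint] unfolding inner by (simp only: zero_ereal_def)
    moreover have "(LBINT \<tau>=ereal 0..ereal t. imult (mean_cubic (\<gamma> * \<tau>) (v \<tau>))) = imult (LBINT \<tau>=ereal 0..ereal t. mean_cubic (\<gamma> * \<tau>) (v \<tau>))"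
      by (rule interval_integral_bounded_linear(1) [OF bounded_linear_imult Gint])
    moreover have "imult (V t w) = V t (imult w)" for w
      unfolding V_def using fourier_imult [of "inv fourier (propagator (\<gamma> * t) w)"]
      by (metis fourier_inv_fourier inv_fourier_fourier propagator_imult)
    ultimately show ?thesis
      unfolding imult_def [symmetric]
      by (subst eq) (simp add: schroedinger_eq V_def bounded_linear.linear [OF bounded_linear_propagator] bounded_linear.linear [OF bounded_linear_inv_fourier] linear_add)
  qed
  show ?thesis
    unfolding GT_solution_def using 1 2 3 4 5 by blast
qed

section \<open>Norm inflation\<close>

text \<open>The propagator is a multiplier of modulus 1, so the H^s norm of u(t) can be read off
  from the interaction variable.\<close>

lemma Hs_norm_inv_fourier_propagator:
  "Hs_norm s (inv fourier (propagator t w)) = sqrt (LBINT \<xi>. (1 + \<bar>\<xi>\<bar>\<^sup>2) powr s * (cmod (rep_L2 w \<xi>))\<^sup>2)"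
proof -
  have w: "w = L2_of (rep_L2 w)" by simp
  have sq: "square_integrable (\<lambda>\<xi>. cis (- (t * \<xi>\<^sup>2)) * rep_L2 w \<xi>)"
    by (intro square_integrable_cis_mult square_integrable_rep_L2) simp
  have "propagator t w = L2_of (\<lambda>\<xi>. cis (- (t * \<xi>\<^sup>2)) * rep_L2 w \<xi>)"
    by (subst w) (rule propagator_L2_of [OF square_integrable_rep_L2])
  then have "AE \<xi> in lborel. rep_L2 (propagator t w) \<xi> = cis (- (t * \<xi>\<^sup>2)) * rep_L2 w \<xi>"
    using AE_rep_L2_of [OF sq] by simp
  then have "AE \<xi> in lborel. (1 + \<bar>\<xi>\<bar>\<^sup>2) powr s * (cmod (rep_L2 (propagator t w) \<xi>))\<^sup>2
      = (1 + \<bar>\<xi>\<bar>\<^sup>2) powr s * (cmod (rep_L2 w \<xi>))\<^sup>2"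
    by eventually_elim (simp add: norm_mult)
  then have "(LBINT \<xi>. (1 + \<bar>\<xi>\<bar>\<^sup>2) powr s * (cmod (rep_L2 (propagator t w) \<xi>))\<^sup>2)
      = (LBINT \<xi>. (1 + \<bar>\<xi>\<bar>\<^sup>2) powr s * (cmod (rep_L2 w \<xi>))\<^sup>2)"
    by (intro integral_cong_AE) measurable
  then show ?thesis
    by (simp add: Hs_norm_def)
qed

text \<open>The vector that detects low frequencies. The factor 1 fits the pattern
  \<open>s * indicator {0..1} x\<close>, of which the case s = - i occurs as well.\<close>

abbreviation low_mode :: L2 where
  "low_mode \<equiv> L2_of (\<lambda>x. 1 * indicator {0..1} x)"

lemma square_integrable_low_mode: "square_integrable (\<lambda>x. s * indicator {0..1} x)"
  and integrable_low_mode: "integrable lborel (\<lambda>x. s * indicator {0..1::real} x :: complex)"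
  and integral_low_mode: "(LBINT x. cmod (s * indicator {0..1::real} x)) = cmod s"
proof -
  show "square_integrable (\<lambda>x. s * indicator {0..1} x)"
    by (rule square_integrable_indicator [of _ 0 1]) auto
  show "integrable lborel (\<lambda>x. s * indicator {0..1::real} x :: complex)"
    by (rule integrable_indicator_bounded [of _ 0 1]) auto
  have "(LBINT x. cmod (s * indicator {0..1::real} x)) = (LBINT x. cmod s * indicator {0..1::real} x)"
    by (rule Bochner_Integration.integral_cong [OF refl]) (auto simp: indicator_def norm_mult)
  then show "(LBINT x. cmod (s * indicator {0..1::real} x)) = cmod s"
    by simp
qed

text \<open>On [0, 1] the weight is at least 2^s because s \<le> 0, and by Cauchy-Schwarz the
  pairing is at most the L^2 norm over [0, 1].\<close>

lemma Hs_norm_lower: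
  assumes s: "s \<le> 0"
  shows "sqrt (2 powr s) * \<bar>w \<bullet> low_mode\<bar> \<le> Hs_norm s (inv fourier (propagator t w))"
proof -
  define b where "b = rep_L2 w"
  have b: "square_integrable b" "w = L2_of b" and [measurable]: "b \<in> borel_measurable borel"
    using square_integrable_measurable [of b] by (simp_all add: b_def)
  define b1 where "b1 x = indicator {0..1} x *\<^sub>R b x" for x :: real
  have b1: "square_integrable b1"
    unfolding b1_def by (rule square_integrable_dominated [OF _ b(1)]) (auto simp: indicator_def)
  have "\<bar>w \<bullet> low_mode\<bar> = \<bar>L2_of b1 \<bullet> low_mode\<bar>"
    unfolding b(2) inner_L2_of [OF b(1) square_integrable_low_mode] inner_L2_of [OF b1 square_integrable_low_mode]
    by (rule arg_cong [where f = abs], rule Bochner_Integration.integral_cong [OF refl])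
       (simp add: b1_def indicator_def)
  also have "\<dots> \<le> norm (L2_of b1) * norm low_mode"
    by (rule Cauchy_Schwarz_ineq2)
  also have "norm low_mode = 1"
  proof -
    have "(LBINT x. (cmod (1 * indicator {0..1::real} x))\<^sup>2) = (LBINT x. indicator {0..1::real} x)"
      by (rule Bochner_Integration.integral_cong [OF refl]) (auto simp: indicator_def)
    then show ?thesis
      unfolding norm_L2_of [OF square_integrable_low_mode] by simp
  qed
  finally have le: "\<bar>w \<bullet> low_mode\<bar> \<le> norm (L2_of b1)" by simp
  have "sqrt (2 powr s) * norm (L2_of b1) = sqrt (LBINT x. 2 powr s * (cmod (b1 x))\<^sup>2)"
    by (simp add: norm_L2_of [OF b1] real_sqrt_mult)
  also have "\<dots> \<le> sqrt (LBINT \<xi>. (1 + \<bar>\<xi>\<bar>\<^sup>2) powr s * (cmod (b \<xi>))\<^sup>2)"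
  proof (intro real_sqrt_le_mono integral_mono)
    show "integrable lborel (\<lambda>x. 2 powr s * (cmod (b1 x))\<^sup>2)"
      using b1 by (simp add: square_integrable_def)
    show "integrable lborel (\<lambda>\<xi>. (1 + \<bar>\<xi>\<bar>\<^sup>2) powr s * (cmod (b \<xi>))\<^sup>2)"
    proof (rule Bochner_Integration.integrable_bound)
      show "integrable lborel (\<lambda>x. (cmod (b x))\<^sup>2)"
        using b(1) by (simp add: square_integrable_def)
      have "(1 + \<bar>\<xi>\<bar>\<^sup>2) powr s \<le> 1" for \<xi> :: real
        using powr_mono [of s 0 "1 + \<bar>\<xi>\<bar>\<^sup>2"] s by (simp add: add_nonneg_eq_0_iff)
      then show "AE \<xi> in lborel. norm ((1 + \<bar>\<xi>\<bar>\<^sup>2) powr s * (cmod (b \<xi>))\<^sup>2) \<le> norm ((cmod (b \<xi>))\<^sup>2)"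
        by (intro AE_I2) (simp add: mult_left_le_one_le)
    qed measurable
    show "2 powr s * (cmod (b1 \<xi>))\<^sup>2 \<le> (1 + \<bar>\<xi>\<bar>\<^sup>2) powr s * (cmod (b \<xi>))\<^sup>2" for \<xi>
    proof (cases "\<xi> \<in> {0..1}")
      case True
      then have "\<xi>\<^sup>2 \<le> 1" by (simp add: power_le_one)
      then have "2 powr s \<le> (1 + \<bar>\<xi>\<bar>\<^sup>2) powr s"
        using s by (intro powr_mono2') (auto simp: add_pos_nonneg)
      with True show ?thesis
        by (simp add: b1_def mult_right_mono)
    qed (simp add: b1_def)
  qed
  also have "\<dots> = Hs_norm s (inv fourier (propagator t w))"
    unfolding Hs_norm_inv_fourier_propagator b_def ..
  finally have "sqrt (2 powr s) * norm (L2_of b1) \<le> Hs_norm s (inv fourier (propagator t w))" .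
  from order_trans [OF mult_left_mono [OF le real_sqrt_ge_zero] this] show ?thesis
    by simp
qed

text \<open>The data on the Fourier side. In [N, 4 N] there is room for \<xi>1 and \<xi>3 in
  [N + \<xi>, 3/2 N + \<xi>] with \<xi>2 = \<xi>1 + \<xi>3 - \<xi> in the interval again, if \<xi>
  lies in [0, 1] and N \<ge> 2.\<close>

definition bump :: "real \<Rightarrow> real \<Rightarrow> real \<Rightarrow> complex" where
  "bump N R x = of_real R * indicator {N..4 * N} x"

lemma bounded_L1_bump:
  assumes "0 \<le> R"
  shows "bounded_L1 R (bump N R)"
  unfolding bounded_L1_def
proof
  show "integrable lborel (bump N R)"
    unfolding bump_def by (rule integrable_indicator_bounded [of _ N "4 * N"]) auto
  show "\<forall>x. cmod (bump N R x) \<le> R"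
    using assms by (simp add: bump_def indicator_def)
qed

lemma integral_bump: "0 \<le> R \<Longrightarrow> 0 \<le> N \<Longrightarrow> (LBINT x. cmod (bump N R x)) = 3 * N * R"
proof -
  assume "0 \<le> R" "0 \<le> N"
  then have "(LBINT x. cmod (bump N R x)) = (LBINT x. R * indicator {N..4 * N} x)"
    by (intro Bochner_Integration.integral_cong [OF refl]) (auto simp: indicator_def bump_def)
  then show ?thesis using \<open>0 \<le> N\<close> by simp
qed

lemma norm_bump:
  assumes "0 \<le> R" "0 \<le> N"
  shows "(norm (L2_of (bump N R)))\<^sup>2 = 3 * N * R\<^sup>2"
proof -
  have "(LBINT x. (cmod (bump N R x))\<^sup>2) = (LBINT x. R\<^sup>2 * indicator {N..4 * N} x)"
    by (intro Bochner_Integration.integral_cong [OF refl]) (auto simp: indicator_def bump_def)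
  then show ?thesis
    using assms by (simp add: norm_L2_of [OF bounded_L1D(4) [OF bounded_L1_bump]])
qed

text \<open>Here the exponent -3/2 enters: on the support the weight is at most (N^2)^(-3/2) =
  N^(-3), and the interval has length 3 N. So the squared norm is at most 3 R^2 / N^2, where 3 is
  rounded up to a square.\<close>

lemma Hs_norm_bump:
  assumes s: "s < - 3/2" and "0 \<le> R" "1 \<le> N"
  shows "Hs_norm s (inv fourier (L2_of (bump N R))) \<le> 2 * R / N"
proof -
  let ?a = "bump N R"
  note a = bounded_L1D [OF bounded_L1_bump [OF \<open>0 \<le> R\<close>, of N]]
  have "Hs_norm s (inv fourier (L2_of ?a)) = sqrt (LBINT \<xi>. (1 + \<bar>\<xi>\<bar>\<^sup>2) powr s * (cmod (rep_L2 (L2_of ?a) \<xi>))\<^sup>2)"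
    using Hs_norm_inv_fourier_propagator [of s 0 "L2_of ?a"] by simp
  also have "(LBINT \<xi>. (1 + \<bar>\<xi>\<bar>\<^sup>2) powr s * (cmod (rep_L2 (L2_of ?a) \<xi>))\<^sup>2)
      = (LBINT \<xi>. (1 + \<bar>\<xi>\<bar>\<^sup>2) powr s * (cmod (?a \<xi>))\<^sup>2)"
  proof (rule integral_cong_AE)
    note [measurable] = a(3)
    show "(\<lambda>\<xi>. (1 + \<bar>\<xi>\<bar>\<^sup>2) powr s * (cmod (rep_L2 (L2_of ?a) \<xi>))\<^sup>2) \<in> borel_measurable lborel"
      "(\<lambda>\<xi>. (1 + \<bar>\<xi>\<bar>\<^sup>2) powr s * (cmod (?a \<xi>))\<^sup>2) \<in> borel_measurable lborel"
      by measurable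
    show "AE \<xi> in lborel. (1 + \<bar>\<xi>\<bar>\<^sup>2) powr s * (cmod (rep_L2 (L2_of ?a) \<xi>))\<^sup>2 = (1 + \<bar>\<xi>\<bar>\<^sup>2) powr s * (cmod (?a \<xi>))\<^sup>2"
      using AE_rep_L2_of [OF a(4)] by eventually_elim simp
  qed
  also have "sqrt \<dots> \<le> sqrt (4 * R\<^sup>2 / N\<^sup>2)"
  proof (rule real_sqrt_le_mono)
    have le: "(1 + \<bar>\<xi>\<bar>\<^sup>2) powr s * (cmod (?a \<xi>))\<^sup>2 \<le> inverse (N ^ 3) * R\<^sup>2 * indicator {N..4 * N} \<xi>" for \<xi>
    proof (cases "\<xi> \<in> {N..4 * N}")
      case True
      then have "N\<^sup>2 \<le> \<bar>\<xi>\<bar>\<^sup>2"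
        using \<open>1 \<le> N\<close> by (intro power_mono) auto
      then have "N\<^sup>2 \<le> 1 + \<bar>\<xi>\<bar>\<^sup>2" by simp
      moreover have "1 \<le> N\<^sup>2" using \<open>1 \<le> N\<close> by simp
      ultimately have "(1 + \<bar>\<xi>\<bar>\<^sup>2) powr s \<le> (N\<^sup>2) powr s"
        using s by (intro powr_mono2') auto
      also have "\<dots> \<le> (N\<^sup>2) powr (- 3/2)"
        using s \<open>1 \<le> N\<^sup>2\<close> by (intro powr_mono) auto
      also have "\<dots> = inverse (N ^ 3)"
      proof -
        have "N\<^sup>2 = N powr 2" using \<open>1 \<le> N\<close> by simp
        then have "(N\<^sup>2) powr (- 3/2) = N powr (- 3)"
          by (simp only: powr_powr) simp
        also have "\<dots> = inverse (N powr 3)" by (rule powr_minus)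
        finally show ?thesis using \<open>1 \<le> N\<close> by simp
      qed
      finally have "(1 + \<bar>\<xi>\<bar>\<^sup>2) powr s * R\<^sup>2 \<le> inverse (N ^ 3) * R\<^sup>2"
        by (rule mult_right_mono) simp
      with True show ?thesis
        by (simp add: bump_def)
    qed (simp add: bump_def)
    have int: "integrable lborel (\<lambda>\<xi>. inverse (N ^ 3) * R\<^sup>2 * indicat_real {N..4 * N} \<xi>)"
      by (intro integrable_mult_right integrable_indicator_bounded [of _ N "4 * N"]) auto
    have "(LBINT \<xi>. (1 + \<bar>\<xi>\<bar>\<^sup>2) powr s * (cmod (?a \<xi>))\<^sup>2) \<le> (LBINT \<xi>. inverse (N ^ 3) * R\<^sup>2 * indicator {N..4 * N} \<xi>)"
    proof (rule integral_mono [OF _ int le])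
      note [measurable] = a(3)
      show "integrable lborel (\<lambda>\<xi>. (1 + \<bar>\<xi>\<bar>\<^sup>2) powr s * (cmod (?a \<xi>))\<^sup>2)"
      proof (rule Bochner_Integration.integrable_bound [OF int])
        have "0 \<le> N" using \<open>1 \<le> N\<close> by simp
        then show "AE \<xi> in lborel. norm ((1 + \<bar>\<xi>\<bar>\<^sup>2) powr s * (cmod (?a \<xi>))\<^sup>2)
            \<le> norm (inverse (N ^ 3) * R\<^sup>2 * indicat_real {N..4 * N} \<xi>)"
          using le by (intro AE_I2) (simp add: abs_mult)
      qed measurable
    qed
    also have "\<dots> = 3 * R\<^sup>2 / N\<^sup>2"
      using \<open>1 \<le> N\<close> by (simp add: field_simps power2_eq_square power3_eq_cube)
    also have "\<dots> \<le> 4 * R\<^sup>2 / N\<^sup>2"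
      by (intro divide_right_mono mult_right_mono) auto
    finally show "(LBINT \<xi>. (1 + \<bar>\<xi>\<bar>\<^sup>2) powr s * (cmod (?a \<xi>))\<^sup>2) \<le> 4 * R\<^sup>2 / N\<^sup>2" .
  qed
  also have "sqrt (4 * R\<^sup>2 / N\<^sup>2) = 2 * R / N"
    using assms by (simp add: real_sqrt_divide real_sqrt_mult)
  finally show ?thesis .
qed

text \<open>The inverse transform of a function with bounded support can be differentiated under the
  integral sign any number of times; \<open>D n\<close> is the n-th derivative.\<close>

lemma smooth_bump:
  assumes "0 \<le> R"
  shows "smooth_L2 (inv fourier (L2_of (bump N R)))"
proof -
  let ?a = "bump N R"
  note bounded_L1 = bounded_L1_bump [OF assms, of N]
  define c where "c = complex_of_real (R / sqrt (2 * pi))"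
  define D where "D n x = c * integral {N..4 * N} (\<lambda>\<xi>. (\<i> * of_real \<xi>) ^ n * cis (\<xi> * x))" for n x
  have cont: "continuous_on S (\<lambda>\<xi>. (\<i> * complex_of_real \<xi>) ^ n * cis (\<xi> * x))" for S n x
    by (intro continuous_intros)
  have D_deriv: "(D n has_vector_derivative D (Suc n) x) (at x)" for n x
  proof -
    have "((\<lambda>x. integral (cbox N (4 * N)) (\<lambda>\<xi>. (\<i> * complex_of_real \<xi>) ^ n * cis (\<xi> * x))) has_vector_derivative
        integral (cbox N (4 * N)) (\<lambda>\<xi>. (\<i> * complex_of_real \<xi>) ^ Suc n * cis (\<xi> * x))) (at x within UNIV)"
    proof (rule leibniz_rule_vector_derivative)
      fix x \<xi> :: real
      have "((\<lambda>z. (\<i> * complex_of_real \<xi>) ^ n * exp (\<i> * (of_real \<xi> * z))) has_field_derivative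
          (\<i> * complex_of_real \<xi>) ^ Suc n * exp (\<i> * (of_real \<xi> * of_real x))) (at (of_real x))"
        by (auto intro!: derivative_eq_intros)
      from has_vector_derivative_real_field [OF this]
      show "((\<lambda>x. (\<i> * complex_of_real \<xi>) ^ n * cis (\<xi> * x)) has_vector_derivative
          (\<i> * complex_of_real \<xi>) ^ Suc n * cis (\<xi> * x)) (at x within UNIV)"
        by (simp add: cis_conv_exp)
    next
      show "(\<lambda>\<xi>. (\<i> * complex_of_real \<xi>) ^ n * cis (\<xi> * x)) integrable_on cbox N (4 * N)" for x
        by (intro integrable_continuous cont)
      show "continuous_on (UNIV \<times> cbox N (4 * N)) (\<lambda>(x, \<xi>). (\<i> * complex_of_real \<xi>) ^ Suc n * cis (\<xi> * x))"
        unfolding split_beta' by (intro continuous_intros)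
    qed auto
    then have "((\<lambda>x. c * integral {N..4 * N} (\<lambda>\<xi>. (\<i> * complex_of_real \<xi>) ^ n * cis (\<xi> * x))) has_vector_derivative
        c * integral {N..4 * N} (\<lambda>\<xi>. (\<i> * complex_of_real \<xi>) ^ Suc n * cis (\<xi> * x))) (at x)"
      by (intro has_vector_derivative_mult_right) simp
    then show ?thesis by (simp only: D_def [abs_def])
  qed
  have "ft ?a (- x) = D 0 x" for x
  proof -
    have int: "set_integrable lborel {N..4 * N} (\<lambda>\<xi>. cis (\<xi> * x))"
      by (intro borel_integrable_atLeastAtMost' continuous_intros)
    have "ft ?a (- x) = (LBINT \<xi>. of_real R * (indicator {N..4 * N} \<xi> *\<^sub>R cis (\<xi> * x))) / of_real (sqrt (2 * pi))"
      unfolding ft_def by (intro arg_cong2 [where f = "(/)"] Bochner_Integration.integral_cong refl)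
        (auto simp: bump_def indicator_def)
    also have "\<dots> = c * (LBINT \<xi>:{N..4 * N}. cis (\<xi> * x))"
      unfolding integral_mult_right_zero c_def set_lebesgue_integral_def by simp
    also have "(LBINT \<xi>:{N..4 * N}. cis (\<xi> * x)) = integral {N..4 * N} (\<lambda>\<xi>. cis (\<xi> * x))"
      by (rule set_borel_integral_eq_integral(2) [OF int])
    finally show ?thesis by (simp add: D_def)
  qed
  then have "D 0 = (\<lambda>x. ft ?a (- x))" by (simp add: fun_eq_iff)
  then have "smooth_function (\<lambda>x. ft ?a (- x))"
    unfolding smooth_function_def using D_deriv by blast
  then show ?thesis
    unfolding smooth_L2_def using inv_fourier_bounded_L1(1,2) [OF bounded_L1] by blast
qed

section \<open>Lower bound for the first iterate at low frequencies\<close>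

lemma cos_ge_half:
  fixes e :: real
  assumes "\<bar>e\<bar> \<le> 1"
  shows "1/2 \<le> cos e"
proof -
  have "\<bar>sin (e / 2)\<bar> \<le> 1/2"
    using abs_sin_x_le_abs_x [of "e / 2"] assms by linarith
  then have "(sin (e / 2))\<^sup>2 \<le> (1/2)\<^sup>2"
    by (subst abs_le_square_iff [symmetric]) simp
  moreover have "cos e = 1 - 2 * (sin (e / 2))\<^sup>2"
    using cos_double_sin [of "e / 2"] by simp
  ultimately show ?thesis by (simp add: power2_eq_square)
qed

text \<open>With \<Phi> = 2 p q and e = \<theta> \<Phi> the imaginary part is (cos e - cos (\<Phi> +
  e)) / \<Phi>. The numerator equals cos e (1 - cos \<Phi>) + sin \<Phi> sin e; as |e| \<le> 1 the
  first term keeps at least half of 1 - cos \<Phi>, and the second loses at most |e|, which is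
  |\<theta>| after division by \<Phi>.\<close>

lemma Im_mean_phase_lower:
  assumes "0 < p" "0 < q" and \<theta>: "\<bar>\<theta>\<bar> * (2 * p * q) \<le> 1"
  shows "(1 - cos (2 * p * q)) / (2 * (2 * p * q)) - \<bar>\<theta>\<bar> \<le> Im (mean_phase \<theta> p q)"
proof -
  define \<Phi> where "\<Phi> = 2 * p * q"
  have \<Phi>: "0 < \<Phi>" using assms by (simp add: \<Phi>_def)
  define e where "e = \<theta> * \<Phi>"
  have e: "\<bar>e\<bar> \<le> 1" "\<bar>e\<bar> = \<bar>\<theta>\<bar> * \<Phi>"
    using \<theta> \<Phi> by (simp_all add: e_def abs_mult flip: \<Phi>_def)
  have "p * q \<noteq> 0" using assms by simp
  then have "mean_phase \<theta> p q = (cis (\<Phi> + e) - cis e) / (\<i> * of_real \<Phi>)"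
    unfolding mean_phase_eq [OF \<open>p * q \<noteq> 0\<close>] by (simp add: \<Phi>_def e_def algebra_simps)
  also have "\<dots> = - \<i> * (cis (\<Phi> + e) - cis e) / of_real \<Phi>"
    using \<Phi> by (simp add: field_simps)
  finally have "Im (mean_phase \<theta> p q) = Im (- \<i> * (cis (\<Phi> + e) - cis e) / of_real \<Phi>)" by (rule arg_cong)
  also have "\<dots> = (cos e - cos (\<Phi> + e)) / \<Phi>"
    by (simp only: Im_divide_of_real) simp
  finally have Im: "Im (mean_phase \<theta> p q) = (cos e - cos (\<Phi> + e)) / \<Phi>" .
  have "\<bar>sin \<Phi> * sin e\<bar> \<le> 1 * \<bar>e\<bar>"
    unfolding abs_mult by (intro mult_mono abs_sin_x_le_abs_x) auto
  moreover have "1/2 * (1 - cos \<Phi>) \<le> cos e * (1 - cos \<Phi>)"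
    by (intro mult_right_mono cos_ge_half e) simp
  ultimately have "(1 - cos \<Phi>) / 2 - \<bar>e\<bar> \<le> cos e - cos (\<Phi> + e)"
    by (simp add: cos_add algebra_simps)
  then have "((1 - cos \<Phi>) / 2 - \<bar>e\<bar>) / \<Phi> \<le> Im (mean_phase \<theta> p q)"
    unfolding Im using \<Phi> by (intro divide_right_mono) auto
  also have "((1 - cos \<Phi>) / 2 - \<bar>e\<bar>) / \<Phi> = (1 - cos \<Phi>) / (2 * \<Phi>) - \<bar>\<theta>\<bar>"
    using \<Phi> by (simp add: e(2) diff_divide_distrib)
  finally show ?thesis by (simp add: \<Phi>_def)
qed

text \<open>The numerator 1 - cos (2 p q) of the averaged phase on the square where p and q lie in
  [N, 3/2 N]. The factors are grouped for integrating the second variable first.\<close>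

definition oscillation :: "real \<Rightarrow> real \<Rightarrow> real \<times> real \<Rightarrow> real" where
  "oscillation N \<xi> z = indicator {N + \<xi>..3/2 * N + \<xi>} (fst z) *
     ((1 - cos (2 * (fst z - \<xi>) * (snd z - \<xi>))) * indicator {N + \<xi>..3/2 * N + \<xi>} (snd z))"

lemma integrable_indicator_pair:
  "integrable lborel2 (\<lambda>z. indicat_real {a..b} (fst z) * indicat_real {c..d} (snd z))"
proof -
  have "integrable lborel2 (\<lambda>(x, y). indicat_real {a..b} x * indicat_real {c..d} y)"
    by (intro integrable_mult_pair lborel.sigma_finite_measure_axioms integrable_indicator_bounded [of _ a b] integrable_indicator_bounded [of _ c d]) auto
  then show ?thesis by (simp add: split_beta')
qed

lemma integrable_oscillation: "integrable lborel2 (oscillation N \<xi>)"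
proof (rule Bochner_Integration.integrable_bound)
  let ?I = "indicat_real {N + \<xi>..3/2 * N + \<xi>}"
  show "integrable lborel2 (\<lambda>z. 2 * (?I (fst z) * ?I (snd z)))"
    by (intro integrable_mult_right integrable_indicator_pair)
  show "oscillation N \<xi> \<in> borel_measurable lborel2"
    unfolding oscillation_def [abs_def] by measurable
  have "\<bar>1 - cos x\<bar> \<le> 2" for x :: real
    using cos_ge_minus_one [of x] cos_le_one [of x] by linarith
  then show "AE z in lborel2. norm (oscillation N \<xi> z) \<le> norm (2 * (?I (fst z) * ?I (snd z)))"
    by (intro AE_I2) (simp add: oscillation_def indicator_def)
qed

text \<open>For fixed p \<ge> N the cosine contributes at most 1/N after integration in q, so the
  integral is close to the area N^2/4 of the square; N \<ge> 2 turns N^2/4 - 1/2 into at least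
  N^2/8.\<close>

lemma integral_oscillation:
  assumes N: "2 \<le> N"
  shows "N\<^sup>2 / 8 \<le> (LINT z|lborel2. oscillation N \<xi> z)"
proof -
  let ?a = "N + \<xi>" and ?b = "3/2 * N + \<xi>"
  have inner: "indicator {?a..?b} x * (N / 2 - 1 / N) \<le> (LBINT y. oscillation N \<xi> (x, y))" for x
  proof (cases "x \<in> {?a..?b}")
    case True
    define p where "p = x - \<xi>"
    have p: "N \<le> p" "0 < p" using True N by (auto simp: p_def)
    let ?F = "\<lambda>y. y - sin (2 * p * (y - \<xi>)) / (2 * p)"
    have "(LBINT y. oscillation N \<xi> (x, y)) = (LBINT y. (1 - cos (2 * p * (y - \<xi>))) * indicator {?a..?b} y)"
      using True by (simp add: oscillation_def p_def)
    also have "\<dots> = ?F ?b - ?F ?a"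
    proof (rule integral_FTC_Icc_real)
      show "(?F has_real_derivative 1 - cos (2 * p * (y - \<xi>))) (at y)" for y
        using p by (auto intro!: derivative_eq_intros)
      show "isCont (\<lambda>y. 1 - cos (2 * p * (y - \<xi>))) y" for y
        by (intro continuous_intros)
    qed (use N in simp)
    also have "\<dots> \<ge> N / 2 - 1 / N"
    proof -
      have "(sin (2 * p * (?b - \<xi>)) - sin (2 * p * (?a - \<xi>))) / (2 * p) \<le> 2 / (2 * p)"
        using p sin_le_one [of "2 * p * (?b - \<xi>)"] sin_ge_minus_one [of "2 * p * (?a - \<xi>)"]
        by (intro divide_right_mono) linarith+
      also have "\<dots> \<le> 1 / N"
        using p N by (simp add: frac_le)
      finally show ?thesis by (simp add: diff_divide_distrib)
    qed
    finally show ?thesis using True by simp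
  next
    case False
    then show ?thesis by (simp add: oscillation_def)
  qed
  have int: "integrable lborel2 (\<lambda>(x, y). oscillation N \<xi> (x, y))"
    using integrable_oscillation by (simp add: split_beta')
  have "N\<^sup>2 / 8 \<le> (N / 2) * (N / 2 - 1 / N)"
  proof -
    have "4 \<le> N * N" using mult_mono [of 2 N 2 N] N by simp
    then show ?thesis using N by (simp add: power2_eq_square right_diff_distrib)
  qed
  also have "\<dots> = (LBINT x. indicator {?a..?b} x * (N / 2 - 1 / N))"
    using N by simp
  also have "\<dots> \<le> (LBINT x. LBINT y. oscillation N \<xi> (x, y))"
  proof (rule integral_mono [OF _ _ inner])
    show "integrable lborel (\<lambda>x. indicat_real {?a..?b} x * (N / 2 - 1 / N))"
      by (intro integrable_mult_left integrable_indicator_bounded [of _ ?a ?b]) auto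
    show "integrable lborel (\<lambda>x. LBINT y. oscillation N \<xi> (x, y))"
      by (rule lborel_pair.integrable_fst [OF int])
  qed
  also have "\<dots> = (LINT z|lborel2. oscillation N \<xi> z)"
    using lborel_pair.integral_fst [OF int] by (simp add: split_beta')
  finally show ?thesis .
qed

text \<open>Outside the square of \<open>oscillation\<close> the imaginary part of the integrand is
  at least - |\<theta>| R^3, so that region is discarded at this cost. In units of R^3 the square
  gives 1/(10 N^2) * N^2/8 = 1/80; the loss is |\<theta>| times the area 9 N^2, and 1440 = 9 * 160
  limits it to half of that. Finally 2 pi \<le> 8 turns 1/160 into 1/1280.\<close>

lemma Im_trilinear_bump:
  assumes N: "2 \<le> N" and R: "0 \<le> R" and \<xi>: "0 \<le> \<xi>" "\<xi> \<le> 1" and \<theta>: "\<bar>\<theta>\<bar> * (1440 * N\<^sup>2) \<le> 1"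
  shows "R ^ 3 / 1280 \<le> Im (trilinear (mean_phase \<theta>) (bump N R) (bump N R) (bump N R) \<xi>)"
proof -
  let ?a = "bump N R" and ?I = "indicat_real {N..4 * N}"
  define F where "F z = mean_phase \<theta> (fst z - \<xi>) (snd z - \<xi>) * ?a (fst z) * ?a (snd z) * cnj (?a (fst z + snd z - \<xi>))" for z
  have k: "cmod (mean_phase \<theta> p q) \<le> 1" for p q
    using mean_phase_le phase_bound_le_1 order_trans by blast
  note bounded_L1 = bounded_L1_bump [OF R, of N]
  have intF: "integrable lborel2 F"
    unfolding F_def by (rule integrable_trilinear_mean_phase [OF measurable_mean_phase k bounded_L1 bounded_L1 bounded_L1])
  have N2: "4 \<le> N\<^sup>2" using power_mono [of 2 N 2] N by simp
  have ptwise: "R ^ 3 * (1 / (10 * N\<^sup>2) * oscillation N \<xi> z - \<bar>\<theta>\<bar> * (?I (fst z) * ?I (snd z))) \<le> Im (F z)" for z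
  proof -
    obtain x y where z: "z = (x, y)" by (cases z)
    show ?thesis
    proof (cases "x \<in> {N..4 * N} \<and> y \<in> {N..4 * N} \<and> x + y - \<xi> \<in> {N..4 * N}")
      case True
      define p q where "p = x - \<xi>" and "q = y - \<xi>"
      have pq: "0 < p" "0 < q" "p \<le> 4 * N" "q \<le> 4 * N"
        using True N \<xi> by (auto simp: p_def q_def)
      have "p * q \<le> (4 * N) * (4 * N)"
        using pq by (intro mult_mono) auto
      then have "2 * p * q \<le> 1440 * N\<^sup>2"
        using N2 by (simp add: power2_eq_square)
      then have "\<bar>\<theta>\<bar> * (2 * p * q) \<le> 1"
        using mult_left_mono [of "2 * p * q" "1440 * N\<^sup>2" "\<bar>\<theta>\<bar>"] \<theta> by linarith
      then have lower: "(1 - cos (2 * p * q)) / (2 * (2 * p * q)) - \<bar>\<theta>\<bar> \<le> Im (mean_phase \<theta> p q)"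
        by (intro Im_mean_phase_lower pq)
      have "1 / (10 * N\<^sup>2) * oscillation N \<xi> z \<le> (1 - cos (2 * p * q)) / (2 * (2 * p * q))"
      proof (cases "x \<in> {N + \<xi>..3/2 * N + \<xi>} \<and> y \<in> {N + \<xi>..3/2 * N + \<xi>}")
        case True
        then have "p * q \<le> (3/2 * N) * (3/2 * N)"
          using pq by (intro mult_mono) (auto simp: p_def q_def)
        \<comment> \<open>On the square 4 p q is at most 9 N^2; the 10 is rounded up.\<close>
        then have "2 * (2 * p * q) \<le> 10 * N\<^sup>2"
          using N2 by (simp add: power2_eq_square)
        then have "(1 - cos (2 * p * q)) / (10 * N\<^sup>2) \<le> (1 - cos (2 * p * q)) / (2 * (2 * p * q))"
          using pq by (intro divide_left_mono) auto
        then show ?thesis using True by (simp add: oscillation_def z p_def q_def)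
      next
        case False
        then have "oscillation N \<xi> z = 0" by (auto simp: oscillation_def z)
        then show ?thesis using pq by simp
      qed
      with lower have "1 / (10 * N\<^sup>2) * oscillation N \<xi> z - \<bar>\<theta>\<bar> \<le> Im (mean_phase \<theta> p q)" by linarith
      then have "R ^ 3 * (1 / (10 * N\<^sup>2) * oscillation N \<xi> z - \<bar>\<theta>\<bar>) \<le> R ^ 3 * Im (mean_phase \<theta> p q)"
        using R by (intro mult_left_mono) auto
      moreover have "F z = of_real (R ^ 3) * mean_phase \<theta> p q"
        using True by (simp add: F_def z bump_def p_def q_def power3_eq_cube)
      ultimately show ?thesis
        using True by (simp add: z)
    next
      case False
      then have "F z = 0" by (auto simp: F_def z bump_def)
      moreover have "oscillation N \<xi> z = 0"
        using False N \<xi> by (auto simp: oscillation_def z indicator_def)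
      ultimately show ?thesis using R by simp
    qed
  qed
  have int2: "integrable lborel2 (\<lambda>z. R ^ 3 * (1 / (10 * N\<^sup>2) * oscillation N \<xi> z - \<bar>\<theta>\<bar> * (?I (fst z) * ?I (snd z))))"
    by (intro integrable_mult_right Bochner_Integration.integrable_diff integrable_oscillation integrable_indicator_pair)
  have area: "(LINT z|lborel2. ?I (fst z) * ?I (snd z)) = 9 * N\<^sup>2"
  proof -
    have "(LINT z|lborel2. ?I (fst z) * ?I (snd z)) = (LBINT x. LBINT y. ?I x * ?I y)"
      using lborel_pair.integral_fst [of "\<lambda>x y. ?I x * ?I y"] integrable_indicator_pair [of N "4 * N" N "4 * N"] by (simp add: split_beta')
    then show ?thesis using N by (simp add: power2_eq_square)
  qed
  have "R ^ 3 / 160 \<le> R ^ 3 * (1 / (10 * N\<^sup>2) * (N\<^sup>2 / 8) - \<bar>\<theta>\<bar> * (9 * N\<^sup>2))"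
  proof -
    have "1 / 160 \<le> 1 / (10 * N\<^sup>2) * (N\<^sup>2 / 8) - \<bar>\<theta>\<bar> * (9 * N\<^sup>2)"
      using N \<theta> by simp
    then show ?thesis
      using R mult_left_mono [of "1/160" _ "R ^ 3"] by fastforce
  qed
  also have "\<dots> \<le> R ^ 3 * (1 / (10 * N\<^sup>2) * (LINT z|lborel2. oscillation N \<xi> z) - \<bar>\<theta>\<bar> * (9 * N\<^sup>2))"
    using R integral_oscillation [OF N, of \<xi>] by (intro mult_left_mono diff_right_mono) auto
  also have "\<dots> = (LINT z|lborel2. R ^ 3 * (1 / (10 * N\<^sup>2) * oscillation N \<xi> z - \<bar>\<theta>\<bar> * (?I (fst z) * ?I (snd z))))"
    using integrable_oscillation [of N \<xi>] integrable_indicator_pair [of N "4 * N" N "4 * N"]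
    by (simp only: integral_mult_right_zero Bochner_Integration.integral_diff integrable_mult_right area)
  also have "\<dots> \<le> (LINT z|lborel2. Im (F z))"
    by (rule integral_mono [OF int2 integrable_Im [OF intF] ptwise])
  also have "\<dots> = Im (LINT z|lborel2. F z)"
    by (rule Bochner_Integration.integral_Im [OF intF])
  finally have Im: "R ^ 3 / 160 \<le> Im (LINT z|lborel2. F z)" .
  have "R ^ 3 / 1280 = R ^ 3 / 160 / 8" by simp
  also have "\<dots> \<le> R ^ 3 / 160 / (2 * pi)"
    using R pi_less_4 by (intro divide_left_mono) auto
  also have "\<dots> \<le> Im (LINT z|lborel2. F z) / (2 * pi)"
    using Im by (intro divide_right_mono) auto
  also have "\<dots> = Im (trilinear (mean_phase \<theta>) ?a ?a ?a \<xi>)"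
    unfolding trilinear_def F_def by (simp only: Im_divide_of_real)
  finally show ?thesis .
qed

lemma inner_imult_left:
  assumes "square_integrable f" "square_integrable g"
  shows "imult (L2_of f) \<bullet> L2_of g = L2_of f \<bullet> L2_of (\<lambda>x. - \<i> * g x)"
  unfolding imult_L2_of [OF assms(1)] inner_L2_of [OF square_integrable_cmult [OF assms(1)] assms(2)]
    inner_L2_of [OF assms(1) square_integrable_cmult [OF assms(2)]]
  by (rule Bochner_Integration.integral_cong [OF refl]) (simp add: inner_complex_def)

lemma inner_imult_low_mode: "imult w \<bullet> low_mode = w \<bullet> L2_of (\<lambda>x. - \<i> * indicator {0..1} x)"
proof (cases w rule: L2_of_exhaust)
  case (1 f)
  then show ?thesis
    using inner_imult_left [OF 1(1) square_integrable_low_mode [of 1]] by (simp only: mult_1_left)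
qed

text \<open>The real inner product of i h with 1 is - Im h, which turns the lower bound on the
  imaginary part over [0, 1] into this upper bound.\<close>

lemma mean_cubic_bump_low_mode:
  assumes N: "2 \<le> N" and R: "0 \<le> R" and \<theta>: "\<bar>\<theta>\<bar> * (1440 * N\<^sup>2) \<le> 1"
  shows "imult (mean_cubic \<theta> (L2_of (bump N R))) \<bullet> low_mode \<le> - (R ^ 3 / 1280)"
proof -
  let ?a = "bump N R"
  note bounded_L1 = bounded_L1_bump [OF R, of N]
  define h where "h = trilinear (mean_phase \<theta>) ?a ?a ?a"
  have h: "square_integrable h"
    unfolding h_def by (rule bounded_L1D(4) [OF trilinear_bounded_L1(1) [OF measurable_phase_bound measurable_mean_phase phase_bound_even bounded_L1D(3) [OF bounded_L1] bounded_L1D(3) [OF bounded_L1] mean_phase_le bounded_L1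
          weight_bound_L2 [OF bounded_L1D(4) [OF bounded_L1]]]]) simp
  have "R ^ 3 / 1280 = (LBINT x. R ^ 3 / 1280 * indicator {0..1::real} x)"
    by simp
  also have "\<dots> \<le> (LBINT x. - ((\<i> * h x) \<bullet> (1 * indicator {0..1} x)))"
  proof (rule integral_mono)
    show "integrable lborel (\<lambda>x. R ^ 3 / 1280 * indicator {0..1::real} x)"
      by (intro integrable_mult_right integrable_indicator_bounded [of _ 0 1]) auto
    show "integrable lborel (\<lambda>x. - ((\<i> * h x) \<bullet> (1 * indicator {0..1} x)))"
      by (intro Bochner_Integration.integrable_minus integrable_inner_square_integrable square_integrable_cmult h square_integrable_low_mode)
    show "R ^ 3 / 1280 * indicator {0..1} x \<le> - ((\<i> * h x) \<bullet> (1 * indicator {0..1} x))" for x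
      using Im_trilinear_bump [OF N R, of x \<theta>] \<theta> by (cases "x \<in> {0..1}") (auto simp: h_def inner_complex_def)
  qed
  also have "\<dots> = - (imult (L2_of h) \<bullet> low_mode)"
    unfolding imult_L2_of [OF h] inner_L2_of [OF square_integrable_cmult [OF h] square_integrable_low_mode] by (rule Bochner_Integration.integral_minus)
  finally show ?thesis
    unfolding mean_cubic_L2_of [OF bounded_L1] h_def by linarith
qed

lemma bump_low_mode:
  assumes "2 \<le> N" "0 \<le> R"
  shows "L2_of (bump N R) \<bullet> low_mode = 0"
proof -
  have "(LBINT x. bump N R x \<bullet> (1 * indicator {0..1} x)) = (LBINT (x::real). 0)"
    using assms by (intro Bochner_Integration.integral_cong [OF refl]) (auto simp: bump_def indicator_def)
  then show ?thesis
    unfolding inner_L2_of [OF bounded_L1D(4) [OF bounded_L1_bump [OF assms(2)]] square_integrable_low_mode] by simp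
qed

text \<open>The conditions on c have one purpose each: 45000 makes the short-time bound last until
  T, 1440 keeps \<gamma> T N^2 small, and 3 * 10^14 makes the error at most half of the main term.
  The latter is T R^3 = c m^(27 - 24), up to a constant.\<close>

lemma norm_inflation:
  fixes \<gamma> s m c :: real
  assumes s: "s < - 3/2" and m: "2 \<le> m" and c: "0 < c" "45000 * c \<le> 1" "\<bar>\<gamma>\<bar> * c * 1440 \<le> 1"
    and mc: "3 * 10 ^ 14 * c \<le> m\<^sup>2"
  obtains u0 u where "smooth_L2 u0" "GT_solution \<gamma> u0 u" "Hs_norm s u0 \<le> 2 / m ^ 3"
    "sqrt (2 powr s) * (c * m ^ 3 / 2560) \<le> Hs_norm s (u (c / m ^ 24))"
proof -
  define N R T where "N = m ^ 12" and "R = m ^ 9" and "T = c / m ^ 24"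
  have m0: "0 < m" "1 \<le> m" using m by auto
  have N: "2 \<le> N" "0 \<le> N"
    using power_increasing [of 1 12 m] m by (simp_all add: N_def)
  have R: "0 < R" "0 \<le> R" using m0 by (simp_all add: R_def)
  have T: "0 < T" using c m0 by (simp add: T_def)
  define w0 where "w0 = L2_of (bump N R)"
  note bounded_L1 = bounded_L1_bump [OF R(2), of N]
  \<comment> \<open>The bump has supremum R but L^1 norm 3 N R, so the common bound is 3 R.\<close>
  have L1_Linf_w0: "L1_Linf N (3 * R) w0"
    unfolding w0_def
  proof (rule L1_Linf_L2_of)
    show "bounded_L1 (3 * R) (bump N R)"
      using bounded_L1 R by (auto simp: bounded_L1_def intro: order_trans)
    show "(LBINT x. cmod (bump N R x)) \<le> N * (3 * R)"
      using integral_bump [OF R(2) N(2)] by simp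
  qed
  have w0: "w0 \<noteq> 0"
    using norm_bump [OF R(2) N(2)] N R by (auto simp: w0_def)
  \<comment> \<open>The constant is 625 * 216 / 3 = 45000, and m^2 R^2 T = c m^(20 - 24).\<close>
  have CT: "(25 * m)\<^sup>2 * (2 * (3 * R)) ^ 3 * T \<le> 3 * R"
  proof -
    have "(25 * m)\<^sup>2 * (2 * (3 * R)) ^ 3 * T = 3 * R * (45000 * c * (m ^ 20 / m ^ 24))"
      by (simp add: T_def R_def power_mult_distrib flip: power_mult power_add)
    also have "m ^ 20 / m ^ 24 \<le> 1"
      using m0 by (simp add: power_increasing)
    then have "45000 * c * (m ^ 20 / m ^ 24) \<le> 1 * 1"
      using c m0 by (intro mult_mono) auto
    then have "3 * R * (45000 * c * (m ^ 20 / m ^ 24)) \<le> 3 * R * 1"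
      using R by (intro mult_left_mono) auto
    finally show ?thesis by simp
  qed
  obtain v \<kappa> where v: "continuous_on UNIV v" "0 \<le> \<kappa>" "\<And>t. L1_Linf N (3 * R * exp (\<kappa> * \<bar>t\<bar>)) (v t)"
    "\<And>t. v t = w0 + (LBINT \<tau>=ereal 0..ereal t. imult (mean_cubic (\<gamma> * \<tau>) (v \<tau>)))"
    "\<And>t. \<bar>t\<bar> \<le> T \<Longrightarrow> L1_Linf N (2 * (3 * R)) (v t)"
    using interaction_solution [OF L1_Linf_w0 [unfolded N_def] w0 m0(1) CT, of \<gamma>] unfolding N_def by blast
  define u where "u t = inv fourier (propagator (\<gamma> * t) (v t))" for t
  have sol: "GT_solution \<gamma> (inv fourier w0) u"
    unfolding u_def by (rule GT_solution_interaction [OF v(1,3) N(2) v(2,4)])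
  define g where "g \<tau> = imult (mean_cubic (\<gamma> * \<tau>) (v \<tau>))" for \<tau>
  have g: "continuous_on UNIV g"
    unfolding g_def by (rule continuous_on_compose2 [OF linear_continuous_on [OF bounded_linear_imult] continuous_mean_cubic [OF v(1,3) N(2) v(2)]]) auto
  have v_eq: "v t = w0 + (LBINT \<tau>=ereal 0..ereal t. g \<tau>)" for t
    unfolding g_def by (rule v(4))
  let ?C = "(25 * m)\<^sup>2 * (2 * (3 * R)) ^ 3"
  have diff: "L1_Linf N (?C * T) (v t - w0)" if t: "t \<in> closed_segment 0 T" for t
  proof -
    have t': "\<bar>t\<bar> \<le> T" using t T by (auto simp: closed_segment_eq_real_ivl)
    have 1: "L1_Linf N (0 + \<bar>LBINT x=ereal 0..ereal t. ?C\<bar>) (0 + (LBINT \<tau>=ereal 0..ereal t. g \<tau>))"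
    proof (rule L1_Linf_interval_integral [OF L1_Linf_0 g _ N(2)])
      fix x assume "x \<in> closed_segment 0 t"
      then have "\<bar>x\<bar> \<le> T"
        using t' by (auto simp: closed_segment_eq_real_ivl split: if_splits)
      then show "L1_Linf N ?C (g x)"
        unfolding g_def N_def by (intro L1_Linf_imult L1_Linf_mean_cubic_product v(5) [unfolded N_def] m0)
    qed (use N in auto)
    have 2: "\<bar>LBINT x=ereal 0..ereal t. ?C\<bar> \<le> ?C * T"
    proof -
      have "\<bar>LBINT x=ereal 0..ereal t. ?C\<bar> = \<bar>t\<bar> * ?C"
        using R by (simp add: interval_integral_const_real abs_mult)
      also have "\<dots> \<le> T * ?C"
        using t' R by (intro mult_right_mono) auto
      finally show ?thesis by (simp only: mult.commute)
    qed
    have "L1_Linf N (?C * T) (0 + (LBINT \<tau>=ereal 0..ereal t. g \<tau>))"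
      by (rule L1_Linf_mono [OF 1 _ N(2)]) (simp only: add_0 2)
    moreover have "v t - w0 = 0 + (LBINT \<tau>=ereal 0..ereal t. g \<tau>)"
      using v_eq [of t] by simp
    ultimately show ?thesis by (simp only:)
  qed
  have lower: "R ^ 3 / 2560 \<le> - (g t \<bullet> low_mode)" if t: "t \<in> closed_segment 0 T" for t
  proof -
    have t': "0 \<le> t" "t \<le> T" using t T by (auto simp: closed_segment_eq_real_ivl)
    have "\<bar>\<gamma> * t\<bar> * (1440 * N\<^sup>2) \<le> \<bar>\<gamma>\<bar> * T * (1440 * N\<^sup>2)"
      using t' by (intro mult_right_mono) (auto simp: abs_mult mult_left_mono)
    also have "\<dots> = \<bar>\<gamma>\<bar> * c * 1440"
      using m0 by (simp add: T_def N_def flip: power_mult)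
    finally have \<theta>: "\<bar>\<gamma> * t\<bar> * (1440 * N\<^sup>2) \<le> 1" using c by linarith
    have main: "imult (mean_cubic (\<gamma> * t) w0) \<bullet> low_mode \<le> - (R ^ 3 / 1280)"
      unfolding w0_def by (rule mean_cubic_bump_low_mode [OF N(1) R(2) \<theta>])
    let ?w = "L2_of (\<lambda>x. - \<i> * indicator {0..1} x)"
    have "\<bar>(mean_cubic (\<gamma> * t) (v t) - mean_cubic (\<gamma> * t) w0) \<bullet> ?w\<bar>
        \<le> 7 * (25 * m)\<^sup>2 * (2 * (3 * R))\<^sup>2 * (?C * T) * (LBINT x. cmod (- \<i> * indicator {0..1::real} x))"
    proof (rule mean_cubic_diff_dual_test)
      show "L1_Linf (m ^ 12) (2 * (3 * R)) (v t)"
        using v(5) t' by (simp add: N_def)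
      show "L1_Linf (m ^ 12) (2 * (3 * R)) w0"
        using L1_Linf_mono [OF L1_Linf_w0 _ N(2), of "2 * (3 * R)"] R by (simp add: N_def)
      show "L1_Linf (m ^ 12) (?C * T) (v t - w0)"
        using diff [OF t] by (simp add: N_def)
      show "?C * T \<le> 2 * (3 * R)"
        using CT R by linarith
    qed (intro m0 square_integrable_low_mode integrable_low_mode)+
    \<comment> \<open>21262500000 = 7 * 625 * 36 * 625 * 216; the exponent 49 consists of 4 from the
      weights and 45 from R^5.\<close>
    also have "\<dots> = 21262500000 * c * (m ^ 49 / m ^ 24)"
      unfolding integral_low_mode by (simp add: T_def R_def power_mult_distrib flip: power_mult power_add)
    also have "m ^ 49 / m ^ 24 = m ^ 25"
      using m0 by (simp add: power_diff [symmetric])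
    also have "21262500000 * c * m ^ 25 \<le> R ^ 3 / 2560"
    proof -
      have "21262500000 * c * 2560 \<le> 3 * 10 ^ 14 * c"
        using c by simp
      also have "\<dots> \<le> m\<^sup>2" by (rule mc)
      finally have "21262500000 * c * 2560 * m ^ 25 \<le> m\<^sup>2 * m ^ 25"
        using m0 by (intro mult_right_mono) auto
      also have "m\<^sup>2 * m ^ 25 = R ^ 3"
        by (simp add: R_def flip: power_mult power_add)
      finally show ?thesis by simp
    qed
    finally have err: "\<bar>imult (mean_cubic (\<gamma> * t) (v t) - mean_cubic (\<gamma> * t) w0) \<bullet> low_mode\<bar> \<le> R ^ 3 / 2560"
      by (simp only: inner_imult_low_mode)
    have "g t \<bullet> low_mode = imult (mean_cubic (\<gamma> * t) w0) \<bullet> low_mode + imult (mean_cubic (\<gamma> * t) (v t) - mean_cubic (\<gamma> * t) w0) \<bullet> low_mode"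
      by (simp add: g_def linear_diff [OF bounded_linear.linear [OF bounded_linear_imult]] inner_diff_left)
    with main err show ?thesis by linarith
  qed
  \<comment> \<open>The data have no low frequencies, and the pairing of the derivative has a fixed
    sign on [0, T], so it accumulates without cancellation.\<close>
  have "v T \<bullet> low_mode = w0 \<bullet> low_mode + (LBINT \<tau>=ereal 0..ereal T. g \<tau>) \<bullet> low_mode"
    by (subst v_eq) (rule inner_add_left)
  also have "\<dots> = (LBINT \<tau>=ereal 0..ereal T. g \<tau> \<bullet> low_mode)"
    unfolding w0_def bump_low_mode [OF N(1) R(2)]
    using interval_integral_bounded_linear(1) [OF bounded_linear_inner_left interval_integrable_continuous [OF g]] by simp
  finally have vT: "v T \<bullet> low_mode = (LBINT \<tau>=ereal 0..ereal T. g \<tau> \<bullet> low_mode)" .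
  have "(LBINT \<tau>=ereal 0..ereal T. - (g \<tau> \<bullet> low_mode)) = - (v T \<bullet> low_mode)"
    unfolding vT by (rule interval_lebesgue_integral_uminus)
  moreover have "(LBINT \<tau>=ereal 0..ereal T. R ^ 3 / 2560) = T * (R ^ 3 / 2560)"
    by (simp only: interval_integral_const_real real_scaleR_def diff_zero)
  moreover have "norm (LBINT \<tau>=ereal 0..ereal T. R ^ 3 / 2560) \<le> \<bar>LBINT \<tau>=ereal 0..ereal T. - (g \<tau> \<bullet> low_mode)\<bar>"
    by (rule norm_interval_integral_le) (use lower R in \<open>auto intro!: continuous_intros g\<close>)
  ultimately have "T * (R ^ 3 / 2560) \<le> \<bar>v T \<bullet> low_mode\<bar>"
    using abs_ge_self [of "T * (R ^ 3 / 2560)"] by (simp only: real_norm_def abs_minus_cancel) 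
  moreover have "T * (R ^ 3 / 2560) = c * m ^ 3 / 2560"
  proof -
    have "R ^ 3 = m ^ 3 * m ^ 24"
      by (simp add: R_def flip: power_mult power_add)
    moreover have "(c / q) * (r * q / 2560) = c * r / 2560" if "q \<noteq> 0" for q r :: real
      using that by simp
    ultimately show ?thesis
      unfolding T_def using m0 by (metis power_not_zero less_irrefl)
  qed
  ultimately have low_mode: "c * m ^ 3 / 2560 \<le> \<bar>v T \<bullet> low_mode\<bar>" by simp
  show ?thesis
  proof (rule that [OF _ sol])
    show "smooth_L2 (inv fourier w0)"
      unfolding w0_def by (rule smooth_bump [OF R(2)])
    have "Hs_norm s (inv fourier w0) \<le> 2 * R / N"
      unfolding w0_def using N by (intro Hs_norm_bump s R) auto
    also have "2 * R / N = 2 / m ^ 3"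
    proof -
      have "N = R * m ^ 3" by (simp add: N_def R_def flip: power_add)
      then show ?thesis using R m0 by simp
    qed
    finally show "Hs_norm s (inv fourier w0) \<le> 2 / m ^ 3" .
    have "sqrt (2 powr s) * (c * m ^ 3 / 2560) \<le> sqrt (2 powr s) * \<bar>v T \<bullet> low_mode\<bar>"
      by (intro mult_left_mono low_mode) simp
    also have "\<dots> \<le> Hs_norm s (u T)"
      unfolding u_def using s by (intro Hs_norm_lower) simp
    finally show "sqrt (2 powr s) * (c * m ^ 3 / 2560) \<le> Hs_norm s (u (c / m ^ 24))"
      by (simp add: T_def)
  qed
qed

theorem theorem1p4:
  fixes \<gamma> s :: real
  assumes "\<gamma> \<noteq> 0" and "s < - 3 / 2"
  shows "(\<forall>\<epsilon>>0. \<exists>u0 u T. smooth_L2 u0 \<and> GT_solution \<gamma> u0 u \<and>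
            Hs_norm s u0 < \<epsilon> \<and> \<bar>T\<bar> < \<epsilon> \<and> Hs_norm s (u T) > 1 / \<epsilon>) \<and>
         (\<forall>T>0. \<not> GT_continuous_at_0 \<gamma> s T)"
proof
  show inflation: "\<forall>\<epsilon>>0. \<exists>u0 u T. smooth_L2 u0 \<and> GT_solution \<gamma> u0 u \<and>
            Hs_norm s u0 < \<epsilon> \<and> \<bar>T\<bar> < \<epsilon> \<and> Hs_norm s (u T) > 1 / \<epsilon>"
  proof (intro allI impI)
    fix \<epsilon> :: real assume \<epsilon>: "\<epsilon> > 0"
    \<comment> \<open>Small enough for the constraints that involve c and \<gamma> alone; it does
      not depend on \<epsilon>.\<close>
    define c where "c = 1 / (45000 + 1440 * \<bar>\<gamma>\<bar>)"
    have c: "0 < c" "45000 * c \<le> 1" "\<bar>\<gamma>\<bar> * c * 1440 \<le> 1" "c \<le> 1"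
      by (auto simp: c_def divide_simps add_pos_nonneg)
    define d where "d = sqrt (2 powr s) * c"
    have d: "0 < d" using c by (simp add: d_def)
    \<comment> \<open>One summand for each requirement: m \<ge> 2, the error bound, the size
      1/\<epsilon> of the solution, and the smallness of both data and time.\<close>
    define m where "m = 2 + 3 * 10 ^ 14 * c + 2560 / (d * \<epsilon>) + 2 / \<epsilon>"
    have pos: "0 < 3 * 10 ^ 14 * c" "0 < 2560 / (d * \<epsilon>)" "0 < 2 / \<epsilon>"
      using c d \<epsilon> by simp_all
    have m: "2 \<le> m" "3 * 10 ^ 14 * c \<le> m" "2560 / (d * \<epsilon>) < m" "2 / \<epsilon> < m"
      using pos unfolding m_def by linarith+
    have m_pow: "m \<le> m ^ k" if "1 \<le> k" for k
      using power_increasing [OF that, of m] m by simp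
    obtain u0 u where u: "smooth_L2 u0" "GT_solution \<gamma> u0 u" "Hs_norm s u0 \<le> 2 / m ^ 3"
      "sqrt (2 powr s) * (c * m ^ 3 / 2560) \<le> Hs_norm s (u (c / m ^ 24))"
      using norm_inflation [OF _ m(1) c(1,2,3), of s] assms(2) order_trans [OF m(2) m_pow [of 2]] by auto
    have "2 / m < \<epsilon>"
      using m(1,4) \<epsilon> by (simp add: field_simps)
    moreover have "2 / m ^ 3 \<le> 2 / m"
      using m m_pow [of 3] by (intro divide_left_mono) auto
    moreover have "c / m ^ 24 \<le> 2 / m"
      using m m_pow [of 24] c by (intro frac_le) auto
    moreover have "0 < c / m ^ 24" using c m by simp
    moreover have "1 / \<epsilon> < sqrt (2 powr s) * (c * m ^ 3 / 2560)"
    proof -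
      have "1 / \<epsilon> = d * (2560 / (d * \<epsilon>)) / 2560"
        using d \<epsilon> by simp
      also have "\<dots> < d * m ^ 3 / 2560"
        using d m(3) m_pow [of 3] by (intro divide_strict_right_mono mult_strict_left_mono) auto
      finally show ?thesis by (simp add: d_def)
    qed
    ultimately show "\<exists>u0 u T. smooth_L2 u0 \<and> GT_solution \<gamma> u0 u \<and>
            Hs_norm s u0 < \<epsilon> \<and> \<bar>T\<bar> < \<epsilon> \<and> Hs_norm s (u T) > 1 / \<epsilon>"
      using u by (intro exI [of _ u0] exI [of _ u] exI [of _ "c / m ^ 24"]) auto
  qed
  show "\<forall>T>0. \<not> GT_continuous_at_0 \<gamma> s T"
  proof (intro allI impI notI)
    fix T :: real assume T: "T > 0" and cont: "GT_continuous_at_0 \<gamma> s T"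
    obtain \<delta> where \<delta>: "\<delta> > 0" and le: "\<And>u0 u. smooth_L2 u0 \<Longrightarrow> GT_solution \<gamma> u0 u \<Longrightarrow> Hs_norm s u0 < \<delta> \<Longrightarrow>
        (SUP t\<in>{-T<..<T}. ereal (Hs_norm s (u t))) < ereal 1"
      using cont unfolding GT_continuous_at_0_def by (metis zero_less_one)
    \<comment> \<open>At most \<delta> and T, so that data and time are admissible, and at most 1,
      so that the inflated norm exceeds the bound 1 taken from continuity.\<close>
    define \<epsilon> where "\<epsilon> = min 1 (min \<delta> T)"
    have \<epsilon>: "0 < \<epsilon>" "\<epsilon> \<le> 1" "\<epsilon> \<le> \<delta>" "\<epsilon> \<le> T"
      using \<delta> T by (auto simp: \<epsilon>_def)
    obtain u0 u t where u: "smooth_L2 u0" "GT_solution \<gamma> u0 u" "Hs_norm s u0 < \<epsilon>" "\<bar>t\<bar> < \<epsilon>" "Hs_norm s (u t) > 1 / \<epsilon>"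
      using inflation \<epsilon>(1) by blast
    have "ereal (Hs_norm s (u t)) \<le> (SUP t\<in>{-T<..<T}. ereal (Hs_norm s (u t)))"
      using u(4) \<epsilon> by (intro SUP_upper) auto
    also have "\<dots> < ereal 1"
      using u \<epsilon> by (intro le) auto
    finally have "Hs_norm s (u t) < 1" by simp
    moreover have "1 \<le> 1 / \<epsilon>" using \<epsilon> by simp
    ultimately show False using u(5) by linarith
  qed
qed

end
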